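(* For every even positive integer $t$, $$\sum_{\lambda\in \mathcal{SC}}q^{|\lambda|}x^{|\mathcal{H}_t(\lambda)|}b^{\mathrm{BG}(\lambda)}\prod_{h\in\mathcal{H}_t(\lambda)}\frac{1}{h^{1/2}}=\left(q^{2t};q^{2t}\right)_{\infty}^{t/2}\left(-bq;q^4\right)_{\infty}\left(-q^3/b;q^4\right)_{\infty}\exp\left(\frac{x^2q^{2t}}{2}+\frac{x^4q^{4t}}{4t}\right).$$
   Context: A partition is a finite nonincreasing sequence $\lambda=(\lambda_1,\dots,\lambda_\ell)$ of positive integers (the empty partition is allowed), and $|\lambda|$ is the sum of its parts. A partition is identified with its Ferrers diagram, the set of boxes $(i,j)$ (row $i$, column $j$) with $1\le j\le\lambda_i$. The conjugate $\lambda'$ is given by $\lambda'_j=\#\{i:\lambda_i\ge j\}$; $\mathcal{SC}$ is the set of self-conjugate partitions ($\lambda=\lambda'$). The hook-length of a box $(i,j)$ is $\lambda_i-j+\lambda'_j-i+1$; $\mathcal{H}_t(\lambda)$ is the multiset of hook-lengths of $\lambda$ divisible by $t$ (cardinality and products are taken with multiplicity; empty products are $1$). The BG-rank is $\mathrm{BG}(\lambda)=\sum_{(i,j)\in\lambda}(-1)^{i+j}$. Also $(a;q)_\infty=\prod_{j\ge0}(1-aq^j)$. The identity is one of formal power series in $q$ whose coefficients are polynomials in $x,b,b^{-1}$. *)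

theory Defs
  imports
    "HOL-Analysis.Analysis"
    "HOL-Computational_Algebra.Computational_Algebra"
    "HOL-Library.Poly_Mapping"
    "HOL-Library.Multiset"
begin

section \<open>Partitions\<close>

definition is_partition :: "nat list \<Rightarrow> bool" where
  "is_partition l \<longleftrightarrow> sorted_wrt (\<ge>) l \<and> (\<forall>k \<in> set l. 0 < k)"

text \<open>Parts are numbered from 1; \<open>part l i\<close> is 0 beyond the last part.\<close>

definition part :: "nat list \<Rightarrow> nat \<Rightarrow> nat" where
  "part l i = (if 1 \<le> i \<and> i \<le> length l then l ! (i - 1) else 0)"

definition conj_part :: "nat list \<Rightarrow> nat \<Rightarrow> nat" where
  "conj_part l j = card {i. 1 \<le> i \<and> i \<le> length l \<and> j \<le> part l i}"

text \<open>The conjugate has exactly \<open>part l 1\<close> nonzero parts.\<close>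

definition conjugate :: "nat list \<Rightarrow> nat list" where
  "conjugate l = map (conj_part l) [1..<Suc (part l 1)]"

definition self_conjugate_partitions :: "nat list set" where
  "self_conjugate_partitions = {l. is_partition l \<and> conjugate l = l}"

definition diagram :: "nat list \<Rightarrow> (nat \<times> nat) set" where
  "diagram l = {(i, j). 1 \<le> i \<and> i \<le> length l \<and> 1 \<le> j \<and> j \<le> part l i}"

text \<open>Neither subtraction truncates when \<open>(i, j)\<close> is a box of the diagram.\<close>

definition hook_length :: "nat list \<Rightarrow> nat \<times> nat \<Rightarrow> nat" where
  "hook_length l = (\<lambda>(i, j). (part l i - j) + (conj_part l j - i) + 1)"

definition hooks_dvd :: "nat \<Rightarrow> nat list \<Rightarrow> nat multiset" where
  "hooks_dvd t l = filter_mset (\<lambda>h. t dvd h) (image_mset (hook_length l) (mset_set (diagram l)))"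

definition BG_rank :: "nat list \<Rightarrow> int" where
  "BG_rank l = (\<Sum>(i, j) \<in> diagram l. (- 1) ^ (i + j))"

section \<open>Power series in \<open>q\<close> over polynomials in \<open>x\<close>, \<open>b\<close> and the inverse of \<open>b\<close>\<close>

text \<open>
  A Laurent polynomial in \<open>b\<close> over the reals with \<open>x\<close> adjoined is a finitely supported map from
  exponents of \<open>b\<close> to polynomials in \<open>x\<close>; the product of \<open>poly_mapping\<close> is convolution.
  Infinite sums and products of power series refer to the metric of \<open>fps\<close>, which is the
  \<open>q\<close>-adic one.
\<close>

type_synonym laurent = "int \<Rightarrow>\<^sub>0 real poly"
type_synonym qseries = "laurent fps"

definition scalar :: "real \<Rightarrow> qseries" where
  "scalar c = fps_const (Poly_Mapping.single 0 [:c:])"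

definition x_var :: qseries where
  "x_var = fps_const (Poly_Mapping.single 0 [:0, 1:])"

definition b_pow :: "int \<Rightarrow> qseries" where
  "b_pow k = fps_const (Poly_Mapping.single k 1)"

definition q_var :: qseries where
  "q_var = fps_X"

definition qpoch_inf :: "qseries \<Rightarrow> qseries \<Rightarrow> qseries" where
  "qpoch_inf a q = prodinf (\<lambda>j. 1 - a * q ^ j)"

text \<open>
  The exponential series \<open>\<Sum>n. f ^ n / n!\<close>, meaningful when \<open>f\<close> has constant term 0.
  (\<open>fps_exp\<close> itself needs coefficients in a field.)
\<close>

definition exp_qseries :: "qseries \<Rightarrow> qseries" where
  "exp_qseries f = fps_compose (Abs_fps (\<lambda>n. Poly_Mapping.single 0 [:1 / fact n:])) f"

end

theory Submission
  imports Defs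
begin

text \<open>
  A partition is encoded by its Maya diagram, the set of integers \<open>\<lambda>\<^sub>i - i\<close> for \<open>i \<ge> 1\<close>; its hook
  lengths are the differences \<open>a - b > 0\<close> with \<open>a\<close> in the diagram and \<open>b\<close> outside, and
  self-conjugate partitions are the diagrams that are exchanged with their complement by
  \<open>s \<mapsto> -1 - s\<close>.  For \<open>t = 2 u\<close> no residue class modulo \<open>t\<close> is fixed by this reflection, so a
  self-conjugate diagram amounts to \<open>u\<close> arbitrary diagrams, one on each residue class \<open>k < u\<close>,
  and a hook length divisible by \<open>t\<close> occurs twice, as \<open>t\<close> times a hook length of one of the \<open>u\<close>
  runners.  A runner splits into its charge, which carries the powers of \<open>b\<close>, and a diagram of
  charge 0, that is, a partition.  So the sum over self-conjugate partitions equals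
  \<open>\<Theta> * (\<Sum>\<nu>. w \<nu>) ^ u\<close>, where \<open>\<Theta>\<close> does not depend on the weight \<open>w\<close>.
  For \<open>w\<close> without \<open>x\<close> the left-hand side is the product over the odd diagonal hooks, and
  \<open>\<Sum>\<nu>. q ^ (2 t |\<nu>|) = 1 / (q\<^sup>2\<^sup>t; q\<^sup>2\<^sup>t)\<close>; this determines \<open>\<Theta>\<close>.
  For the hook weight, \<open>\<Sum>\<nu>. z ^ |\<nu>| / H(\<nu>) = exp (z + z\<^sup>2 / 2)\<close>, because
  the coefficients \<open>s n\<close> satisfy \<open>(n + 1) s (n + 1) = s n + s (n - 1)\<close>.  This recursion comes from
  the up and down rules for \<open>1 / H\<close> in Young's lattice (two instances of Lagrange
  interpolation) and the fact that a partition has one more addable than removable box.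
\<close>

section \<open>Generating functions of weighted sets\<close>

text \<open>The constants of the theorem can be read off a runner. The position
  \<open>k + t * m\<close> and its mirror image together contribute 2 k + 1 + 2 t m to the size, so
  one box on a runner costs q^(2t). It stands for two hooks of length t h, whose weights multiply to
  x^2 / (t h): the doubling removes the square root. Hence z = x^2 q^(2t) / t, and the power u = t/2
  of exp (z + z^2/2) has the exponent x^2 q^(2t) / 2 + x^4 q^(4t) / (4t). Weights that are invariant
  under shifts cannot see the charge, which is why one factor \<Theta> serves two different weights.
  The coefficients form only an integral domain. Therefore the exponential is recognised by its
  differential equation, and the partition series is removed by multiplying with its inverse
  product. Identities are proved coefficient by coefficient on index sets with finite fibres, and
  the infinite sum of the theorem is recovered from them at the end.\<close>

definition finite_fibres :: "('a \<Rightarrow> nat) \<Rightarrow> 'a set \<Rightarrow> bool" where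
  "finite_fibres d A \<longleftrightarrow> (\<forall>n. finite {a \<in> A. d a = n})"

definition gf :: "'a set \<Rightarrow> ('a \<Rightarrow> nat) \<Rightarrow> ('a \<Rightarrow> 'b::comm_ring_1) \<Rightarrow> 'b fps" where
  "gf A d w = Abs_fps (\<lambda>n. \<Sum>a | a \<in> A \<and> d a = n. w a)"

lemma gf_nth: "fps_nth (gf A d w) n = (\<Sum>a | a \<in> A \<and> d a = n. w a)"
  by (simp add: gf_def)

lemma gf_cong:
  assumes "\<And>a. a \<in> A \<Longrightarrow> d a = d' a" "\<And>a. a \<in> A \<Longrightarrow> w a = w' a"
  shows "gf A d w = gf A d' w'"
  by (rule fps_ext) (auto simp: gf_nth assms intro!: sum.cong)

lemma finite_fibres_le:
  assumes "finite_fibres d A" shows "finite {a \<in> A. d a \<le> n}"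
proof -
  have "{a \<in> A. d a \<le> n} = (\<Union>i\<le>n. {a \<in> A. d a = i})" by auto
  then show ?thesis using assms by (auto simp: finite_fibres_def)
qed

text \<open>The coefficient of q^n is already exact for every finite set that contains the fibre
  over n, and this is convergence in the q-adic metric. The lemma leads from coefficient identities
  to the \<open>has_sum\<close> of the theorem.\<close>

lemma gf_has_sum:
  assumes "finite_fibres d A"
  shows "((\<lambda>a. fps_const (w a) * fps_X ^ d a) has_sum gf A d w) A"
  unfolding has_sum_def
proof (rule tendsto_fpsI)
  fix n
  have fin: "finite {a \<in> A. d a = n}" using assms by (simp add: finite_fibres_def)
  show "\<forall>\<^sub>F F in finite_subsets_at_top A.
      fps_nth (\<Sum>a\<in>F. fps_const (w a) * fps_X ^ d a) n = fps_nth (gf A d w) n"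
    unfolding eventually_finite_subsets_at_top
  proof (intro exI[of _ "{a \<in> A. d a = n}"] conjI allI impI)
    fix F assume F: "finite F \<and> {a \<in> A. d a = n} \<subseteq> F \<and> F \<subseteq> A"
    have "fps_nth (\<Sum>a\<in>F. fps_const (w a) * fps_X ^ d a) n = (\<Sum>a\<in>F. if d a = n then w a else 0)"
      by (auto simp: fps_sum_nth fps_X_power_nth intro!: sum.cong)
    also have "\<dots> = (\<Sum>a | a \<in> A \<and> d a = n. w a)"
      using F by (subst sum.inter_filter[symmetric]) (auto intro!: sum.cong)
    finally show "fps_nth (\<Sum>a\<in>F. fps_const (w a) * fps_X ^ d a) n = fps_nth (gf A d w) n"
      by (simp add: gf_nth)
  qed (use fin in auto)
qed

lemma finite_fibres_reindex:
  assumes "bij_betw f A B"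
  shows "finite_fibres e B \<longleftrightarrow> finite_fibres (\<lambda>a. e (f a)) A"
proof -
  have "bij_betw f {a \<in> A. e (f a) = n} {b \<in> B. e b = n}" for n
    using assms by (auto simp: bij_betw_def inj_on_def image_iff)
  then show ?thesis
    unfolding finite_fibres_def using bij_betw_finite by blast
qed

lemma gf_reindex:
  assumes "bij_betw f A B"
  shows "gf B e v = gf A (\<lambda>a. e (f a)) (\<lambda>a. v (f a))"
proof (rule fps_ext)
  fix n
  have "bij_betw f {a \<in> A. e (f a) = n} {b \<in> B. e b = n}"
    using assms by (auto simp: bij_betw_def inj_on_def image_iff)
  then show "fps_nth (gf B e v) n = fps_nth (gf A (\<lambda>a. e (f a)) (\<lambda>a. v (f a))) n"
    unfolding gf_nth by (rule sum.reindex_bij_betw[symmetric])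
qed

lemma finite_fibres_times:
  assumes "finite_fibres d A" "finite_fibres e B"
  shows "finite_fibres (\<lambda>(a, b). d a + e b) (A \<times> B)"
  unfolding finite_fibres_def
proof
  fix n
  have "{p \<in> A \<times> B. (\<lambda>(a, b). d a + e b) p = n} \<subseteq> {a \<in> A. d a \<le> n} \<times> {b \<in> B. e b \<le> n}"
    by auto
  then show "finite {p \<in> A \<times> B. (\<lambda>(a, b). d a + e b) p = n}"
    by (rule finite_subset) (intro finite_cartesian_product finite_fibres_le assms)
qed

lemma gf_times:
  assumes "finite_fibres d A" "finite_fibres e B"
  shows "gf (A \<times> B) (\<lambda>(a, b). d a + e b) (\<lambda>(a, b). w a * v b) = gf A d w * gf B e v"
proof (rule fps_ext)
  fix n
  let ?A = "\<lambda>i. {a. a \<in> A \<and> d a = i}" and ?B = "\<lambda>i. {b. b \<in> B \<and> e b = i}"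
  have fin: "finite (?A i)" "finite (?B i)" for i
    using assms by (auto simp: finite_fibres_def)
  have "fps_nth (gf A d w * gf B e v) n = (\<Sum>i=0..n. sum w (?A i) * sum v (?B (n - i)))"
    by (simp add: fps_mult_nth gf_nth)
  also have "\<dots> = (\<Sum>i=0..n. \<Sum>p\<in>?A i \<times> ?B (n - i). case p of (a, b) \<Rightarrow> w a * v b)"
    by (simp add: sum_product sum.cartesian_product)
  also have "\<dots> = (\<Sum>p\<in>(\<Union>i\<in>{0..n}. ?A i \<times> ?B (n - i)). case p of (a, b) \<Rightarrow> w a * v b)"
    by (rule sum.UNION_disjoint[symmetric]) (use fin in auto)
  also have "(\<Union>i\<in>{0..n}. ?A i \<times> ?B (n - i)) = {p. p \<in> A \<times> B \<and> (\<lambda>(a, b). d a + e b) p = n}"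
    by auto
  finally show "fps_nth (gf (A \<times> B) (\<lambda>(a, b). d a + e b) (\<lambda>(a, b). w a * v b)) n
      = fps_nth (gf A d w * gf B e v) n"
    by (simp add: gf_nth)
qed

lemma gf_finite:
  assumes "finite A"
  shows "gf A d w = (\<Sum>a\<in>A. fps_const (w a) * fps_X ^ d a)"
proof (rule fps_ext)
  fix n
  have "fps_nth (\<Sum>a\<in>A. fps_const (w a) * fps_X ^ d a) n = (\<Sum>a\<in>A. if d a = n then w a else 0)"
    by (auto simp: fps_sum_nth fps_X_power_nth intro!: sum.cong)
  also have "\<dots> = (\<Sum>a | a \<in> A \<and> d a = n. w a)"
    using assms by (rule sum.inter_filter[symmetric])
  finally show "fps_nth (gf A d w) n = fps_nth (\<Sum>a\<in>A. fps_const (w a) * fps_X ^ d a) n"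
    by (simp add: gf_nth)
qed

lemma gf_PiE:
  fixes d :: "nat \<Rightarrow> 'a \<Rightarrow> nat"
  assumes "\<And>k. k < u \<Longrightarrow> finite_fibres (d k) A"
  shows "finite_fibres (\<lambda>f. \<Sum>k<u. d k (f k)) (PiE {..<u} (\<lambda>_. A))"
    and "gf (PiE {..<u} (\<lambda>_. A)) (\<lambda>f. \<Sum>k<u. d k (f k)) (\<lambda>f. \<Prod>k<u. w k (f k))
      = (\<Prod>k<u. gf A (d k) (w k))"
  using assms
proof (induction u)
  case 0
  { case 1 then show ?case by (simp add: finite_fibres_def) }
  { case 2 then show ?case by (simp add: gf_finite) }
next
  case (Suc u)
  let ?P = "PiE {..<u} (\<lambda>_. A)" and ?P' = "PiE {..<Suc u} (\<lambda>_. A)"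
  let ?f = "\<lambda>(y, g). g(u := y)"
  have "bij_betw ?f (A \<times> ?P) (PiE (insert u {..<u}) (\<lambda>_. A))"
    unfolding bij_betw_def
  proof
    show "inj_on ?f (A \<times> ?P)" using inj_combinator[of u "{..<u}" "\<lambda>_. A"] by simp
    show "?f ` (A \<times> ?P) = PiE (insert u {..<u}) (\<lambda>_. A)" by (simp add: PiE_insert_eq)
  qed
  then have bij: "bij_betw ?f (A \<times> ?P) ?P'"
    by (simp add: lessThan_Suc)
  let ?d = "\<lambda>(y, g). d u y + (\<Sum>k<u. d k (g k))" and ?w = "\<lambda>(y, g). w u y * (\<Prod>k<u. w k (g k))"
  have d: "(\<lambda>p. \<Sum>k<Suc u. d k (?f p k)) = ?d" and w: "(\<lambda>p. \<Prod>k<Suc u. w k (?f p k)) = ?w"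
    by (rule ext, clarsimp simp: add.commute mult.commute)+
  { case 1
    have "finite_fibres ?d (A \<times> ?P)"
      by (rule finite_fibres_times) (use 1 Suc.IH(1) in auto)
    then show ?case
      by (subst finite_fibres_reindex[OF bij]) (simp only: d) }
  { case 2
    have "gf (A \<times> ?P) ?d ?w
        = gf A (d u) (w u) * gf ?P (\<lambda>f. \<Sum>k<u. d k (f k)) (\<lambda>f. \<Prod>k<u. w k (f k))"
      by (rule gf_times) (use 2 Suc.IH(1) in auto)
    then show ?case using Suc.IH(2) 2
      by (subst gf_reindex[OF bij]) (simp only: d w, simp add: mult.commute) }
qed

section \<open>Infinite products as sums over finite sets of factors\<close>

lemma finite_fibres_Fin:
  assumes "\<And>j. j < v j"
  shows "finite_fibres (sum v) {D :: nat set. finite D}"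
  unfolding finite_fibres_def
proof
  fix n
  have "D \<subseteq> {..n}" if "finite D" "sum v D = n" for D
  proof
    fix j assume "j \<in> D"
    then have "v j \<le> n" using that member_le_sum[of j D v] by auto
    then show "j \<in> {..n}" using assms[of j] by simp
  qed
  then have "{D \<in> {D. finite D}. sum v D = n} \<subseteq> Pow {..n}" by auto
  then show "finite {D \<in> {D. finite D}. sum v D = n}"
    by (rule finite_subset) simp
qed

lemma prod_fps_const: "(\<Prod>a\<in>A. fps_const (w a)) = fps_const (prod w A)"
  by (induction A rule: infinite_finite_induct) auto

text \<open>Expanding the product gives one term for each subset of \<open>{..n}\<close>. Since
  \<open>j < v j\<close>, a finite set of total degree \<open>m \<le> n\<close> has all its elements
  below n, so the factors after the n-th do not reach the coefficient of q^m.\<close>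

lemma partial_prod_nth:
  fixes w :: "nat \<Rightarrow> 'b::comm_ring_1"
  assumes v: "\<And>j. j < v j" and "m \<le> n"
  shows "fps_nth (\<Prod>j\<le>n. 1 + fps_const (w j) * fps_X ^ v j) m
    = fps_nth (gf {D. finite D} (sum v) (prod w)) m"
proof -
  have "(\<Prod>j\<le>n. 1 + fps_const (w j) * fps_X ^ v j) = gf (Pow {..n}) (sum v) (prod w)"
    using prod_add[of "{..n}" "\<lambda>j. fps_const (w j) * fps_X ^ v j" "\<lambda>_. 1"]
    by (simp add: gf_finite prod.distrib power_sum add.commute prod_fps_const)
  moreover have "D \<subseteq> {..n}" if "finite D" "sum v D = m" for D
  proof
    fix j assume "j \<in> D"
    then have "v j \<le> m" using that member_le_sum[of j D v] by auto
    then show "j \<in> {..n}" using v[of j] \<open>m \<le> n\<close> by simp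
  qed
  then have "{D. D \<in> Pow {..n} \<and> sum v D = m} = {D. D \<in> {D. finite D} \<and> sum v D = m}"
    using finite_subset[OF _ finite_atMost] by blast
  ultimately show ?thesis by (simp only: gf_nth)
qed

lemma prodinf_eq_gf:
  fixes w :: "nat \<Rightarrow> 'b::idom"
  assumes v: "\<And>j. j < v j"
  shows "prodinf (\<lambda>j. 1 + fps_const (w j) * fps_X ^ v j) = gf {D. finite D} (sum v) (prod w)"
proof -
  let ?G = "gf {D. finite D} (sum v) (prod w)"
  have "(\<lambda>n. \<Prod>j\<le>n. 1 + fps_const (w j) * fps_X ^ v j) \<longlonglongrightarrow> ?G"
  proof (rule tendsto_fpsI)
    fix m
    show "\<forall>\<^sub>F n in sequentially. fps_nth (\<Prod>j\<le>n. 1 + fps_const (w j) * fps_X ^ v j) m = fps_nth ?G m"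
      unfolding eventually_sequentially using partial_prod_nth[OF v] by blast
  qed
  \<comment> \<open>\<open>has_prod\<close> asks for a nonzero limit; all \<open>v j\<close> are
    positive, so only the empty set has degree 0 and the constant term is 1.\<close>
  moreover have "?G \<noteq> 0"
  proof -
    have "{D. D \<in> {D. finite D} \<and> sum v D = 0} = {{}}"
      using v by (auto simp: sum_nonneg_eq_0_iff) (metis gr_implies_not0)
    then have "fps_nth ?G 0 = 1" by (simp add: gf_nth)
    then show ?thesis by auto
  qed
  ultimately have "(\<lambda>j. 1 + fps_const (w j) * fps_X ^ v j) has_prod ?G"
    by (simp add: has_prod_def raw_has_prod_def)
  then show ?thesis by (rule has_prod_unique[symmetric])
qed

lemma prodinf_nth:
  fixes w :: "nat \<Rightarrow> 'b::idom"
  assumes "\<And>j. j < v j" "m \<le> n"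
  shows "fps_nth (prodinf (\<lambda>j. 1 + fps_const (w j) * fps_X ^ v j)) m
    = fps_nth (\<Prod>j\<le>n. 1 + fps_const (w j) * fps_X ^ v j) m"
  unfolding prodinf_eq_gf[OF assms(1)] partial_prod_nth[OF assms] ..

section \<open>Maya diagrams\<close>

definition maya :: "int set \<Rightarrow> bool" where
  "maya M \<longleftrightarrow> finite (M \<inter> {0..}) \<and> finite ({..<0} - M)"

text \<open>
  The sum of \<open>F\<close> over \<open>M\<close>, made finite by subtracting the sum over the vacuum \<open>{..<0}\<close>.
\<close>

definition en :: "(int \<Rightarrow> int) \<Rightarrow> int set \<Rightarrow> int" where
  "en F M = sum F (M \<inter> {0..}) - sum F ({..<0} - M)"

text \<open>Call the elements of M beads and the other integers gaps. The charge is the number of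
  nonnegative beads minus the number of negative gaps.\<close>

definition charge :: "int set \<Rightarrow> int" where
  "charge M = en (\<lambda>_. 1) M"

text \<open>For the diagram of a partition these pairs correspond to the boxes, and \<open>a - b\<close> is the hook length.\<close>

definition invs :: "int set \<Rightarrow> (int \<times> int) set" where
  "invs M = {(a, b). a \<in> M \<and> b \<notin> M \<and> b < a}"

definition shift :: "int \<Rightarrow> int set \<Rightarrow> int set" where
  "shift c M = {s. s - c \<in> M}"

lemma mem_shift [simp]: "s \<in> shift c M \<longleftrightarrow> s - c \<in> M"
  by (simp add: shift_def)

lemma shift_shift [simp]: "shift c (shift d M) = shift (c + d) M"
  by (auto simp: algebra_simps)

lemma shift_0 [simp]: "shift 0 M = M"
  by auto

lemma maya_insert [simp]: "maya (insert x M) \<longleftrightarrow> maya M"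
proof -
  have "insert x M \<inter> {0..} = (if 0 \<le> x then insert x (M \<inter> {0..}) else M \<inter> {0..})"
    "{..<0} - insert x M = ({..<0} - M) - {x}" by auto
  then show ?thesis by (simp add: maya_def)
qed

lemma maya_remove [simp]: "maya (M - {x}) \<longleftrightarrow> maya M"
  by (metis insert_Diff_single maya_insert)

lemma en_insert:
  assumes "maya M" "x \<notin> M"
  shows "en F (insert x M) = en F M + F x"
proof (cases "0 \<le> x")
  case True
  then have "insert x M \<inter> {0..} = insert x (M \<inter> {0..})" "{..<0} - insert x M = {..<0} - M" by auto
  then show ?thesis using assms by (simp add: en_def maya_def)
next
  case False
  define C where "C = {..<0} - insert x M"
  have C: "{..<0} - M = insert x C" "insert x M \<inter> {0..} = M \<inter> {0..}"
    using False assms by (auto simp: C_def)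
  have "finite C" "x \<notin> C" using assms by (auto simp: maya_def C_def intro: finite_subset[rotated])
  then show ?thesis unfolding en_def C C_def[symmetric] by simp
qed

lemma en_remove:
  assumes "maya M" "x \<in> M"
  shows "en F (M - {x}) = en F M - F x"
  using en_insert[of "M - {x}" x F] assms by (simp add: insert_absorb)

lemma maya_bounds:
  assumes "maya M"
  obtains N where "0 \<le> N" "{..<-N} \<subseteq> M" "M \<subseteq> {..<N}"
proof -
  define S where "S = M \<inter> {0..} \<union> uminus ` ({..<0} - M)"
  have "bdd_above S" unfolding S_def using assms by (intro bdd_above_finite) (simp add: maya_def)
  then obtain N where N: "x \<le> N" if "x \<in> S" for x unfolding bdd_above_def by blast
  have 1: "x \<in> M" if "x < - max N 0" for x
    using N[of "- x"] that by (force simp: S_def)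
  have 2: "x < max N 0 + 1" if "x \<in> M" for x
    using N[of x] that by (force simp: S_def)
  show thesis
    by (rule that[of "max N 0 + 1"]) (use 1 2 in auto)
qed

lemma mayaI:
  assumes "{..<a} \<subseteq> M" "M \<subseteq> {..<b}"
  shows "maya M"
proof -
  have "M \<inter> {0..} \<subseteq> {0..<b}" "{..<0} - M \<subseteq> {a..<0}" using assms by force+
  then show ?thesis unfolding maya_def by (meson finite_atLeastLessThan_int finite_subset)
qed

lemma maya_shift [simp]: "maya (shift c M) \<longleftrightarrow> maya M"
proof -
  have "maya (shift c M)" if "maya M" for c M
    using maya_bounds[OF that]
  proof cases
    case (1 N)
    then show ?thesis by (intro mayaI[of "c - N" _ "c + N"]) (auto simp: subset_iff)
  qed
  from this[of M c] this[of "shift c M" "- c"] show ?thesis by auto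
qed

lemma finite_invs:
  assumes "maya M" shows "finite (invs M)"
  using maya_bounds[OF assms]
proof cases
  case (1 N)
  then have "invs M \<subseteq> {-N..<N} \<times> {-N..<N}"
    unfolding invs_def subset_iff by force
  then show ?thesis by (rule finite_subset) simp
qed

text \<open>Only position -1 crosses the boundary of the vacuum. A bead there becomes a new
  nonnegative bead at 0; a gap there is no longer counted among the negative gaps. Either way the
  correction is \<open>F 0\<close>.\<close>

lemma en_shift1:
  assumes "maya M"
  shows "en F (shift 1 M) = en (\<lambda>s. F (s + 1)) M + F 0"
proof -
  have M: "finite (M \<inter> {0..})" "finite ({..<0} - M)" using assms by (auto simp: maya_def)
  let ?A = "(\<lambda>s. s + 1) ` (M \<inter> {0..})" and ?B = "(\<lambda>s. s + 1) ` ({..<0} - M)"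
  have A: "sum F ?A = (\<Sum>s\<in>M \<inter> {0..}. F (s + 1))" and B: "sum F ?B = (\<Sum>s\<in>{..<0} - M. F (s + 1))"
    by (simp_all add: sum.reindex inj_on_def)
  have img: "s \<in> (\<lambda>s. s + 1) ` X \<longleftrightarrow> s - 1 \<in> X" for s :: int and X
    by (auto simp: image_iff intro: bexI[of _ "s - 1"])
  show ?thesis
  proof (cases "-1 \<in> M")
    case True
    then have "shift 1 M \<inter> {0..} = insert 0 ?A" "{..<0} - shift 1 M = ?B"
      by (auto simp: set_eq_iff img not_less less_le)
    then show ?thesis using M by (simp add: en_def A B img)
  next
    case False
    define C where "C = {..<0} - shift 1 M"
    have C: "shift 1 M \<inter> {0..} = ?A" "?B = insert 0 C"
      using False by (auto simp: set_eq_iff img C_def not_less less_le)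
    have "finite C" "0 \<notin> C" using assms maya_shift unfolding maya_def C_def by auto
    then show ?thesis unfolding en_def C C_def[symmetric] A[symmetric] B[symmetric] by simp
  qed
qed

lemma en_shift_minus1:
  assumes "maya M"
  shows "en F (shift (-1) M) = en (\<lambda>s. F (s - 1)) M - F (-1)"
  using en_shift1[of "shift (-1) M" "\<lambda>s. F (s - 1)"] assms by simp

lemma charge_shift:
  assumes "maya M"
  shows "charge (shift c M) = charge M + c"
proof (induction c rule: int_induct[where k = 0])
  case (step1 i)
  have "charge (shift 1 (shift i M)) = charge (shift i M) + 1"
    unfolding charge_def by (rule en_shift1) (simp add: assms)
  then show ?case using step1 by (simp add: add.commute)
next
  case (step2 i)
  have "charge (shift (-1) (shift i M)) = charge (shift i M) - 1"
    unfolding charge_def by (rule en_shift_minus1) (simp add: assms)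
  then show ?case using step2 by simp
qed simp

lemma bij_invs_shift: "bij_betw (\<lambda>(a, b). (a + c, b + c)) (invs M) (invs (shift c M))"
  by (rule bij_betw_byWitness[of _ "\<lambda>(a, b). (a - c, b - c)"]) (auto simp: invs_def)

lemma card_invs_shift [simp]: "card (invs (shift c M)) = card (invs M)"
  using bij_betw_same_card[OF bij_invs_shift] by metis

lemma maya_lessThan [simp]: "maya {..<c}"
  by (rule mayaI) auto

lemma en_lessThan_0 [simp]: "en F {..<0} = 0"
proof -
  have "{..<0} \<inter> {0..} = ({} :: int set)" by auto
  then show ?thesis by (simp add: en_def)
qed

lemma lessThan_eq_shift: "{..<c} = shift c {..<0}"
  by auto

lemma charge_lessThan: "charge {..<c} = c"
proof -
  have "charge {..<0} = 0" by (simp add: charge_def)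
  then show ?thesis by (subst lessThan_eq_shift) (simp add: charge_shift)
qed

lemma en_id_lessThan: "2 * en (\<lambda>s. s) {..<c} = c * (c - 1)"
proof (induction c rule: int_induct[where k = 0])
  case (step1 i)
  have "{..<i + 1} = insert i {..<i}" by auto
  then show ?case using step1 en_insert[of "{..<i}" i "\<lambda>s. s"] by (simp add: algebra_simps)
next
  case (step2 i)
  have "{..<i} = insert (i - 1) {..<i - 1}" by auto
  then show ?case using step2 en_insert[of "{..<i-1}" "i - 1" "\<lambda>s. s"] by (simp add: algebra_simps)
qed simp

text \<open>With no bead above a gap, the diagram is cut at its least gap. The window
  \<open>{-N..N}\<close> contains it: everything below -N is filled and N itself is a gap.\<close>

lemma invs_empty_imp:
  assumes "maya M" "invs M = {}"
  obtains c where "M = {..<c}"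
  using maya_bounds[OF assms(1)]
proof cases
  case (1 N)
  let ?C = "{-N..N} - M"
  have "N \<notin> M" using 1(3) by (metis lessThan_iff less_irrefl subsetD)
  then have "N \<in> ?C" using 1(1) by simp
  then have fin: "finite ?C" "?C \<noteq> {}" by (simp, metis empty_iff)
  have "Min ?C \<in> ?C" using fin by (rule Min_in)
  moreover have "s \<in> M" if "s < Min ?C" for s
  proof (rule ccontr)
    assume "s \<notin> M"
    then have "-N \<le> s" using 1 by (meson lessThan_iff linorder_not_less subsetD)
    then have "s \<in> ?C" using that \<open>s \<notin> M\<close> \<open>Min ?C \<in> ?C\<close> by auto
    then show False using that fin by (meson Min_le linorder_not_less)
  qed
  moreover have "s < Min ?C" if "s \<in> M" for s
    using assms(2) that \<open>Min ?C \<in> ?C\<close> unfolding invs_def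
    by (metis (mono_tags, lifting) DiffD2 case_prodI empty_iff linorder_neqE mem_Collect_eq)
  ultimately have "M = {..<Min ?C}" by auto
  then show thesis by (rule that)
qed

section \<open>Moving one bead by one step\<close>

definition raise :: "int \<Rightarrow> int set \<Rightarrow> int set" where
  "raise s M = insert (s + 1) (M - {s})"

definition lower :: "int \<Rightarrow> int set \<Rightarrow> int set" where
  "lower s M = insert s (M - {s + 1})"

text \<open>These are the addable and the removable boxes: adding a box to row i moves the bead
  \<open>\<lambda>\<^sub>i - i\<close> one step up.\<close>

definition ups :: "int set \<Rightarrow> int set" where "ups M = {s. s \<in> M \<and> s + 1 \<notin> M}"
definition downs :: "int set \<Rightarrow> int set" where "downs M = {s. s \<notin> M \<and> s + 1 \<in> M}"

lemma maya_raise [simp]: "maya (raise s M) \<longleftrightarrow> maya M" and maya_lower [simp]: "maya (lower s M) \<longleftrightarrow> maya M"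
  by (auto simp: raise_def lower_def)

lemma lower_raise: "s \<in> ups M \<Longrightarrow> lower s (raise s M) = M" and raise_lower: "s \<in> downs M \<Longrightarrow> raise s (lower s M) = M"
  by (auto simp: raise_def lower_def ups_def downs_def)

lemma downs_raise: "s \<in> ups M \<Longrightarrow> s \<in> downs (raise s M)" and ups_lower: "s \<in> downs M \<Longrightarrow> s \<in> ups (lower s M)"
  by (auto simp: raise_def lower_def ups_def downs_def)

lemma en_lower:
  assumes "maya M" "s \<in> downs M"
  shows "en F (lower s M) = en F M + F s - F (s + 1)"
proof -
  have "s \<notin> M" "s + 1 \<in> M" using assms by (auto simp: downs_def)
  then show ?thesis
    using assms(1) by (simp add: lower_def en_insert en_remove)
qed

text \<open>The transposition of s and s + 1 turns \<open>lower s M\<close> into M. The two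
  positions are adjacent, so the order of every other pair is kept, and (s + 1, s) is the one
  inversion that M has in addition.\<close>

lemma card_invs_lower:
  assumes "maya M" "s \<in> downs M"
  shows "card (invs M) = Suc (card (invs (lower s M)))"
proof -
  define r where "r x = (if x = s then s + 1 else if x = s + 1 then s else x)" for x
  have s: "s \<notin> M" "s + 1 \<in> M" using assms by (auto simp: downs_def)
  have rr [simp]: "r (r x) = x" for x by (simp add: r_def)
  have mem: "x \<in> lower s M \<longleftrightarrow> r x \<in> M" for x using s by (auto simp: lower_def r_def)
  have less: "r b < r a" if "b < a" "(a, b) \<noteq> (s + 1, s)" for a b
    using that by (auto simp: r_def split: if_splits)
  have "bij_betw (map_prod r r) (invs (lower s M)) (invs M - {(s + 1, s)})"
  proof (rule bij_betw_byWitness[of _ "map_prod r r"])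
    show "map_prod r r ` invs (lower s M) \<subseteq> invs M - {(s + 1, s)}"
    proof (rule image_subsetI, unfold split_paired_all)
      fix a b assume ab: "(a, b) \<in> invs (lower s M)"
      then have ne: "(a, b) \<noteq> (s + 1, s)" using s by (auto simp: invs_def lower_def)
      have "(a, b) \<noteq> (s, s + 1)" using ab by (auto simp: invs_def)
      then have "map_prod r r (a, b) \<noteq> (s + 1, s)" by (auto simp: r_def split: if_splits)
      then show "map_prod r r (a, b) \<in> invs M - {(s + 1, s)}"
        using ab less[of b a] ne by (auto simp: invs_def mem)
    qed
    show "map_prod r r ` (invs M - {(s + 1, s)}) \<subseteq> invs (lower s M)"
      using less by (auto simp: invs_def mem)
  qed auto
  moreover have "(s + 1, s) \<in> invs M" using s by (auto simp: invs_def)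
  ultimately show ?thesis
    using finite_invs[OF assms(1)] by (metis bij_betw_same_card card_Suc_Diff1)
qed

text \<open>If no gap had a bead directly above it, the gap b would propagate upwards and reach the
  bead a.\<close>

lemma downs_nonempty:
  assumes "(a, b) \<in> invs M"
  obtains s where "s \<in> downs M"
proof -
  have ab: "a \<in> M" "b \<notin> M" "b < a" using assms by (auto simp: invs_def)
  have False if "\<And>s. s \<notin> downs M"
  proof -
    have "x \<notin> M" if "b \<le> x" for x
      using that
      by (induction x rule: int_ge_induct) (use ab \<open>\<And>s. s \<notin> downs M\<close> in \<open>auto simp: downs_def\<close>)
    then show False using ab by auto
  qed
  then show thesis using that by blast
qed

lemma charge_lower: "maya M \<Longrightarrow> s \<in> downs M \<Longrightarrow> charge (lower s M) = charge M"
  by (simp add: charge_def en_lower)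

lemma charge_raise: "maya M \<Longrightarrow> s \<in> ups M \<Longrightarrow> charge (raise s M) = charge M"
  using charge_lower[of "raise s M" s] by (simp add: downs_raise lower_raise)

lemma card_invs_raise: "maya M \<Longrightarrow> s \<in> ups M \<Longrightarrow> card (invs (raise s M)) = Suc (card (invs M))"
  using card_invs_lower[of "raise s M" s] by (simp add: downs_raise lower_raise)

text \<open>Lowering a bead takes one off both the sum of the positions and the number of inversions
  and keeps the charge. Induction thus descends to a diagram \<open>{..<c}\<close> without
  inversions, where twice the sum is c (c - 1). In charge 0, the number of inversions is the sum of
  the positions relative to the vacuum.\<close>

lemma energy:
  assumes "maya M"
  shows "2 * en (\<lambda>s. s) M = 2 * int (card (invs M)) + charge M * (charge M - 1)"
  using assms
proof (induction "card (invs M)" arbitrary: M)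
  case 0
  then have "invs M = {}" using finite_invs by simp
  then obtain c where "M = {..<c}" using invs_empty_imp 0 by metis
  then show ?case using 0 by (simp add: en_id_lessThan charge_lessThan)
next
  case (Suc n)
  then obtain a b where "(a, b) \<in> invs M" by (metis card.empty ex_in_conv nat.distinct(1) surj_pair)
  then obtain s where s: "s \<in> downs M" by (rule downs_nonempty)
  have "n = card (invs (lower s M))" using Suc card_invs_lower[OF _ s] by simp
  then have "2 * en (\<lambda>s. s) (lower s M)
      = 2 * int (card (invs (lower s M))) + charge (lower s M) * (charge (lower s M) - 1)"
    using Suc by simp
  then show ?case using Suc s card_invs_lower[OF _ s] by (simp add: en_lower charge_lower)
qed

section \<open>Diagrams of charge 0\<close>

definition maya0 :: "int set set" where
  "maya0 = {M. maya M \<and> charge M = 0}"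

text \<open>By \<open>energy\<close>, the number of inversions is here the sum of the nonnegative
  beads plus the sum of \<open>- s\<close> over the negative gaps s. No term is negative, so a
  single gap x < 0 already costs \<open>- x\<close>.\<close>

lemma maya0_missing:
  assumes "M \<in> maya0" "x \<notin> M"
  shows "- int (card (invs M)) \<le> x"
proof (cases "x < 0")
  case True
  have M: "maya M" "charge M = 0" using assms by (auto simp: maya0_def)
  then have fin: "finite ({..<0} - M)" by (auto simp: maya_def)
  have "- x \<le> (\<Sum>s\<in>{..<0} - M. - s)" by (rule member_le_sum[OF _ _ fin]) (use True assms in auto)
  moreover have "0 \<le> \<Sum>(M \<inter> {0..})" by (auto intro: sum_nonneg)
  moreover have "en (\<lambda>s. s) M = int (card (invs M))" using energy[OF M(1)] M(2) by simp
  ultimately show ?thesis by (simp add: en_def sum_negf)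
qed simp

lemma finite_fibres_maya0: "finite_fibres (\<lambda>M. card (invs M)) maya0"
  unfolding finite_fibres_def
proof
  fix n
  have "M \<in> (\<lambda>(A, B). A \<union> ({..<0} - B)) ` (Pow {0..int n} \<times> Pow {- int n..<0})"
    if "M \<in> maya0" "card (invs M) = n" for M
  proof -
    have M: "finite (M \<inter> {0..})" "finite ({..<0} - M)" using that by (auto simp: maya_def maya0_def)
    have e: "en (\<lambda>s. s) M = int n" using that energy[of M] by (simp add: maya0_def)
    have pos: "0 \<le> \<Sum>(M \<inter> {0..})" "\<Sum>({..<0} - M) \<le> 0"
      by (auto intro: sum_nonneg sum_nonpos)
    have "x \<le> int n" if "x \<in> M \<inter> {0..}" for x
    proof -
      have "x \<le> \<Sum>(M \<inter> {0..})" by (rule member_le_sum[OF that _ M(1)]) auto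
      then show ?thesis using e pos by (simp add: en_def)
    qed
    moreover have "- int n \<le> x" if "x \<in> {..<0} - M" for x
      using maya0_missing[of M x] that \<open>M \<in> maya0\<close> \<open>card (invs M) = n\<close> by simp
    ultimately have "M \<inter> {0..} \<in> Pow {0..int n}" "{..<0} - M \<in> Pow {- int n..<0}"
      by (auto simp: subset_iff)
    moreover have "M = M \<inter> {0..} \<union> ({..<0} - ({..<0} - M))" by auto
    ultimately show ?thesis by (metis (no_types, lifting) SigmaI case_prod_conv image_eqI)
  qed
  then have "{M \<in> maya0. card (invs M) = n}
      \<subseteq> (\<lambda>(A, B). A \<union> ({..<0} - B)) ` (Pow {0..int n} \<times> Pow {- int n..<0})" by blast
  then show "finite {M \<in> maya0. card (invs M) = n}" by (rule finite_subset) simp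
qed

text \<open>From left to right the indicator of M starts at 1 and ends at 0. It falls after the
  elements of \<open>ups M\<close> and rises after those of \<open>downs M\<close>; the telescoping
  sum makes the difference 1.\<close>

lemma card_ups_downs:
  assumes "maya M"
  shows "finite (ups M)" "finite (downs M)" "card (ups M) = Suc (card (downs M))"
proof -
  obtain N where N: "0 \<le> N" "{..<-N} \<subseteq> M" "M \<subseteq> {..<N}" using maya_bounds[OF assms] .
  have sub: "ups M \<subseteq> {-N-1..<N}" "downs M \<subseteq> {-N-1..<N}"
    using N unfolding ups_def downs_def subset_iff by force+
  then show fin: "finite (ups M)" "finite (downs M)" by (meson finite_atLeastLessThan_int finite_subset)+
  define ind where "ind s = (of_bool (s \<in> M) :: int)" for s
  have tele: "(\<Sum>s\<in>{a..<b}. ind s - ind (s + 1)) = ind a - ind b" if "a \<le> b" for a b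
    using that
  proof (induction b rule: int_ge_induct)
    case (step b)
    have "{a..<b + 1} = insert b {a..<b}" using step by auto
    then show ?case using step by simp
  qed simp
  have "ind s - ind (s + 1) = of_bool (s \<in> ups M) - of_bool (s \<in> downs M)" for s
    by (auto simp: ind_def ups_def downs_def)
  then have "ind (-N-1) - ind N = (\<Sum>s\<in>{-N-1..<N}. of_bool (s \<in> ups M)) - (\<Sum>s\<in>{-N-1..<N}. of_bool (s \<in> downs M))"
    using tele[of "-N-1" N] N by (simp add: sum_subtractf)
  moreover have "ind (-N-1) = 1" "ind N = 0" using N by (auto simp: ind_def)
  moreover have "(\<Sum>s\<in>{-N-1..<N}. of_bool (s \<in> X)) = int (card X)" if "X \<subseteq> {-N-1..<N}" for X
    using that by (simp add: of_bool_def sum.If_cases Int_absorb1)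
  ultimately show "card (ups M) = Suc (card (downs M))" using sub by simp
qed

section \<open>The hook product on Young's lattice\<close>

text \<open>\<open>p\<close> is its own interpolation polynomial at the nodes X, since the
  difference from the latter has \<open>card X\<close> roots but smaller degree. The basis
  polynomials are monic of degree \<open>card X - 1\<close>, so the sum is the coefficient
  there.\<close>

lemma Lagrange_leading_coeff:
  fixes X :: "real set"
  assumes "finite X" "degree p < card X"
  shows "(\<Sum>x\<in>X. poly p x / (\<Prod>j\<in>X - {x}. x - j)) = coeff p (card X - 1)"
proof -
  define B where "B x = (\<Prod>j\<in>X - {x}. [:- j, 1:])" for x
  define L where "L = (\<Sum>x\<in>X. smult (poly p x / (\<Prod>j\<in>X - {x}. x - j)) (B x))"
  have deg: "degree (B x) = card X - 1" "coeff (B x) (card X - 1) = 1" if "x \<in> X" for x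
  proof -
    have "degree (B x) = (\<Sum>j\<in>X - {x}. degree [:- j, 1:])"
      unfolding B_def by (rule degree_prod_eq_sum_degree) simp
    then show "degree (B x) = card X - 1" using that assms(1) by simp
    moreover have "lead_coeff (B x) = 1" unfolding B_def lead_coeff_prod by simp
    ultimately show "coeff (B x) (card X - 1) = 1" by simp
  qed
  have "p - L = 0"
  proof (rule ccontr)
    assume ne: "p - L \<noteq> 0"
    have "degree L \<le> card X - 1"
      unfolding L_def by (rule degree_sum_le) (use assms deg in \<open>auto intro: order_trans[OF degree_smult_le]\<close>)
    then have "degree (p - L) < card X"
      using assms(2) by (intro degree_diff_less) auto
    moreover have "X \<subseteq> {x. poly (p - L) x = 0}"
    proof
      fix y assume y: "y \<in> X"
      have "poly (B x) y = 0" if "x \<in> X" "x \<noteq> y" for x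
        using that y assms(1) by (auto simp: B_def poly_prod)
      then have "poly L y = poly p y / (\<Prod>j\<in>X - {y}. y - j) * poly (B y) y"
        unfolding L_def poly_sum poly_smult
        using y assms(1) by (subst sum.remove[of _ y]) (auto intro!: sum.neutral)
      moreover have "(\<Prod>j\<in>X - {y}. y - j) \<noteq> 0" using assms(1) by auto
      ultimately show "y \<in> {x. poly (p - L) x = 0}" by (simp add: B_def poly_prod)
    qed
    then have "card X \<le> card {x. poly (p - L) x = 0}"
      by (intro card_mono poly_roots_finite ne)
    then have "card X \<le> degree (p - L)" using card_poly_roots_bound[OF ne] by simp
    ultimately show False by simp
  qed
  then have "coeff p (card X - 1) = coeff L (card X - 1)" by simp
  also have "\<dots> = (\<Sum>x\<in>X. poly p x / (\<Prod>j\<in>X - {x}. x - j))"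
    unfolding L_def coeff_sum coeff_smult using deg by (intro sum.cong) auto
  finally show ?thesis by simp
qed

text \<open>The top coefficients of the product of all z - f(x) are 1, -e1 and e2 = (p1^2 - p2) / 2,
  in elementary symmetric functions and power sums. The factor z^2 raises their degrees, so that
  they exist without truncated subtraction even for fewer than two factors.\<close>

lemma coeff_prod_linear:
  fixes f :: "'a \<Rightarrow> real"
  assumes "finite A"
  defines "q \<equiv> [:0, 0, 1:] * (\<Prod>x\<in>A. [:- f x, 1:])"
  shows "\<And>i. i > card A + 2 \<Longrightarrow> coeff q i = 0"
    and "coeff q (card A + 2) = 1"
    and "coeff q (card A + 1) = - sum f A"
    and "coeff q (card A) = ((sum f A)\<^sup>2 - (\<Sum>x\<in>A. (f x)\<^sup>2)) / 2"
  unfolding q_def using assms(1)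
proof (induction A)
  case empty
  { case 1 then show ?case by (auto simp: coeff_pCons split: nat.splits) }
  { case 2 then show ?case by (simp add: coeff_pCons numeral_2_eq_2) }
  { case 3 then show ?case by (simp add: coeff_pCons) }
  { case 4 then show ?case by simp }
next
  case (insert a A)
  let ?q = "[:0, 0, 1:] * (\<Prod>x\<in>A. [:- f x, 1:])"
  have step: "coeff ([:0, 0, 1:] * (\<Prod>x\<in>insert a A. [:- f x, 1:])) (Suc i)
      = coeff ?q i - f a * coeff ?q (Suc i)" for i
  proof -
    have "[:0, 0, 1:] * (\<Prod>x\<in>insert a A. [:- f x, 1:]) = [:- f a, 1:] * ?q"
      using insert by (simp add: ac_simps)
    also have "\<dots> = pCons 0 ?q - smult (f a) ?q" by simp
    finally show ?thesis by (simp only: coeff_diff coeff_smult coeff_pCons_Suc)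
  qed
  define C C' where "C = coeff ?q" and "C' = coeff ([:0, 0, 1:] * (\<Prod>x\<in>insert a A. [:- f x, 1:]))"
  have step: "C' (Suc i) = C i - f a * C (Suc i)" for i
    unfolding C_def C'_def by (rule step)
  have card: "card (insert a A) = Suc (card A)" using insert by simp
  note IH = insert.IH[folded C_def]
  { case (1 i)
    then obtain j where "i = Suc j" "j > card A + 2" using card by (cases i) auto
    then show ?case unfolding C'_def[symmetric] by (simp add: step IH(1)) }
  { case 2
    show ?case unfolding C'_def[symmetric] card
      using step[of "card A + 2"] IH(1)[of "card A + 3"] IH(2) by (simp add: numeral_3_eq_3) }
  { case 3
    show ?case unfolding C'_def[symmetric] card
      using step[of "card A + 1"] insert.hyps IH(2,3) by simp }
  { case 4
    show ?case unfolding C'_def[symmetric] card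
      using step[of "card A"] insert.hyps IH(3,4)
      by (simp add: power2_eq_square algebra_simps add_divide_distrib diff_divide_distrib) }
qed

text \<open>In the numerator, a factor for j = s may be added because it is 1, and the factor for j
  = 0 is s + 1, which cancels 1 / (s + 1). What remains is the value at s of a monic polynomial of
  degree \<open>card X - 1\<close>, to which Lagrange interpolation applies.\<close>

lemma sum_raise_ratio:
  fixes X :: "real set"
  assumes "finite X" "0 \<in> X" "\<And>x. x \<in> X \<Longrightarrow> 0 \<le> x"
  shows "(\<Sum>s\<in>X. 1 / (s + 1) * (\<Prod>j\<in>X - {s}. (s + 1 - j) / (s - j))) = 1"
proof -
  define p where "p = (\<Prod>j\<in>X - {0}. [:1 - j, 1:])"
  have degp: "degree p = card X - 1"
  proof -
    have "degree p = (\<Sum>j\<in>X - {0}. degree [:1 - j, 1:])"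
      unfolding p_def by (rule degree_prod_eq_sum_degree) simp
    then show ?thesis using assms by simp
  qed
  have "lead_coeff p = 1" unfolding p_def lead_coeff_prod by simp
  then have lc: "coeff p (card X - 1) = 1" by (simp add: degp)
  have pos: "card X > 0" using assms by (auto simp: card_gt_0_iff)
  have "1 / (s + 1) * (\<Prod>j\<in>X - {s}. (s + 1 - j) / (s - j)) = poly p s / (\<Prod>j\<in>X - {s}. s - j)"
    if s: "s \<in> X" for s
  proof -
    have "(\<Prod>j\<in>X - {s}. s + 1 - j) = (\<Prod>j\<in>X. s + 1 - j)"
      using prod.remove[OF assms(1) s, of "\<lambda>j. s + 1 - j"] by simp
    also have "\<dots> = (s + 1) * poly p s"
      using prod.remove[OF assms(1,2), of "\<lambda>j. s + 1 - j"] by (simp add: p_def poly_prod algebra_simps)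
    finally have "(\<Prod>j\<in>X - {s}. s + 1 - j) = (s + 1) * poly p s" .
    moreover have "s + 1 \<noteq> 0" using assms(3)[OF s] by simp
    ultimately show ?thesis unfolding prod_dividef by simp
  qed
  then have "(\<Sum>s\<in>X. 1 / (s + 1) * (\<Prod>j\<in>X - {s}. (s + 1 - j) / (s - j)))
      = (\<Sum>s\<in>X. poly p s / (\<Prod>j\<in>X - {s}. s - j))" by (rule sum.cong[OF refl])
  also have "\<dots> = 1"
    using Lagrange_leading_coeff[OF assms(1), of p] degp pos lc by simp
  finally show ?thesis .
qed

text \<open>With P(z) the product of the z - (j + 1) and Q(z) that of the z - j, the summand is -s
  P(s) over the Lagrange denominator. The degree of z P(z) is too large for interpolation, so (z -
  k) Q(z), which vanishes on X, is subtracted, where k = card X. This cancels the two top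
  coefficients because e1 grows by k from Q to P; the coefficient left at z^(k-1) is minus the
  right-hand side.\<close>

lemma sum_lower_ratio:
  fixes X :: "real set"
  assumes "finite X"
  shows "(\<Sum>s\<in>X. s * (\<Prod>j\<in>X - {s}. (s - 1 - j) / (s - j)))
    = sum (\<lambda>s. s) X - real (card X) * (real (card X) - 1) / 2"
proof (cases "X = {}")
  case False
  define k where "k = card X"
  have k: "k > 0" using assms False by (auto simp: k_def card_gt_0_iff)
  define P Q where "P = (\<Prod>j\<in>X. [:- (j + 1), 1:])" and "Q = (\<Prod>j\<in>X. [:- j, 1 :: real:])"
  \<comment> \<open>The remainder of \<open>z P(z)\<close> modulo \<open>Q\<close>.\<close>
  define p where "p = [:0, 1:] * P - [:- real k, 1:] * Q"
  let ?P = "[:0, 0, 1:] * P" and ?Q = "[:0, 0, 1:] * Q"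
  have c: "coeff p i = coeff ?P (Suc i) - coeff ?Q (Suc i) + real k * coeff ?Q (Suc (Suc i))" for i
  proof -
    have "[:0, 0, 1:] * p = pCons 0 ?P - (pCons 0 ?Q - smult (real k) ?Q)"
      by (simp add: p_def algebra_simps)
    then have "coeff ([:0, 0, 1:] * p) (Suc (Suc i))
        = coeff ?P (Suc i) - coeff ?Q (Suc i) + real k * coeff ?Q (Suc (Suc i))"
      by (simp only: coeff_diff coeff_smult coeff_pCons_Suc)
    moreover have "coeff ([:0, 0, 1:] * p) (Suc (Suc i)) = coeff p i" by simp
    ultimately show ?thesis by simp
  qed
  note cP = coeff_prod_linear[OF assms, where f = "\<lambda>j. j + 1", folded P_def k_def]
  note cQ = coeff_prod_linear[OF assms, where f = "\<lambda>j. j", folded Q_def k_def]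
  have s1: "(\<Sum>x\<in>X. x + 1) = sum (\<lambda>x. x) X + real k" by (simp add: sum.distrib k_def)
  have s2: "(\<Sum>x\<in>X. (x + 1)\<^sup>2) = (\<Sum>x\<in>X. x\<^sup>2) + 2 * sum (\<lambda>x. x) X + real k"
    by (simp add: sum.distrib k_def power2_eq_square algebra_simps sum_distrib_left)
  have "coeff p i = 0" if "i \<ge> k" for i
  proof -
    consider "i = k" | "i = k + 1" | "i > k + 1" using \<open>i \<ge> k\<close> by force
    then show ?thesis
    proof cases
      case 1 then show ?thesis using c[of i] cP(3) cQ(2,3) s1 by simp
    next
      case 2 then show ?thesis using c[of i] cP(2) cQ(2) cQ(1)[of "Suc (Suc i)"] by simp
    next
      case 3 then show ?thesis using c[of i] cP(1)[of "Suc i"] cQ(1)[of "Suc i"] cQ(1)[of "Suc (Suc i)"] by simp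
    qed
  qed
  then have "degree p \<le> k - 1" by (intro degree_le) auto
  then have deg: "degree p < card X" using k by (simp add: k_def)
  have lc: "coeff p (card X - 1) = - (sum (\<lambda>s. s) X - real k * (real k - 1) / 2)"
  proof -
    have "Suc (k - 1) = k" using k by simp
    then have "coeff p (k - 1) = coeff ?P k - coeff ?Q k + real k * coeff ?Q (k + 1)"
      using c[of "k - 1"] by simp
    then show ?thesis
      unfolding cP(4) cQ(3,4) s1 s2 by (simp add: k_def power2_eq_square algebra_simps add_divide_distrib diff_divide_distrib)
  qed
  have "s * (\<Prod>j\<in>X - {s}. (s - 1 - j) / (s - j)) = - (poly p s / (\<Prod>j\<in>X - {s}. s - j))"
    if s: "s \<in> X" for s
  proof -
    have "poly Q s = 0" using s assms by (auto simp: Q_def poly_prod)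
    moreover have "poly P s = - (\<Prod>j\<in>X - {s}. s - 1 - j)"
      using prod.remove[OF assms s, of "\<lambda>j. s - 1 - j"] by (simp add: P_def poly_prod algebra_simps)
    ultimately show ?thesis by (simp add: p_def prod_dividef)
  qed
  then have "(\<Sum>s\<in>X. s * (\<Prod>j\<in>X - {s}. (s - 1 - j) / (s - j)))
      = (\<Sum>s\<in>X. - (poly p s / (\<Prod>j\<in>X - {s}. s - j)))" by (rule sum.cong[OF refl])
  also have "\<dots> = sum (\<lambda>s. s) X - real k * (real k - 1) / 2"
    unfolding sum_negf Lagrange_leading_coeff[OF assms deg] lc by simp
  finally show ?thesis by (simp add: k_def)
qed simp

section \<open>The hook product under moves of one bead\<close>

definition hookw :: "int set \<Rightarrow> real" where
  "hookw M = (\<Prod>(a, b)\<in>invs M. 1 / real_of_int (a - b))"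

lemma fact_int_prod: "0 \<le> n \<Longrightarrow> (fact (nat n) :: real) = (\<Prod>b\<in>{0..<n}. real_of_int (n - b))"
proof (induction n rule: int_ge_induct)
  case (step i)
  have "{0..<i + 1} = insert 0 {1..<i + 1}" using step by auto
  moreover have "(\<Prod>b\<in>{1..<i + 1}. real_of_int (i + 1 - b)) = (\<Prod>b\<in>{0..<i}. real_of_int (i - b))"
    by (rule prod.reindex_bij_witness[of _ "\<lambda>b. b + 1" "\<lambda>b. b - 1"]) auto
  ultimately have "(\<Prod>b\<in>{0..<i + 1}. real_of_int (i + 1 - b)) = real_of_int (i + 1) * (\<Prod>b\<in>{0..<i}. real_of_int (i - b))"
    by simp
  moreover have "nat (i + 1) = Suc (nat i)" using step by simp
  ultimately show ?case using step by simp
qed simp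

text \<open>A new bead y destroys the hooks from the beads above y down to the former gap y and
  creates one hook for each gap below y. All these gaps lie in [a, y), so the created lengths
  multiply to (y - a)! divided by the distances from y to the beads in [a, y). This makes the
  dependence on y explicit, as interpolation requires.\<close>

lemma hookw_insert:
  assumes Z: "maya Z" "{..<a} \<subseteq> Z" and y: "y \<notin> Z" "a \<le> y"
  shows "hookw (insert y Z) = hookw Z * (\<Prod>j\<in>Z \<inter> {a..}. \<bar>real_of_int (y - j)\<bar>) / fact (nat (y - a))"
proof -
  let ?f = "\<lambda>(a, b). 1 / real_of_int (a - b)"
  \<comment> \<open>K: hooks that do not involve y; L: beads whose hook ended at the gap y; R: gaps
    that get a hook from the new bead y.\<close>
  define K where "K = {(i, b). (i, b) \<in> invs Z \<and> b \<noteq> y}"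
  define L where "L = {i \<in> Z. y < i}"
  define R where "R = {a..<y} - Z"
  have finK: "finite K" by (rule finite_subset[OF _ finite_invs[OF Z(1)]]) (auto simp: K_def)
  obtain N where N: "0 \<le> N" "{..<-N} \<subseteq> Z" "Z \<subseteq> {..<N}" using maya_bounds[OF Z(1)] .
  have finL: "finite L" by (rule finite_subset[of _ "{y..<N}"]) (use N in \<open>auto simp: L_def\<close>)
  have finR: "finite R" by (simp add: R_def)
  have Zeq: "invs Z = K \<union> (\<lambda>i. (i, y)) ` L" and Zdis: "K \<inter> (\<lambda>i. (i, y)) ` L = {}"
    using y by (auto simp: K_def L_def invs_def)
  have gZ: "hookw Z = prod ?f K * (\<Prod>i\<in>L. 1 / real_of_int (i - y))"
    unfolding hookw_def Zeq prod.union_disjoint[OF finK finite_imageI[OF finL] Zdis]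
    by (simp add: prod.reindex inj_on_def)
  have R: "b \<in> R \<longleftrightarrow> b \<notin> Z \<and> b < y" for b
    using Z(2) not_less[of b a] by (auto simp: R_def)
  have Yeq: "invs (insert y Z) = K \<union> (\<lambda>b. (y, b)) ` R" and Ydis: "K \<inter> (\<lambda>b. (y, b)) ` R = {}"
    using y(1) by (auto simp: K_def R invs_def image_iff)
  have gY: "hookw (insert y Z) = prod ?f K * (\<Prod>b\<in>R. 1 / real_of_int (y - b))"
    unfolding hookw_def Yeq prod.union_disjoint[OF finK finite_imageI[OF finR] Ydis]
    by (simp add: prod.reindex inj_on_def)
  define J where "J = Z \<inter> {a..<y}"
  have finJ: "finite J" by (simp add: J_def)
  have "(\<Prod>j\<in>Z \<inter> {a..}. \<bar>real_of_int (y - j)\<bar>) = (\<Prod>j\<in>J \<union> L. \<bar>real_of_int (y - j)\<bar>)"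
    by (rule prod.cong) (use y in \<open>auto simp: J_def L_def less_le\<close>)
  also have "\<dots> = (\<Prod>j\<in>J. real_of_int (y - j)) * (\<Prod>i\<in>L. real_of_int (i - y))"
    using finJ finL by (subst prod.union_disjoint) (auto simp: J_def L_def intro!: arg_cong2[of _ _ _ _ "(*)"] prod.cong)
  finally have num: "(\<Prod>j\<in>Z \<inter> {a..}. \<bar>real_of_int (y - j)\<bar>)
      = (\<Prod>j\<in>J. real_of_int (y - j)) * (\<Prod>i\<in>L. real_of_int (i - y))" .
  have "(fact (nat (y - a)) :: real) = (\<Prod>b\<in>{a..<y}. real_of_int (y - b))"
  proof -
    have "(\<Prod>b\<in>{a..<y}. real_of_int (y - b)) = (\<Prod>b\<in>{0..<y - a}. real_of_int (y - a - b))"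
      by (rule prod.reindex_bij_witness[of _ "\<lambda>b. b + a" "\<lambda>b. b - a"]) auto
    then show ?thesis using y by (simp add: fact_int_prod)
  qed
  also have "{a..<y} = J \<union> R" by (auto simp: J_def R_def)
  also have "(\<Prod>b\<in>J \<union> R. real_of_int (y - b)) = (\<Prod>j\<in>J. real_of_int (y - j)) * (\<Prod>b\<in>R. real_of_int (y - b))"
    by (rule prod.union_disjoint) (auto simp: J_def R_def)
  finally have den: "(fact (nat (y - a)) :: real)
      = (\<Prod>j\<in>J. real_of_int (y - j)) * (\<Prod>b\<in>R. real_of_int (y - b))" .
  have "(\<Prod>j\<in>J. real_of_int (y - j)) \<noteq> 0" "(\<Prod>i\<in>L. real_of_int (i - y)) \<noteq> 0"
    using finJ finL by (auto simp: J_def L_def)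
  then show ?thesis
    unfolding gZ gY num den by (simp add: prod_dividef field_simps)
qed

lemma hookw_move:
  assumes M: "maya M" "{..<a} \<subseteq> M" and s: "s \<in> M" "a \<le> s" and y: "y \<notin> M" "a \<le> y"
  shows "hookw (insert y (M - {s}))
    = hookw M * (fact (nat (s - a)) / fact (nat (y - a)))
      * (\<Prod>j\<in>M \<inter> {a..} - {s}. \<bar>real_of_int (y - j)\<bar> / \<bar>real_of_int (s - j)\<bar>)"
proof -
  let ?Z = "M - {s}"
  have Z: "maya ?Z" "{..<a} \<subseteq> ?Z" "?Z \<inter> {a..} = M \<inter> {a..} - {s}" "insert s ?Z = M"
    using M s by (auto simp: subset_iff)
  have "(\<Prod>j\<in>M \<inter> {a..} - {s}. \<bar>real_of_int (s - j)\<bar>) \<noteq> 0"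
    by (cases "finite (M \<inter> {a..} - {s})") auto
  moreover have "hookw M = hookw ?Z * (\<Prod>j\<in>M \<inter> {a..} - {s}. \<bar>real_of_int (s - j)\<bar>) / fact (nat (s - a))"
    using hookw_insert[OF Z(1,2), of s] s unfolding Z(3,4) by simp
  moreover have "hookw (insert y ?Z) = hookw ?Z * (\<Prod>j\<in>M \<inter> {a..} - {s}. \<bar>real_of_int (y - j)\<bar>) / fact (nat (y - a))"
    using hookw_insert[OF Z(1,2), of y] y unfolding Z(3) by simp
  ultimately show ?thesis by (simp add: prod_dividef)
qed

text \<open>A step of length one cannot carry s past j, so numerator and denominator never have
  opposite signs and the absolute values drop out. The origin is moved to \<open>a\<close> to match
  the interpolation sums.\<close>

lemma abs_ratio_adjacent:
  fixes s j d :: int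
  assumes "s \<noteq> j" "\<bar>d\<bar> = 1"
  shows "\<bar>real_of_int (s + d - j)\<bar> / \<bar>real_of_int (s - j)\<bar>
    = (real_of_int (s - a) + real_of_int d - real_of_int (j - a)) / (real_of_int (s - a) - real_of_int (j - a))"
proof (cases "s < j")
  case True
  then have "s + d - j \<le> 0" using assms by linarith
  then have "\<bar>real_of_int (s + d - j)\<bar> = - real_of_int (s + d - j)" "\<bar>real_of_int (s - j)\<bar> = - real_of_int (s - j)"
    using True by linarith+
  then show ?thesis by (simp only: minus_divide_divide) simp
next
  case False
  then have "s + d - j \<ge> 0" using assms by linarith
  then have "\<bar>real_of_int (s + d - j)\<bar> = real_of_int (s + d - j)" "\<bar>real_of_int (s - j)\<bar> = real_of_int (s - j)"
    using False by linarith+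
  then show ?thesis by simp
qed

text \<open>The window starts at a bead \<open>a\<close> with only beads below it. Counted from
  \<open>a\<close>, it is the node 0 that \<open>sum_raise_ratio\<close> requires and the node of
  weight 0 in \<open>sum_lower_ratio\<close>.\<close>

lemma maya_base:
  assumes "maya M"
  obtains a where "a < 0" "{..a} \<subseteq> M" "finite (M \<inter> {a..})"
proof -
  obtain N where N: "0 \<le> N" "{..<-N} \<subseteq> M" "M \<subseteq> {..<N}" using maya_bounds[OF assms] .
  have "finite (M \<inter> {-N-1..})" by (rule finite_subset[of _ "{-N-1..<N}"]) (use N in auto)
  then show thesis using N by (intro that[of "-N-1"]) auto
qed

lemma real_of_shifted_prod:
  fixes a s :: int
  shows "(\<Prod>j\<in>(\<lambda>j. real_of_int (j - a)) ` X - {real_of_int (s - a)}. F j)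
    = (\<Prod>j\<in>X - {s}. F (real_of_int (j - a)))"
proof -
  have "(\<lambda>j. real_of_int (j - a)) ` X - {real_of_int (s - a)} = (\<lambda>j. real_of_int (j - a)) ` (X - {s})"
    by auto
  then show ?thesis by (simp add: prod.reindex inj_on_def del: of_int_diff)
qed

lemma fact_ratio: "fact n / fact (Suc n) = 1 / (real n + 1)"
  and fact_ratio': "fact (Suc n) / fact n = real n + 1"
  by (simp_all add: add.commute)

text \<open>The quotients \<open>hookw (raise s M) / hookw M\<close> are the summands of
  \<open>sum_raise_ratio\<close> at the positions counted from \<open>a\<close>. If s + 1 is
  occupied, the bead s cannot be raised, and its summand contains the factor 0 for j = s + 1; so the
  sum may run over the whole window.\<close>

lemma sum_hookw_raise:
  assumes "maya M"
  shows "(\<Sum>s\<in>ups M. hookw (raise s M)) = hookw M"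
proof -
  obtain a where a: "{..a} \<subseteq> M" "finite (M \<inter> {a..})" using maya_base[OF assms] by metis
  define X where "X = M \<inter> {a..}"
  let ?r = "\<lambda>j. real_of_int (j - a)"
  have aX: "a \<in> X" using a by (auto simp: X_def)
  have summand: "hookw M * (1 / (?r s + 1) * (\<Prod>j\<in>?r ` X - {?r s}. (?r s + 1 - j) / (?r s - j)))
      = (if s \<in> ups M then hookw (raise s M) else 0)" if s: "s \<in> X" for s
  proof (cases "s \<in> ups M")
    case True
    have n: "nat (s + 1 - a) = Suc (nat (s - a))" "real (nat (s - a)) = ?r s"
      using s by (auto simp: X_def)
    have fct: "fact (nat (s - a)) / fact (nat (s + 1 - a)) = 1 / (?r s + 1)"
      unfolding n(1) fact_ratio n(2) ..
    have "{..<a} \<subseteq> M" using a by auto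
    then have "hookw (raise s M) = hookw M * (fact (nat (s - a)) / fact (nat (s + 1 - a)))
      * (\<Prod>j\<in>X - {s}. \<bar>real_of_int (s + 1 - j)\<bar> / \<bar>real_of_int (s - j)\<bar>)"
      unfolding raise_def X_def
      using True s by (intro hookw_move assms) (auto simp: ups_def X_def)
    also have "(\<Prod>j\<in>X - {s}. \<bar>real_of_int (s + 1 - j)\<bar> / \<bar>real_of_int (s - j)\<bar>)
        = (\<Prod>j\<in>X - {s}. (?r s + 1 - ?r j) / (?r s - ?r j))"
      using abs_ratio_adjacent[of s _ 1 a] by (intro prod.cong) auto
    finally show ?thesis
      using True by (simp only: real_of_shifted_prod fct) simp
  next
    case False
    then have "s + 1 \<in> X - {s}" using s by (auto simp: ups_def X_def)
    moreover have "(?r s + 1 - ?r (s + 1)) / (?r s - ?r (s + 1)) = 0" by simp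
    ultimately have "(\<Prod>j\<in>X - {s}. (?r s + 1 - ?r j) / (?r s - ?r j)) = 0"
      using a(2) unfolding X_def by (intro prod_zero) blast+
    then show ?thesis using False by (simp only: real_of_shifted_prod) simp
  qed
  have "(\<Sum>s\<in>?r ` X. 1 / (s + 1) * (\<Prod>j\<in>?r ` X - {s}. (s + 1 - j) / (s - j))) = 1"
    by (rule sum_raise_ratio) (use a aX in \<open>auto simp: X_def image_iff intro: bexI[of _ a]\<close>)
  then have "hookw M = hookw M * (\<Sum>s\<in>X. 1 / (?r s + 1) * (\<Prod>j\<in>?r ` X - {?r s}. (?r s + 1 - j) / (?r s - j)))"
    by (subst (asm) sum.reindex) (simp_all add: inj_on_def)
  also have "\<dots> = (\<Sum>s\<in>X. if s \<in> ups M then hookw (raise s M) else 0)"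
    unfolding sum_distrib_left by (rule sum.cong[OF refl summand])
  also have "\<dots> = (\<Sum>s\<in>X \<inter> ups M. hookw (raise s M))"
    using a(2) by (simp add: sum.inter_restrict X_def)
  also have "X \<inter> ups M = ups M"
  proof -
    have "s \<in> X" if "s \<in> ups M" for s
    proof (rule ccontr)
      assume "s \<notin> X"
      then have "s < a" using that by (auto simp: X_def ups_def)
      then have "s + 1 \<in> M" using a(1) by auto
      then show False using that by (simp add: ups_def)
    qed
    then show ?thesis by blast
  qed
  finally show ?thesis by simp
qed

text \<open>This is \<open>energy\<close> for the beads of the window: their number k satisfies
  \<open>charge M = k + a\<close>, and the terms in \<open>a\<close> cancel. It identifies the
  right-hand side of \<open>sum_lower_ratio\<close>.\<close>

lemma card_invs_window:
  assumes "maya M" "a < 0" "{..a} \<subseteq> M" "finite (M \<inter> {a..})"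
  shows "real (card (invs M)) = (\<Sum>x\<in>M \<inter> {a..}. real_of_int (x - a))
      - real (card (M \<inter> {a..})) * (real (card (M \<inter> {a..})) - 1) / 2"
proof -
  define X where "X = M \<inter> {a..}"
  define k where "k = int (card X)"
  have en: "en F M = sum F X - sum F {a..<0}" for F
  proof -
    let ?P = "M \<inter> {0..}" and ?N = "M \<inter> {a..<0}" and ?C = "{..<0} - M"
    have f: "finite ?P" "finite ?N" "finite ?C" using assms(1) by (auto simp: maya_def)
    have X: "X = ?P \<union> ?N" using assms(2) by (auto simp: X_def)
    have I: "{a..<0} = ?N \<union> ?C"
    proof -
      have "a \<le> s" if "s \<notin> M" for s using assms(3) that by (meson atMost_iff linear subsetD)
      then show ?thesis by auto
    qed
    have "sum F X = sum F ?P + sum F ?N"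
      unfolding X by (rule sum.union_disjoint[OF f(1,2)]) auto
    moreover have "sum F {a..<0} = sum F ?N + sum F ?C"
      by (rule trans[OF arg_cong[OF I, of "sum F"] sum.union_disjoint[OF f(2,3)]]) auto
    ultimately show ?thesis by (simp add: en_def)
  qed
  have c: "charge M = k + a" using assms(2) by (simp add: charge_def en k_def)
  have tri: "2 * sum (\<lambda>x. x) {a..<0} = - (a * (a - 1))"
  proof -
    have "2 * sum (\<lambda>x. x) {i..<0} = - (i * (i - 1))" if "i \<le> 0" for i :: int
      using that
    proof (induction i rule: int_le_induct)
      case (step i)
      have "{i - 1..<0} = insert (i - 1) {i..<0}" using step by auto
      then show ?case using step by (simp add: algebra_simps)
    qed simp
    then show ?thesis using assms(2) by simp
  qed
  have "2 * sum (\<lambda>x. x) X + a * (a - 1) = 2 * int (card (invs M)) + (k + a) * (k + a - 1)"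
    using energy[OF assms(1)] tri unfolding en c by (simp add: algebra_simps)
  moreover have "(\<Sum>x\<in>X. x - a) = sum (\<lambda>x. x) X - k * a"
    by (simp add: sum_subtractf k_def)
  ultimately have "2 * int (card (invs M)) = 2 * (\<Sum>x\<in>X. x - a) - k * (k - 1)"
    by (simp add: algebra_simps)
  then have "real_of_int (2 * int (card (invs M))) = real_of_int (2 * (\<Sum>x\<in>X. x - a) - k * (k - 1))"
    by presburger
  then have "2 * real (card (invs M)) = 2 * (\<Sum>x\<in>X. real_of_int (x - a)) - real (card X) * (real (card X) - 1)"
    by (simp add: k_def)
  then show ?thesis by (simp add: X_def field_simps)
qed

lemma sum_hookw_lower:
  assumes "maya M"
  shows "(\<Sum>s\<in>downs M. hookw (lower s M)) = real (card (invs M)) * hookw M"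
proof -
  obtain a where a: "a < 0" "{..a} \<subseteq> M" "finite (M \<inter> {a..})" using maya_base[OF assms] by metis
  define X where "X = M \<inter> {a..}"
  let ?r = "\<lambda>j. real_of_int (j - a)"
  have summand: "hookw M * (?r s * (\<Prod>j\<in>?r ` X - {?r s}. (?r s - 1 - j) / (?r s - j)))
      = (if s - 1 \<in> downs M then hookw (lower (s - 1) M) else 0)" if s: "s \<in> X" for s
  proof (cases "s - 1 \<in> downs M")
    case True
    then have "a < s" using a(2) by (auto simp: downs_def subset_iff) (metis linorder_not_le order.trans zle_diff1_eq less_imp_le)
    then have n: "nat (s - a) = Suc (nat (s - 1 - a))" "real (nat (s - 1 - a)) = ?r s - 1"
      by auto
    have fct: "fact (nat (s - a)) / fact (nat (s - 1 - a)) = ?r s"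
      unfolding n(1) fact_ratio' n(2) by simp
    have "{..<a} \<subseteq> M" using a by auto
    then have "hookw (lower (s - 1) M) = hookw M * (fact (nat (s - a)) / fact (nat (s - 1 - a)))
      * (\<Prod>j\<in>X - {s}. \<bar>real_of_int (s - 1 - j)\<bar> / \<bar>real_of_int (s - j)\<bar>)"
      unfolding lower_def X_def
      using True s \<open>a < s\<close> hookw_move[OF assms, of a s "s - 1"] by (auto simp: downs_def X_def)
    also have "(\<Prod>j\<in>X - {s}. \<bar>real_of_int (s - 1 - j)\<bar> / \<bar>real_of_int (s - j)\<bar>)
        = (\<Prod>j\<in>X - {s}. (?r s - 1 - ?r j) / (?r s - ?r j))"
      using abs_ratio_adjacent[of s _ "-1" a] by (intro prod.cong) auto
    finally show ?thesis
      using True by (simp only: real_of_shifted_prod fct) simp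
  next
    case False
    show ?thesis
    \<comment> \<open>The bottom bead cannot be lowered, but the bead at a - 1 that blocks it lies
      outside the window. Its term vanishes through the factor \<open>?r s = 0\<close>, not through
      the product.\<close>
    proof (cases "s = a")
      case sa: False
      then have "s - 1 \<in> X - {s}" using s False by (auto simp: downs_def X_def)
      moreover have "(?r s - 1 - ?r (s - 1)) / (?r s - ?r (s - 1)) = 0" by simp
      ultimately have "(\<Prod>j\<in>X - {s}. (?r s - 1 - ?r j) / (?r s - ?r j)) = 0"
        using a(3) unfolding X_def by (intro prod_zero) blast+
      then show ?thesis using False by (simp only: real_of_shifted_prod) simp
    qed (use False in simp)
  qed
  have finX: "finite X" using a by (simp add: X_def)
  have card: "card (?r ` X) = card X" by (rule card_image) (simp add: inj_on_def)
  have sumr: "sum (\<lambda>s. s) (?r ` X) = (\<Sum>s\<in>X. ?r s)" by (subst sum.reindex) (simp_all add: inj_on_def)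
  have "(\<Sum>s\<in>?r ` X. s * (\<Prod>j\<in>?r ` X - {s}. (s - 1 - j) / (s - j))) = real (card (invs M))"
    unfolding sum_lower_ratio[OF finite_imageI[OF finX]] card sumr
    using card_invs_window[OF assms a] by (simp only: X_def)
  then have "real (card (invs M)) * hookw M
      = hookw M * (\<Sum>s\<in>X. ?r s * (\<Prod>j\<in>?r ` X - {?r s}. (?r s - 1 - j) / (?r s - j)))"
    by (subst (asm) sum.reindex) (simp_all add: inj_on_def)
  also have "\<dots> = (\<Sum>s\<in>X. if s - 1 \<in> downs M then hookw (lower (s - 1) M) else 0)"
    unfolding sum_distrib_left by (rule sum.cong[OF refl summand])
  also have "\<dots> = (\<Sum>s\<in>{s\<in>X. s - 1 \<in> downs M}. hookw (lower (s - 1) M))"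
    by (rule sum.inter_filter[OF finX, symmetric])
  also have "\<dots> = (\<Sum>s\<in>downs M. hookw (lower s M))"
  proof (rule sum.reindex_bij_witness[of _ "\<lambda>s. s + 1" "\<lambda>s. s - 1"])
    fix s assume s: "s \<in> downs M"
    then have "\<not> s \<le> a" using a(2) by (auto simp: downs_def)
    then show "s + 1 \<in> {s \<in> X. s - 1 \<in> downs M}" using s by (auto simp: downs_def X_def)
  qed auto
  finally show ?thesis by simp
qed

section \<open>Sums over partitions of a given size\<close>

definition level :: "nat \<Rightarrow> int set set" where
  "level n = {M \<in> maya0. card (invs M) = n}"

lemma finite_level [simp]: "finite (level n)"
  using finite_fibres_maya0 by (simp add: finite_fibres_def level_def)

lemma levelD: "M \<in> level n \<Longrightarrow> maya M" "M \<in> level n \<Longrightarrow> charge M = 0" "M \<in> level n \<Longrightarrow> card (invs M) = n"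
  by (auto simp: level_def maya0_def)

lemma level_0: "level 0 = {{..<0}}"
proof
  show "level 0 \<subseteq> {{..<0}}"
  proof
    fix M assume M: "M \<in> level 0"
    then have "invs M = {}" using levelD[OF M] finite_invs[of M] by simp
    then obtain c where c: "M = {..<c}" using invs_empty_imp levelD(1)[OF M] by metis
    then show "M \<in> {{..<0}}" using levelD(2)[OF M] by (simp add: charge_lessThan)
  qed
  have "invs {..<0} = {}" by (auto simp: invs_def)
  then show "{{..<0}} \<subseteq> level 0" by (simp add: level_def maya0_def charge_lessThan)
qed

text \<open>Both sides run over the edges of Young's lattice between two consecutive sizes, listed
  from the upper and from the lower end.\<close>

lemma level_swap:
  fixes f :: "int set \<Rightarrow> int set \<Rightarrow> real"
  shows "(\<Sum>M\<in>level (Suc n). \<Sum>s\<in>downs M. f M (lower s M)) = (\<Sum>M\<in>level n. \<Sum>s\<in>ups M. f (raise s M) M)"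
proof -
  have "(\<Sum>M\<in>level (Suc n). \<Sum>s\<in>downs M. f M (lower s M))
      = (\<Sum>(M, s)\<in>Sigma (level (Suc n)) downs. f M (lower s M))"
    by (rule sum.Sigma) (auto dest: levelD intro: card_ups_downs)
  also have "\<dots> = (\<Sum>(M, s)\<in>Sigma (level n) ups. f (raise s M) M)"
  proof (rule sum.reindex_bij_witness[of _ "\<lambda>(M, s). (raise s M, s)" "\<lambda>(M, s). (lower s M, s)"])
    fix p assume "p \<in> Sigma (level (Suc n)) downs"
    then obtain M s where p: "p = (M, s)" "M \<in> level (Suc n)" "s \<in> downs M" by auto
    then show "(case case p of (M, s) \<Rightarrow> (lower s M, s) of (M, s) \<Rightarrow> (raise s M, s)) = p"
      by (simp add: raise_lower)
    have "lower s M \<in> level n"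
      using p levelD[OF p(2)] card_invs_lower[of M s] by (simp add: level_def maya0_def charge_lower)
    then show "(case p of (M, s) \<Rightarrow> (lower s M, s)) \<in> Sigma (level n) ups"
      using p by (simp add: ups_lower)
    show "(case case p of (M, s) \<Rightarrow> (lower s M, s) of (M, s) \<Rightarrow> f (raise s M) M)
        = (case p of (M, s) \<Rightarrow> f M (lower s M))" using p by (simp add: raise_lower)
  next
    fix p assume "p \<in> Sigma (level n) ups"
    then obtain M s where p: "p = (M, s)" "M \<in> level n" "s \<in> ups M" by auto
    then show "(case case p of (M, s) \<Rightarrow> (raise s M, s) of (M, s) \<Rightarrow> (lower s M, s)) = p"
      by (simp add: lower_raise)
    have "raise s M \<in> level (Suc n)"
      using p levelD[OF p(2)] card_invs_raise[of M s] by (simp add: level_def maya0_def charge_raise)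
    then show "(case p of (M, s) \<Rightarrow> (raise s M, s)) \<in> Sigma (level (Suc n)) downs"
      using p by (simp add: downs_raise)
  qed
  also have "\<dots> = (\<Sum>M\<in>level n. \<Sum>s\<in>ups M. f (raise s M) M)"
    by (rule sum.Sigma[symmetric]) (auto dest: levelD intro: card_ups_downs)
  finally show ?thesis .
qed

text \<open>By the hook length formula, \<open>n! * hook_sum n\<close> counts the standard Young
  tableaux with n boxes, that is, the involutions of n letters; the recursion below is the one for
  involution numbers.\<close>

definition hook_sum :: "nat \<Rightarrow> real" where
  "hook_sum n = (\<Sum>M\<in>level n. hookw M)"

lemma hook_sum_0: "hook_sum 0 = 1"
proof -
  have "invs {..<0} = {}" by (auto simp: invs_def)
  then show ?thesis by (simp add: hook_sum_def level_0 hookw_def)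
qed

text \<open>The down rule turns the left-hand side into a sum over edges. Seen from below, each M of
  size n occurs once per addable box, that is, once more than per removable box. The single copies
  give \<open>hook_sum n\<close>; the others form a sum over the edges down to size n - 1, which the
  up rule collapses.\<close>

lemma hook_sum_Suc:
  "real (Suc n) * hook_sum (Suc n) = hook_sum n + (case n of 0 \<Rightarrow> 0 | Suc m \<Rightarrow> hook_sum m)"
proof -
  have "real (Suc n) * hook_sum (Suc n) = (\<Sum>M\<in>level (Suc n). \<Sum>s\<in>downs M. hookw (lower s M))"
    unfolding hook_sum_def sum_distrib_left
    by (intro sum.cong refl) (simp add: sum_hookw_lower levelD)
  also have "\<dots> = (\<Sum>M\<in>level n. \<Sum>s\<in>ups M. hookw M)"
    by (rule level_swap[of "\<lambda>_. hookw"])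
  also have "\<dots> = (\<Sum>M\<in>level n. hookw M + (\<Sum>s\<in>downs M. hookw M))"
    using card_ups_downs(3)[OF levelD(1)] by (intro sum.cong refl) (simp add: algebra_simps)
  also have "\<dots> = hook_sum n + (\<Sum>M\<in>level n. \<Sum>s\<in>downs M. hookw M)"
    by (simp add: hook_sum_def sum.distrib)
  also have "(\<Sum>M\<in>level n. \<Sum>s\<in>downs M. hookw M) = (case n of 0 \<Rightarrow> 0 | Suc m \<Rightarrow> hook_sum m)"
  proof (cases n)
    case 0
    have "downs {..<0} = {}" by (auto simp: downs_def)
    then show ?thesis using 0 by (simp add: level_0)
  next
    case (Suc m)
    have "(\<Sum>M\<in>level (Suc m). \<Sum>s\<in>downs M. hookw M) = (\<Sum>M\<in>level m. \<Sum>s\<in>ups M. hookw (raise s M))"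
      by (rule level_swap[of "\<lambda>M _. hookw M"])
    then show ?thesis using Suc by (simp add: hook_sum_def sum_hookw_raise levelD)
  qed
  finally show ?thesis .
qed

section \<open>Euler's product for partitions\<close>

lemma gf_Un:
  assumes "finite_fibres d (A \<union> B)" "A \<inter> B = {}"
  shows "gf (A \<union> B) d w = gf A d w + gf B d w"
proof (rule fps_ext)
  fix n
  have "{a \<in> A \<union> B. d a = n} = {a \<in> A. d a = n} \<union> {a \<in> B. d a = n}" by auto
  moreover have "finite {a \<in> A \<union> B. d a = n}" using assms by (simp add: finite_fibres_def)
  ultimately show "fps_nth (gf (A \<union> B) d w) n = fps_nth (gf A d w + gf B d w) n"
    using assms(2) by (simp add: gf_nth) (subst sum.union_disjoint, auto)
qed

lemma gf_add_const: "gf A (\<lambda>a. d a + m) w = gf A d w * fps_X ^ m"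
proof (rule fps_ext)
  fix n
  have "{a \<in> A. d a + m = n} = (if n < m then {} else {a \<in> A. d a = n - m})" by auto
  then show "fps_nth (gf A (\<lambda>a. d a + m) w) n = fps_nth (gf A d w * fps_X ^ m) n"
    by (simp add: gf_nth fps_X_power_mult_right_nth)
qed

lemma finite_fibres_subset: "finite_fibres d B \<Longrightarrow> A \<subseteq> B \<Longrightarrow> finite_fibres d A"
  unfolding finite_fibres_def by (auto intro: finite_subset[of "{a \<in> A. d a = n}" "{a \<in> B. d a = n}" for n])

lemma finite_fibres_mult:
  assumes "finite_fibres d A" "0 < c" shows "finite_fibres (\<lambda>a. c * d a) A"
  unfolding finite_fibres_def
proof
  fix n
  have "{a \<in> A. c * d a = n} \<subseteq> {a \<in> A. d a = n div c}" using assms(2) by auto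
  then show "finite {a \<in> A. c * d a = n}"
    by (rule finite_subset) (use assms(1) in \<open>simp add: finite_fibres_def\<close>)
qed

lemma fps_mult_nth_cong:
  assumes "\<And>i. i \<le> n \<Longrightarrow> fps_nth a i = fps_nth a' i" "\<And>i. i \<le> n \<Longrightarrow> fps_nth b i = fps_nth b' i"
  shows "fps_nth (a * b) n = fps_nth (a' * b') n"
  unfolding fps_mult_nth using assms by (intro sum.cong) auto

text \<open>These are the diagrams of the partitions with at most \<open>k\<close> parts.\<close>

definition maya0_above :: "nat \<Rightarrow> int set set" where
  "maya0_above k = {M \<in> maya0. {..<- int k} \<subseteq> M}"

lemma maya0_above_0: "maya0_above 0 = {{..<0}}"
proof
  show "maya0_above 0 \<subseteq> {{..<0}}"
  proof
    fix M assume "M \<in> maya0_above 0"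
    then have M: "maya M" "charge M = 0" "{..<0} - M = {}" by (auto simp: maya0_above_def maya0_def)
    then have "int (card (M \<inter> {0..})) = 0" by (simp add: charge_def en_def)
    then have "M \<inter> {0..} = {}" using M(1) by (simp add: maya_def)
    then have "M = {..<0}" using M(3) by (auto simp: not_less disjoint_iff)
    then show "M \<in> {{..<0}}" by simp
  qed
qed (auto simp: maya0_above_def maya0_def charge_lessThan)

text \<open>B holds the partitions with exactly k + 1 parts. They arise from those with at most k +
  1 parts by adding a full column of k + 1 boxes. On beads, everything is raised by one, and
  deleting the bead at -k - 2 opens the gap at -k - 1 and brings the charge back to 0.\<close>

lemma maya0_above_Suc:
  fixes k :: nat
  defines "B \<equiv> {M \<in> maya0_above (Suc k). - int (Suc k) \<notin> M}"
  shows "maya0_above (Suc k) = maya0_above k \<union> B" "maya0_above k \<inter> B = {}"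
    and "bij_betw (\<lambda>M. shift 1 (M - {- int k - 2})) (maya0_above (Suc k)) B"
    and "\<And>M. M \<in> maya0_above (Suc k) \<Longrightarrow>
      card (invs (shift 1 (M - {- int k - 2}))) = card (invs M) + Suc k"
proof -
  have lt: "{..<- int k} = insert (- int (Suc k)) {..<- int (Suc k)}" by auto
  show "maya0_above (Suc k) = maya0_above k \<union> B" "maya0_above k \<inter> B = {}"
    unfolding maya0_above_def B_def lt by blast+
  define x where "x = - int k - 2"
  have f: "shift 1 (M - {x}) \<in> B" "card (invs (shift 1 (M - {x}))) = card (invs M) + Suc k"
    if "M \<in> maya0_above (Suc k)" for M
  proof -
    have M: "maya M" "charge M = 0" "{..<- int (Suc k)} \<subseteq> M" using that by (auto simp: maya0_above_def maya0_def)
    have x: "x \<in> M" using M(3) by (auto simp: x_def)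
    let ?N = "shift 1 (M - {x})"
    have N: "maya ?N" using M by simp
    have c: "charge ?N = 0" using M x by (simp add: charge_shift) (simp add: charge_def en_remove)
    have "en (\<lambda>s. s) ?N = en (\<lambda>s. s + 1) M - (x + 1)" using M x by (simp add: en_shift1 en_remove)
    also have "en (\<lambda>s. s + 1) M = en (\<lambda>s. s) M + charge M"
      by (simp add: en_def charge_def sum.distrib)
    finally have e: "en (\<lambda>s. s) ?N = en (\<lambda>s. s) M + int (Suc k)" using M by (simp add: x_def)
    show "card (invs ?N) = card (invs M) + Suc k"
      using energy[OF N] energy[OF M(1)] e c M(2) by simp
    have "{..<- int (Suc k)} \<subseteq> ?N"
      using M(3) by (auto simp: x_def subset_iff)
    then show "?N \<in> B" using N c by (simp add: B_def maya0_above_def maya0_def x_def)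
  qed
  have g: "insert x (shift (-1) N) \<in> maya0_above (Suc k)" if "N \<in> B" for N
  proof -
    have N: "maya N" "charge N = 0" "{..<- int (Suc k)} \<subseteq> N" "x + 1 \<notin> N"
      using that by (auto simp: B_def maya0_above_def maya0_def x_def)
    have "charge (insert x (shift (-1) N)) = 0"
      using N charge_shift[of N "-1"] by (simp add: charge_def en_insert)
    moreover have "{..<- int (Suc k)} \<subseteq> insert x (shift (-1) N)"
    proof
      fix s assume "s \<in> {..<- int (Suc k)}"
      then have "s = x \<or> s + 1 \<in> {..<- int (Suc k)}" by (auto simp: x_def)
      then show "s \<in> insert x (shift (-1) N)" using subsetD[OF N(3), of "s + 1"] by auto
    qed
    ultimately show ?thesis using N(1) by (simp add: maya0_above_def maya0_def)
  qed
  have "bij_betw (\<lambda>M. shift 1 (M - {x})) (maya0_above (Suc k)) B"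
  proof (rule bij_betw_byWitness[of _ "\<lambda>N. insert x (shift (-1) N)"])
    show "\<forall>M\<in>maya0_above (Suc k). insert x (shift (-1) (shift 1 (M - {x}))) = M"
      by (auto simp: maya0_above_def x_def subset_iff)
    show "\<forall>N\<in>B. shift 1 (insert x (shift (-1) N) - {x}) = N"
      by (auto simp: B_def x_def)
  qed (use f g in blast)+
  then show "bij_betw (\<lambda>M. shift 1 (M - {- int k - 2})) (maya0_above (Suc k)) B"
    by (simp add: x_def)
  show "\<And>M. M \<in> maya0_above (Suc k) \<Longrightarrow>
      card (invs (shift 1 (M - {- int k - 2}))) = card (invs M) + Suc k"
    using f(2) by (simp add: x_def)
qed

text \<open>\<open>maya0_above_Suc\<close> reads G_(k+1) = G_k + q^(c (k+1)) G_(k+1), which yields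
  one factor of the product per step.\<close>

lemma gf_maya0_above:
  assumes "0 < c"
  shows "gf (maya0_above k) (\<lambda>M. c * card (invs M)) (\<lambda>_. 1 :: 'b::idom)
    * (\<Prod>j<k. 1 - fps_X ^ (c * Suc j)) = 1"
proof (induction k)
  case 0
  have "invs {..<0} = {}" by (auto simp: invs_def)
  then show ?case by (simp add: maya0_above_0 gf_finite)
next
  case (Suc k)
  let ?d = "\<lambda>M. c * card (invs M)"
  let ?G = "\<lambda>A. gf A ?d (\<lambda>_. 1 :: 'b)"
  let ?B = "{M \<in> maya0_above (Suc k). - int (Suc k) \<notin> M}"
  have "finite_fibres ?d maya0" by (rule finite_fibres_mult[OF finite_fibres_maya0 assms])
  then have fin: "finite_fibres ?d (maya0_above (Suc k))"
    by (rule finite_fibres_subset) (auto simp: maya0_above_def)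
  have "?G (maya0_above (Suc k)) = ?G (maya0_above k \<union> ?B)"
    using maya0_above_Suc(1)[of k] by simp
  also have "\<dots> = ?G (maya0_above k) + ?G ?B"
    using fin maya0_above_Suc(1,2)[of k] by (intro gf_Un) simp_all
  also have "?G ?B = gf (maya0_above (Suc k)) (\<lambda>M. ?d M + c * Suc k) (\<lambda>_. 1)"
    unfolding gf_reindex[OF maya0_above_Suc(3)]
    by (rule gf_cong) (simp_all only: maya0_above_Suc(4) add_mult_distrib2)
  also have "\<dots> = ?G (maya0_above (Suc k)) * fps_X ^ (c * Suc k)" by (rule gf_add_const)
  finally have "?G (maya0_above (Suc k)) * (1 - fps_X ^ (c * Suc k)) = ?G (maya0_above k)"
    by (simp add: algebra_simps)
  moreover have "a * (p * g) = (a * g) * p" for a p g :: "'b fps" by (simp add: ac_simps)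
  ultimately show ?case using Suc by (simp only: prod.lessThan_Suc)
qed

text \<open>A partition of size at most n has at most n parts, so up to degree n both factors agree
  with their truncations, whose product is 1.\<close>

theorem partition_gf:
  assumes "0 < c"
  shows "gf maya0 (\<lambda>M. c * card (invs M)) (\<lambda>_. 1 :: 'b::idom)
    * prodinf (\<lambda>j. 1 - fps_X ^ c * (fps_X ^ c) ^ j) = 1"
proof (rule fps_ext)
  fix n
  let ?d = "\<lambda>M. c * card (invs M)"
  have v: "j < c * Suc j" for j using assms by (cases c) auto
  have eq: "1 - fps_X ^ c * (fps_X ^ c) ^ j = (1 - fps_X ^ (c * Suc j) :: 'b fps)" for j
    by (simp add: power_add power_mult)
  have eq': "1 - fps_X ^ (c * Suc j) = 1 + fps_const (- 1 :: 'b) * fps_X ^ (c * Suc j)" for j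
    by (simp add: fps_const_neg[symmetric] del: fps_const_neg)
  \<comment> \<open>The cut is at \<open>Suc n\<close> parts to match the n + 1 factors with index
    at most n in the truncated product.\<close>
  have "fps_nth (gf maya0 ?d (\<lambda>_. 1 :: 'b)) i = fps_nth (gf (maya0_above (Suc n)) ?d (\<lambda>_. 1)) i" if "i \<le> n" for i
  proof -
    have "M \<in> maya0_above (Suc n)" if M: "M \<in> maya0" "?d M = i" for M
    proof -
      have "card (invs M) \<le> i" using M(2) assms by (cases c) auto
      then have "x \<in> M" if "x < - int (Suc n)" for x
        using maya0_missing[OF M(1), of x] that \<open>i \<le> n\<close> by force
      then show ?thesis using M by (auto simp: maya0_above_def)
    qed
    then have "{M. M \<in> maya0 \<and> ?d M = i} = {M. M \<in> maya0_above (Suc n) \<and> ?d M = i}"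
      by (auto simp: maya0_above_def)
    then show ?thesis by (simp only: gf_nth)
  qed
  moreover have "fps_nth (prodinf (\<lambda>j. 1 - fps_X ^ c * (fps_X ^ c) ^ j)) i
      = fps_nth (\<Prod>j<Suc n. 1 - fps_X ^ (c * Suc j) :: 'b fps) i" if "i \<le> n" for i
    using prodinf_nth[where w = "\<lambda>_. - 1 :: 'b", OF v that]
    unfolding eq eq' lessThan_Suc_atMost .
  ultimately have "fps_nth (gf maya0 ?d (\<lambda>_. 1 :: 'b) * prodinf (\<lambda>j. 1 - fps_X ^ c * (fps_X ^ c) ^ j)) n
      = fps_nth (gf (maya0_above (Suc n)) ?d (\<lambda>_. 1) * (\<Prod>j<Suc n. 1 - fps_X ^ (c * Suc j))) n"
    by (rule fps_mult_nth_cong)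
  then show "fps_nth (gf maya0 ?d (\<lambda>_. 1 :: 'b) * prodinf (\<lambda>j. 1 - fps_X ^ c * (fps_X ^ c) ^ j)) n = fps_nth 1 n"
    by (simp only: gf_maya0_above[OF assms])
qed

section \<open>The exponential series\<close>

abbreviation xpoly :: "real poly \<Rightarrow> laurent" where
  "xpoly p \<equiv> Poly_Mapping.single 0 p"

lemma xpoly_mult: "xpoly p * xpoly r = xpoly (p * r)"
  by (simp add: mult_single)

lemma xpoly_power: "xpoly p ^ n = xpoly (p ^ n)"
  by (induction n) (simp_all add: xpoly_mult)

lemma xpoly_of_nat: "of_nat n * xpoly p = xpoly (smult (real n) p)"
proof -
  have "(of_nat n :: laurent) = xpoly [:real n:]"
    by (simp add: single_of_nat[symmetric] of_nat_poly)
  then show ?thesis by (simp add: xpoly_mult)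
qed

lemma x_var_power: "x_var ^ n = fps_const (xpoly (monom 1 n))"
proof -
  have "[:0, 1 :: real:] ^ n = monom 1 n" by (simp add: monom_altdef)
  then show ?thesis by (simp add: x_var_def fps_const_power xpoly_power)
qed

lemma scalar_x_var: "scalar c * x_var ^ n = fps_const (xpoly (monom c n))"
  by (simp add: scalar_def x_var_power xpoly_mult smult_monom)

text \<open>The equation expresses n + 1 times the coefficient of degree n + 1 by the earlier ones,
  and n + 1 can be cancelled in characteristic 0. This characterises the exponential over
  coefficients that need not form a field.\<close>

lemma fps_ode_unique:
  fixes A B h :: "'b::{idom, ring_char_0} fps"
  assumes "fps_deriv A = h * A" "fps_deriv B = h * B" "fps_nth A 0 = fps_nth B 0"
  shows "A = B"
proof (rule fps_ext)
  fix n
  show "fps_nth A n = fps_nth B n"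
  proof (induction n rule: less_induct)
    case (less n)
    show ?case
    proof (cases n)
      case (Suc m)
      have "fps_nth (h * A) m = fps_nth (h * B) m"
        using less.IH Suc by (auto simp: fps_mult_nth intro!: sum.cong)
      then have "fps_nth (fps_deriv A) m = fps_nth (fps_deriv B) m" using assms by simp
      then have "of_nat (Suc m) * fps_nth A (Suc m) = of_nat (Suc m) * fps_nth B (Suc m)"
        by (simp only: fps_deriv_nth Suc_eq_plus1)
      then show ?thesis using Suc by (simp del: of_nat_Suc)
    qed (use assms in simp)
  qed
qed

lemma fps_deriv_monom:
  "fps_deriv (fps_const c * fps_X ^ n) = fps_const (of_nat n * c) * fps_X ^ (n - 1)"
  for c :: "'b::comm_ring_1"
  by (rule fps_ext) (cases n, auto simp: fps_X_power_nth algebra_simps)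

lemma exp_qseries_deriv:
  assumes "fps_nth f 0 = 0"
  shows "fps_deriv (exp_qseries f) = fps_deriv f * exp_qseries f"
proof -
  let ?e = "Abs_fps (\<lambda>n. xpoly [:1 / fact n:])"
  have "fps_deriv ?e = ?e"
  proof (rule fps_ext)
    fix n
    show "fps_nth (fps_deriv ?e) n = fps_nth ?e n"
      using xpoly_of_nat[of "Suc n" "[:1 / fact (Suc n):]"] by (simp del: of_nat_Suc)
  qed
  then show ?thesis using fps_compose_deriv[OF assms, of ?e] by (simp add: exp_qseries_def mult.commute)
qed

lemma exp_qseries_nth_0: "fps_nth f 0 = 0 \<Longrightarrow> fps_nth (exp_qseries f) 0 = 1"
  by (simp add: exp_qseries_def fps_compose_nth one_pCons[symmetric])

definition hook_coeff :: "nat \<Rightarrow> int set \<Rightarrow> laurent" where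
  "hook_coeff t M = xpoly (monom (hookw M / real t ^ card (invs M)) (2 * card (invs M)))"

lemma hook_gf_nth:
  assumes "0 < t"
  shows "fps_nth (gf maya0 (\<lambda>M. 2 * t * card (invs M)) (hook_coeff t)) m
    = (if 2 * t dvd m then xpoly (monom (hook_sum (m div (2 * t)) / real t ^ (m div (2 * t))) (2 * (m div (2 * t)))) else 0)"
proof (cases "2 * t dvd m")
  case True
  then obtain n where m: "m = 2 * t * n" by blast
  have *: "{M. M \<in> maya0 \<and> 2 * t * card (invs M) = m} = level n" using assms by (auto simp: level_def m)
  have "(\<Sum>M\<in>level n. hook_coeff t M) = (\<Sum>M\<in>level n. xpoly (monom (hookw M / real t ^ n) (2 * n)))"
    by (rule sum.cong) (auto simp: hook_coeff_def level_def)
  also have "\<dots> = xpoly (monom (hook_sum n / real t ^ n) (2 * n))"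
  proof -
    have "(\<Sum>M\<in>A. xpoly (monom (hookw M / real t ^ n) (2 * n)))
        = xpoly (monom (sum hookw A / real t ^ n) (2 * n))" if "finite A" for A
      using that by (induction A) (simp_all add: single_add[symmetric] add_monom add_divide_distrib)
    then show ?thesis by (simp add: hook_sum_def)
  qed
  finally show ?thesis using assms unfolding gf_nth * by (simp add: m)
next
  case False
  then have "{M. M \<in> maya0 \<and> 2 * t * card (invs M) = m} = {}" by auto
  then show ?thesis using False unfolding gf_nth by (simp only: sum.empty if_False)
qed

text \<open>With z = x^2 q^(2t) / t, the series E is the sum of \<open>hook_sum n\<close> z^n, and
  the recursion says dE/dz = (1 + z) E. The two monomials are dz/dq and z dz/dq.\<close>

lemma hook_gf_deriv:
  assumes "0 < t"
  defines "E \<equiv> gf maya0 (\<lambda>M. 2 * t * card (invs M)) (hook_coeff t)"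
  shows "fps_deriv E = (fps_const (xpoly (monom 2 2)) * fps_X ^ (2 * t - 1)
      + fps_const (xpoly (monom (2 / real t) 4)) * fps_X ^ (4 * t - 1)) * E"
proof (rule fps_ext)
  fix m
  define e where "e n = xpoly (monom (hook_sum n / real t ^ n) (2 * n))" for n
  have E: "fps_nth E i = (if 2 * t dvd i then e (i div (2 * t)) else 0)" for i
    unfolding E_def e_def using hook_gf_nth[OF assms(1)] .
  have E': "fps_nth E (2 * t * n) = e n" for n using assms(1) by (simp add: E)
  have rhs: "fps_nth ((fps_const (xpoly (monom 2 2)) * fps_X ^ (2 * t - 1)
      + fps_const (xpoly (monom (2 / real t) 4)) * fps_X ^ (4 * t - 1)) * E) m
    = (if m < 2 * t - 1 then 0 else xpoly (monom 2 2) * fps_nth E (m - (2 * t - 1)))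
      + (if m < 4 * t - 1 then 0 else xpoly (monom (2 / real t) 4) * fps_nth E (m - (4 * t - 1)))"
    by (simp only: distrib_right mult.assoc fps_add_nth fps_mult_left_const_nth fps_X_power_mult_nth)
      (simp only: if_distrib[of "(*) _"] mult_zero_right)
  show "fps_nth (fps_deriv E) m = fps_nth ((fps_const (xpoly (monom 2 2)) * fps_X ^ (2 * t - 1)
      + fps_const (xpoly (monom (2 / real t) 4)) * fps_X ^ (4 * t - 1)) * E) m"
  \<comment> \<open>E is supported on multiples of 2 t, so both sides vanish in degree m unless 2 t
    divides m + 1.\<close>
  proof (cases "2 * t dvd m + 1")
    case False
    have "\<not> 2 * t dvd m - (2 * t - 1)" if "\<not> m < 2 * t - 1"
    proof -
      have "m + 1 = m - (2 * t - 1) + 2 * t" using that assms(1) by linarith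
      then show ?thesis using False by (metis dvd_add dvd_refl)
    qed
    moreover have "\<not> 2 * t dvd m - (4 * t - 1)" if "\<not> m < 4 * t - 1"
    proof -
      have "m + 1 = m - (4 * t - 1) + 2 * t * 2" using that assms(1) by linarith
      then show ?thesis using False by (metis dvd_add dvd_triv_left)
    qed
    ultimately show ?thesis unfolding rhs using False by (simp add: E)
  next
    case True
    then obtain n where n: "m + 1 = 2 * t * n" by blast
    then obtain k where k: "n = Suc k" by (cases n) auto
    have lhs: "fps_nth (fps_deriv E) m = xpoly (smult (real (m + 1)) (monom (hook_sum n / real t ^ n) (2 * n)))"
      by (simp only: fps_deriv_nth n E' e_def xpoly_of_nat)
    have m1: "\<not> m < 2 * t - 1" "m - (2 * t - 1) = 2 * t * k" using n k assms(1) by (auto simp: algebra_simps)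
    have r1: "xpoly (monom 2 2) * e k = xpoly (monom (2 * hook_sum k / real t ^ k) (2 * n))"
      by (simp add: e_def xpoly_mult mult_monom k)
    have rec: "real (m + 1) * (hook_sum n / real t ^ n)
        = 2 * hook_sum k / real t ^ k + (case k of 0 \<Rightarrow> 0 | Suc j \<Rightarrow> 2 * hook_sum j / (real t * real t ^ j))"
    proof -
      have "real (m + 1) * (hook_sum n / real t ^ n) = 2 * (real (Suc k) * hook_sum (Suc k)) / real t ^ k"
        unfolding n k using assms(1) by (simp add: field_simps)
      then show ?thesis
        unfolding hook_sum_Suc by (cases k) (auto simp: distrib_left add_divide_distrib)
    qed
    show ?thesis
    proof (cases k)
      case 0
      then have "m < 4 * t - 1" using n k assms(1) by auto
      then show ?thesis unfolding lhs rhs using m1 r1 rec 0 E'[of 0] by (simp add: smult_monom)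
    next
      case (Suc j)
      then have m2: "\<not> m < 4 * t - 1" "m - (4 * t - 1) = 2 * t * j" using n k assms(1) by (auto simp: algebra_simps)
      have r2: "xpoly (monom (2 / real t) 4) * e j = xpoly (monom (2 * hook_sum j / (real t * real t ^ j)) (2 * n))"
        by (simp add: e_def xpoly_mult mult_monom k Suc eval_nat_numeral)
      have "fps_nth E (m - (2 * t - 1)) = e k" "fps_nth E (m - (4 * t - 1)) = e j"
        by (simp_all only: m1 m2 E')
      then show ?thesis unfolding lhs rhs using m1(1) m2(1) r1 r2 rec Suc
        by (simp add: smult_monom single_add[symmetric] add_monom)
    qed
  qed
qed

text \<open>The power E^u has the logarithmic derivative u h, and the exponent on the right is its
  antiderivative without constant term: 2 u / (2 t) = 1 / 2 and (2 u / t) / (4 t) = 1 / (4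
  t).\<close>

theorem hook_gf_power:
  assumes "even t" "0 < t"
  shows "gf maya0 (\<lambda>M. 2 * t * card (invs M)) (hook_coeff t) ^ (t div 2)
    = exp_qseries (scalar (1 / 2) * x_var ^ 2 * q_var ^ (2 * t)
        + scalar (1 / (4 * real t)) * x_var ^ 4 * q_var ^ (4 * t))"
proof -
  define E where "E = gf maya0 (\<lambda>M. 2 * t * card (invs M)) (hook_coeff t)"
  define h where "h = fps_const (xpoly (monom 2 2)) * fps_X ^ (2 * t - 1)
      + fps_const (xpoly (monom (2 / real t) 4)) * fps_X ^ (4 * t - 1)"
  define f where "f = fps_const (xpoly (monom (1 / 2) 2)) * fps_X ^ (2 * t)
      + fps_const (xpoly (monom (1 / (4 * real t)) 4)) * fps_X ^ (4 * t)"
  obtain u where u: "t = 2 * u" "u > 0" using assms by (auto elim: evenE)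
  have dE: "fps_deriv E = h * E" unfolding E_def h_def by (rule hook_gf_deriv[OF assms(2)])
  have f0: "fps_nth f 0 = 0" using assms(2) by (simp add: f_def)
  have df: "fps_deriv f = of_nat u * h"
  proof -
    have c: "of_nat u * (fps_const c * z) = fps_const (of_nat u * c) * z" for c :: laurent and z
      by (simp only: fps_of_nat[symmetric] fps_const_mult[symmetric] mult.assoc)
    have "real (2 * t) * (1 / 2) = real u * 2" "real (4 * t) * (1 / (4 * real t)) = real u * (2 / real t)"
      using u by simp_all
    then show ?thesis
      unfolding f_def h_def fps_deriv_add fps_deriv_monom distrib_left c xpoly_of_nat smult_monom by (simp add: mult.commute)
  qed
  have "E ^ u = exp_qseries f"
  proof (rule fps_ode_unique)
    show "fps_deriv (E ^ u) = (of_nat u * h) * E ^ u"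
    proof -
      obtain v where v: "u = Suc v" using u(2) by (cases u) auto
      have "fps_deriv (E ^ u) = of_nat u * (h * E) * E ^ v"
        by (simp only: fps_deriv_power dE fps_of_nat v diff_Suc_1)
      then show ?thesis by (simp add: v mult_ac del: of_nat_Suc)
    qed
    show "fps_deriv (exp_qseries f) = (of_nat u * h) * exp_qseries f"
      using exp_qseries_deriv[OF f0] df by simp
    have "fps_nth E 0 = 1"
      unfolding E_def by (subst hook_gf_nth[OF assms(2)]) (simp add: hook_sum_0)
    then show "fps_nth (E ^ u) 0 = fps_nth (exp_qseries f) 0"
      by (simp add: fps_nth_power_0 exp_qseries_nth_0[OF f0])
  qed
  moreover have "f = scalar (1 / 2) * x_var ^ 2 * q_var ^ (2 * t)
        + scalar (1 / (4 * real t)) * x_var ^ 4 * q_var ^ (4 * t)"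
    by (simp only: f_def scalar_x_var q_var_def)
  ultimately show ?thesis using u by (simp add: E_def)
qed

section \<open>Partitions as Maya diagrams\<close>

text \<open>The index also runs past the last part: there \<open>part l i = 0\<close>, and the
  positions -i fill the vacuum.\<close>

definition maya_of :: "nat list \<Rightarrow> int set" where
  "maya_of l = {int (part l i) - int i |i. 1 \<le> i}"

lemma maya_ofI: "1 \<le> i \<Longrightarrow> int (part l i) - int i \<in> maya_of l"
  by (auto simp: maya_of_def)

lemma maya_of_Nil: "maya_of [] = {..<0}"
proof -
  have "s \<in> maya_of []" if "s < 0" for s
    unfolding maya_of_def using that by (auto simp: part_def intro!: exI[of _ "nat (- s)"])
  moreover have "s < 0" if "s \<in> maya_of []" for s
    using that by (auto simp: maya_of_def part_def)
  ultimately show ?thesis by blast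
qed

lemma part_Cons_1: "part (x # l) (Suc 0) = x" and part_Cons_Suc: "1 \<le> i \<Longrightarrow> part (x # l) (Suc i) = part l i"
  by (auto simp: part_def)

lemma maya_of_Cons: "maya_of (x # l) = insert (int x - 1) (shift (- 1) (maya_of l))"
proof -
  have "s \<in> maya_of (x # l) \<longleftrightarrow> s = int x - 1 \<or> s + 1 \<in> maya_of l" for s
  proof
    assume "s \<in> maya_of (x # l)"
    then obtain i where i: "1 \<le> i" "s = int (part (x # l) i) - int i" by (auto simp: maya_of_def)
    show "s = int x - 1 \<or> s + 1 \<in> maya_of l"
    proof (cases "i = 1")
      case True
      then show ?thesis using i by (simp add: part_Cons_1)
    next
      case False
      then obtain k where "i = Suc k" "1 \<le> k" using i(1) by (cases i) auto
      then show ?thesis using i by (auto simp: part_Cons_Suc maya_of_def intro!: exI[of _ k])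
    qed
  next
    assume "s = int x - 1 \<or> s + 1 \<in> maya_of l"
    then show "s \<in> maya_of (x # l)"
    proof
      assume "s = int x - 1"
      then show ?thesis using maya_ofI[of 1 "x # l"] by (simp add: part_Cons_1)
    next
      assume "s + 1 \<in> maya_of l"
      then obtain i where "1 \<le> i" "s + 1 = int (part l i) - int i" by (auto simp: maya_of_def)
      then have "s = int (part (x # l) (Suc i)) - int (Suc i)" by (simp add: part_Cons_Suc)
      then show ?thesis using maya_ofI[of "Suc i" "x # l"] by simp
    qed
  qed
  then show ?thesis by (simp add: set_eq_iff)
qed

lemma is_partition_Nil [simp]: "is_partition []"
  by (simp add: is_partition_def)

lemma is_partition_Cons: "is_partition (x # l) \<longleftrightarrow> 0 < x \<and> (\<forall>y\<in>set l. y \<le> x) \<and> is_partition l"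
  by (auto simp: is_partition_def)

lemma maya_of_less:
  assumes "\<forall>y\<in>set l. y \<le> x" "s \<in> maya_of l"
  shows "s < int x"
proof -
  obtain i where i: "1 \<le> i" "s = int (part l i) - int i" using assms(2) by (auto simp: maya_of_def)
  have "part l i \<le> x" using assms(1) by (auto simp: part_def)
  then show ?thesis using i by simp
qed

lemma maya_maya_of: "maya (maya_of l)"
  by (induction l) (simp_all add: maya_of_Nil maya_of_Cons)

lemma Cons_new:
  assumes "is_partition (x # l)" shows "int x - 1 \<notin> shift (- 1) (maya_of l)"
  using maya_of_less[of l x "int x"] assms by (auto simp: is_partition_Cons)

lemma en_maya_of_Cons:
  assumes "is_partition (x # l)"
  shows "en F (maya_of (x # l)) = en (\<lambda>s. F (s - 1)) (maya_of l) - F (- 1) + F (int x - 1)"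
  using Cons_new[OF assms] by (simp add: maya_of_Cons en_insert maya_maya_of en_shift_minus1)

lemma charge_maya_of: "is_partition l \<Longrightarrow> charge (maya_of l) = 0"
proof (induction l)
  case (Cons x l)
  then show ?case using en_maya_of_Cons[OF Cons.prems, of "\<lambda>_. 1"]
    by (simp add: charge_def is_partition_Cons)
qed (simp add: maya_of_Nil charge_lessThan)

lemma diagram_Cons: "diagram (x # l) = Pair 1 ` {1..x} \<union> (\<lambda>(i, j). (Suc i, j)) ` diagram l"
proof -
  have "(i, j) \<in> diagram (x # l) \<longleftrightarrow> i = 1 \<and> j \<in> {1..x} \<or> (\<exists>k. i = Suc k \<and> (k, j) \<in> diagram l)" for i j
  proof (cases i)
    case (Suc k)
    then show ?thesis by (cases k) (auto simp: diagram_def part_def)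
  qed (auto simp: diagram_def)
  then show ?thesis by (auto simp: image_iff)
qed

lemma diagram_Nil [simp]: "diagram [] = {}"
  by (auto simp: diagram_def)

lemma finite_diagram: "finite (diagram l)"
  by (induction l) (auto simp: diagram_Cons)

text \<open>Row i holds the contents from 1 - i to \<open>\<lambda>\<^sub>i - i\<close>, so f
  telescopes to \<open>F (\<lambda>\<^sub>i - i) - F (- i)\<close>, a bead minus its vacuum
  position. Both functions stay arbitrary in the induction because the contents of the remaining
  rows are shifted by one.\<close>

lemma sum_diagram:
  fixes f F :: "int \<Rightarrow> int"
  assumes "is_partition l" "\<And>m. F m - F (m - 1) = f m"
  shows "(\<Sum>(i, j)\<in>diagram l. f (int j - int i)) = en F (maya_of l)"
  using assms
proof (induction l arbitrary: f F)
  case Nil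
  then show ?case by (simp add: maya_of_Nil)
next
  case (Cons x l)
  have row: "(\<Sum>j\<in>{1..n}. f (int j - 1)) = F (int n - 1) - F (- 1)" for n :: nat
  proof (induction n)
    case (Suc n)
    then show ?case using Cons.prems(2)[of "int n"] by simp
  qed simp
  have IH: "(\<Sum>(i, j)\<in>diagram l. f (int j - int i - 1)) = en (\<lambda>s. F (s - 1)) (maya_of l)"
  proof (rule Cons.IH[where f = "\<lambda>s. f (s - 1)"])
    show "is_partition l" using Cons.prems by (simp add: is_partition_Cons)
    show "F (m - 1) - F (m - 1 - 1) = f (m - 1)" for m by (rule Cons.prems)
  qed
  have "(\<Sum>(i, j)\<in>diagram (x # l). f (int j - int i))
      = (\<Sum>(i, j)\<in>Pair 1 ` {1..x}. f (int j - int i)) + (\<Sum>(i, j)\<in>(\<lambda>(i, j). (Suc i, j)) ` diagram l. f (int j - int i))"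
    unfolding diagram_Cons by (rule sum.union_disjoint) (auto simp: finite_diagram, auto simp: diagram_def)
  also have "(\<Sum>(i, j)\<in>Pair 1 ` {1..x}. f (int j - int i)) = (\<Sum>j\<in>{1..x}. f (int j - 1))"
    by (subst sum.reindex) (auto simp: inj_on_def)
  also have "(\<Sum>(i, j)\<in>(\<lambda>(i, j). (Suc i, j)) ` diagram l. f (int j - int i)) = (\<Sum>(i, j)\<in>diagram l. f (int j - int i - 1))"
    by (subst sum.reindex) (auto simp: inj_on_def algebra_simps intro!: sum.cong)
  finally show ?case unfolding row IH en_maya_of_Cons[OF Cons.prems(1)] by simp
qed

lemma sum_list_eq_en: "is_partition l \<Longrightarrow> int (sum_list l) = en (\<lambda>s. s) (maya_of l)"
proof (induction l)
  case (Cons x l)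
  have "en (\<lambda>s. s - 1) (maya_of l) = en (\<lambda>s. s) (maya_of l) - charge (maya_of l)"
    by (simp add: en_def charge_def sum_subtractf)
  then show ?case using Cons en_maya_of_Cons[OF Cons.prems, of "\<lambda>s. s"]
    by (simp add: charge_maya_of is_partition_Cons)
qed (simp add: maya_of_Nil)

text \<open>A discrete antiderivative of (-1)^m, which turns the BG-rank, an alternating sum over
  contents, into a sum over beads.\<close>

definition even_ind :: "int \<Rightarrow> int" where
  "even_ind m = (if even m then 1 else 0)"

lemma BG_rank_eq_en:
  assumes "is_partition l" shows "BG_rank l = en even_ind (maya_of l)"
proof -
  have "(\<Sum>(i, j)\<in>diagram l. (if even (int j - int i) then 1 else - 1)) = en even_ind (maya_of l)"
    by (rule sum_diagram[OF assms, where f = "\<lambda>m. if even m then 1 else - 1"]) (simp add: even_ind_def)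
  moreover have "(if even (int j - int i) then 1 else - 1) = ((- 1) ^ (i + j) :: int)" for i j
    by (simp add: minus_one_power_iff) 
  ultimately show ?thesis by (simp add: BG_rank_def)
qed

section \<open>Columns, gaps and hook lengths\<close>

lemma part_antimono:
  assumes "is_partition l" "1 \<le> i" "i \<le> k" shows "part l k \<le> part l i"
proof (cases "i = k")
  case False
  then show ?thesis
    using assms by (auto simp: is_partition_def part_def sorted_wrt_iff_nth_less)
qed simp

lemma down_closed_eq_interval:
  fixes S :: "nat set"
  assumes "finite S" "0 \<notin> S" "\<And>i k. k \<in> S \<Longrightarrow> 1 \<le> i \<Longrightarrow> i \<le> k \<Longrightarrow> i \<in> S"
  shows "S = {1..card S}"
proof (cases "S = {}")
  case False
  have "i \<in> S \<longleftrightarrow> 1 \<le> i \<and> i \<le> Max S" for i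
  proof
    assume i: "i \<in> S"
    then have "i \<noteq> 0" using assms(2) by metis
    then show "1 \<le> i \<and> i \<le> Max S" using i assms(1) by simp
  qed (use assms(3)[OF Max_in[OF assms(1) False]] in blast)
  then have "S = {1..Max S}" by (simp add: set_eq_iff)
  then show ?thesis by (metis card_atLeastAtMost diff_Suc_1)
qed simp

lemma le_part_iff_le_conj_part:
  assumes "is_partition l" "1 \<le> i" "1 \<le> j"
  shows "j \<le> part l i \<longleftrightarrow> i \<le> conj_part l j"
proof -
  define S where "S = {i. 1 \<le> i \<and> i \<le> length l \<and> j \<le> part l i}"
  have "finite S" "0 \<notin> S" by (auto simp: S_def)
  moreover have "i \<in> S" if "k \<in> S" "1 \<le> i" "i \<le> k" for i k
    using that part_antimono[OF assms(1) that(2,3)] by (auto simp: S_def)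
  ultimately have "S = {1..card S}" by (rule down_closed_eq_interval)
  moreover have "card S = conj_part l j" by (simp add: S_def conj_part_def)
  ultimately have "i \<in> S \<longleftrightarrow> i \<in> {1..conj_part l j}" by simp
  moreover have "i \<in> S \<longleftrightarrow> j \<le> part l i" using assms by (auto simp: part_def S_def)
  ultimately show ?thesis using assms(2) by simp
qed

lemma conj_part_antimono: "j \<le> k \<Longrightarrow> conj_part l k \<le> conj_part l j"
  unfolding conj_part_def by (rule card_mono) auto

lemma part_conj_cases:
  assumes "is_partition l" "1 \<le> i" "1 \<le> j"
  shows "j \<le> part l i \<and> i \<le> conj_part l j \<or> part l i < j \<and> conj_part l j < i"
  using le_part_iff_le_conj_part[OF assms] by linarith

text \<open>Along the boundary path of the diagram the beads are the vertical steps, one per row,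
  and the gaps are the horizontal steps, one per column. A row and a column at the same position
  would contradict \<open>part_conj_cases\<close>.\<close>

lemma compl_maya_of:
  assumes "is_partition l"
  shows "s \<notin> maya_of l \<longleftrightarrow> (\<exists>j\<ge>1. s = int j - 1 - int (conj_part l j))"
proof
  assume "\<exists>j\<ge>1. s = int j - 1 - int (conj_part l j)"
  then obtain j where j: "1 \<le> j" "s = int j - 1 - int (conj_part l j)" by blast
  show "s \<notin> maya_of l"
  proof
    assume "s \<in> maya_of l"
    then obtain i where i: "1 \<le> i" "s = int (part l i) - int i" by (auto simp: maya_of_def)
    show False using part_conj_cases[OF assms i(1) j(1)] i(2) j(2) by linarith
  qed
next
  assume s: "s \<notin> maya_of l"
  define P where "P i \<longleftrightarrow> 1 \<le> i \<and> int (part l i) - int i < s" for i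
  have "P (length l + nat (\<bar>s\<bar>) + 1)" by (auto simp: P_def part_def)
  then have ex: "\<exists>i. P i" by blast
  \<comment> \<open>Row i is the first whose bead lies below the gap s, so the column of this gap
    ends in row k = i - 1; solving s = j - 1 - k gives its number j.\<close>
  define i where "i = (LEAST i. P i)"
  have i: "P i" unfolding i_def using LeastI_ex[OF ex] .
  obtain k where k: "i = Suc k" using i by (cases i) (auto simp: P_def)
  define j where "j = nat (s + 1 + int k)"
  have "0 < s + 1 + int k" using i k by (simp add: P_def)
  then have j: "int j = s + 1 + int k" "1 \<le> j" by (auto simp: j_def)
  have "\<not> i \<le> conj_part l j"
    using le_part_iff_le_conj_part[OF assms, of i j] i j k by (auto simp: P_def)
  moreover have "k \<le> conj_part l j"
  proof (cases "k = 0")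
    case False
    have "\<not> P k" using k not_less_Least[of k P] by (simp add: i_def)
    moreover have "int (part l k) - int k \<noteq> s" using s False by (auto simp: maya_of_def)
    ultimately have "s < int (part l k) - int k" using False by (auto simp: P_def)
    then show ?thesis using le_part_iff_le_conj_part[OF assms, of k j] False j by auto
  qed simp
  ultimately have "conj_part l j = k" using k by simp
  then show "\<exists>j\<ge>1. s = int j - 1 - int (conj_part l j)" using j by (intro exI[of _ j]) auto
qed

text \<open>A box is the meeting of a row and a column, an inversion that of a bead and a gap below
  it. The difference of the two positions is the hook length after regrouping.\<close>

lemma bij_diagram_invs:
  assumes "is_partition l"
  defines "h \<equiv> \<lambda>(i, j). (int (part l i) - int i, int j - 1 - int (conj_part l j))"
  shows "bij_betw h (diagram l) (invs (maya_of l))"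
    and "\<And>p. p \<in> diagram l \<Longrightarrow> hook_length l p = (case h p of (a, b) \<Rightarrow> nat (a - b))"
proof -
  have mem: "(i, j) \<in> diagram l \<longleftrightarrow> 1 \<le> i \<and> 1 \<le> j \<and> j \<le> part l i" for i j
    by (auto simp: diagram_def part_def)
  have strict1: "int (part l k) - int k < int (part l i) - int i" if "1 \<le> i" "i < k" for i k
    using part_antimono[OF assms(1), of i k] that by linarith
  have strict2: "int i - 1 - int (conj_part l i) < int k - 1 - int (conj_part l k)" if "i < k" for i k
    using conj_part_antimono[of i k l] that by linarith
  have "inj_on h (diagram l)"
  proof (rule inj_onI, unfold split_paired_all)
    fix i j i' j' assume *: "(i, j) \<in> diagram l" "(i', j') \<in> diagram l" "h (i, j) = h (i', j')"
    have "i = i'" using strict1[of i i'] strict1[of i' i] * unfolding mem h_def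
      by (cases i i' rule: linorder_cases) auto
    moreover have "j = j'" using strict2[of j j'] strict2[of j' j] * unfolding h_def
      by (cases j j' rule: linorder_cases) auto
    ultimately show "(i, j) = (i', j')" by simp
  qed
  moreover have "h ` diagram l = invs (maya_of l)"
  proof
    show "h ` diagram l \<subseteq> invs (maya_of l)"
    proof (rule image_subsetI, unfold split_paired_all)
      fix i j assume "(i, j) \<in> diagram l"
      then have ij: "1 \<le> i" "1 \<le> j" "j \<le> part l i" by (auto simp: mem)
      then have "i \<le> conj_part l j" using le_part_iff_le_conj_part[OF assms(1)] by blast
      then have "int j - 1 - int (conj_part l j) < int (part l i) - int i" using ij by linarith
      moreover have "int j - 1 - int (conj_part l j) \<notin> maya_of l"
        using compl_maya_of[OF assms(1)] ij by blast
      ultimately show "h (i, j) \<in> invs (maya_of l)"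
        using ij by (auto simp: h_def invs_def maya_of_def)
    qed
    show "invs (maya_of l) \<subseteq> h ` diagram l"
    proof (rule subsetI, unfold split_paired_all)
      fix a b assume ab: "(a, b) \<in> invs (maya_of l)"
      then obtain i where i: "1 \<le> i" "a = int (part l i) - int i" by (auto simp: invs_def maya_of_def)
      have "b \<notin> maya_of l" using ab by (auto simp: invs_def)
      then obtain j where j: "1 \<le> j" "b = int j - 1 - int (conj_part l j)"
        using compl_maya_of[OF assms(1)] by blast
      have "b < a" using ab by (auto simp: invs_def)
      then have "j \<le> part l i" using part_conj_cases[OF assms(1) i(1) j(1)] i j by linarith
      then show "(a, b) \<in> h ` diagram l" using i j by (auto simp: h_def mem intro!: image_eqI[of _ _ "(i, j)"])
    qed
  qed
  ultimately show "bij_betw h (diagram l) (invs (maya_of l))" by (simp add: bij_betw_def)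
  fix p assume "p \<in> diagram l"
  then obtain i j where p: "p = (i, j)" "1 \<le> i" "1 \<le> j" "j \<le> part l i" by (cases p) (auto simp: mem)
  then have "i \<le> conj_part l j" using le_part_iff_le_conj_part[OF assms(1)] by blast
  then show "hook_length l p = (case h p of (a, b) \<Rightarrow> nat (a - b))"
    using p by (simp add: hook_length_def h_def nat_eq_iff)
qed

lemma hooks_dvd_eq:
  assumes "is_partition l"
  shows "hooks_dvd t l = filter_mset (\<lambda>h. t dvd h) (image_mset (\<lambda>(a, b). nat (a - b)) (mset_set (invs (maya_of l))))"
proof -
  let ?h = "\<lambda>(i, j). (int (part l i) - int i, int j - 1 - int (conj_part l j))"
  note bij = bij_diagram_invs[OF assms]
  have "mset_set (invs (maya_of l)) = image_mset ?h (mset_set (diagram l))"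
    using bij(1) by (simp add: image_mset_mset_set bij_betw_def)
  then have "image_mset (\<lambda>(a, b). nat (a - b)) (mset_set (invs (maya_of l)))
      = image_mset (\<lambda>p. case ?h p of (a, b) \<Rightarrow> nat (a - b)) (mset_set (diagram l))"
    by (simp only: multiset.map_comp o_def)
  also have "\<dots> = image_mset (hook_length l) (mset_set (diagram l))"
    by (rule image_mset_cong) (simp only: bij(2) finite_set_mset_mset_set finite_diagram)
  finally show ?thesis by (simp add: hooks_dvd_def)
qed

lemma part_conjugate:
  assumes "is_partition l" "1 \<le> j" shows "part (conjugate l) j = conj_part l j"
proof (cases "j \<le> part l 1")
  case True
  then show ?thesis using assms(2) by (simp add: part_def conjugate_def del: upt_Suc)
next
  case False
  then have "\<not> 1 \<le> conj_part l j" using le_part_iff_le_conj_part[OF assms(1), of 1 j] assms(2) by simp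
  then show ?thesis using False by (simp add: part_def conjugate_def del: upt_Suc)
qed

lemma maya_of_conjugate:
  assumes "is_partition l" shows "s \<in> maya_of (conjugate l) \<longleftrightarrow> - 1 - s \<notin> maya_of l"
proof -
  have "s \<in> maya_of (conjugate l) \<longleftrightarrow> (\<exists>j\<ge>1. s = int (part (conjugate l) j) - int j)"
    unfolding maya_of_def by blast
  also have "\<dots> \<longleftrightarrow> (\<exists>j\<ge>1. s = int (conj_part l j) - int j)"
    by (intro ex_cong1 conj_cong refl) (simp add: part_conjugate[OF assms])
  also have "\<dots> \<longleftrightarrow> (\<exists>j\<ge>1. - 1 - s = int j - 1 - int (conj_part l j))"
    by (intro ex_cong1) auto
  finally show ?thesis using compl_maya_of[OF assms] by simp
qed

lemma is_partition_conjugate: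
  assumes "is_partition l" shows "is_partition (conjugate l)"
proof -
  have "sorted_wrt (\<ge>) (conjugate l)"
    unfolding conjugate_def sorted_wrt_map
    by (rule sorted_wrt_mono_rel[OF _ sorted_wrt_upt]) (auto intro: conj_part_antimono)
  moreover have "0 < conj_part l j" if "1 \<le> j" "j \<le> part l 1" for j
    using le_part_iff_le_conj_part[OF assms, of 1 j] that by simp
  ultimately show ?thesis by (auto simp: is_partition_def conjugate_def)
qed

lemma maya_of_inj: "is_partition l \<Longrightarrow> is_partition l' \<Longrightarrow> maya_of l = maya_of l' \<Longrightarrow> l = l'"
proof (induction l arbitrary: l')
  case Nil
  show ?case
  proof (cases l')
    case (Cons y k)
    then have "int y - 1 \<in> {..<0}" using Nil by (auto simp: maya_of_Nil maya_of_Cons)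
    then show ?thesis using Nil Cons by (simp add: is_partition_Cons)
  qed simp
next
  case (Cons x l)
  show ?case
  proof (cases l')
    case Nil
    have "int x - 1 \<in> maya_of (x # l)" by (simp add: maya_of_Cons)
    then have "int x - 1 \<in> {..<0}" unfolding Cons.prems(3) Nil maya_of_Nil .
    then show ?thesis using Cons by (simp add: is_partition_Cons)
  next
    case l': (Cons y k)
    have le: "s \<le> int z - 1" if "is_partition (z # m)" "s \<in> maya_of (z # m)" for s z m
      using that maya_of_less[of "z # m" z s] by (auto simp: is_partition_Cons)
    have "int x - 1 \<in> maya_of (x # l)" "int y - 1 \<in> maya_of (y # k)" by (simp_all add: maya_of_Cons)
    then have xy: "x = y" using le[of x l "int y - 1"] le[of y k "int x - 1"] Cons.prems l' by simp
    have "shift (-1) (maya_of l) = maya_of (x # l) - {int x - 1}"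
      "shift (-1) (maya_of k) = maya_of (y # k) - {int y - 1}"
      using Cons_new[of x l] Cons_new[of y k] Cons.prems l' by (auto simp: maya_of_Cons)
    then have "shift (-1) (maya_of l) = shift (-1) (maya_of k)" using Cons.prems(3) xy l' by simp
    then have "shift 1 (shift (-1) (maya_of l)) = shift 1 (shift (-1) (maya_of k))" by simp
    then have "l = k" using Cons.IH[of k] Cons.prems l' by (simp add: is_partition_Cons)
    then show ?thesis using xy l' by simp
  qed
qed

text \<open>Induction on a bound N for the number of parts: the largest bead x gives the first part
  x + 1, and the other beads, raised by one, need one part fewer. Without nonnegative beads, charge
  0 also excludes negative gaps, and the diagram is the vacuum.\<close>

lemma maya_of_surj:
  assumes "maya M" "charge M = 0"
  obtains l where "is_partition l" "maya_of l = M"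
proof -
  have "\<exists>l. is_partition l \<and> maya_of l = M"
    if "maya M" "charge M = 0" "{..<- int N} \<subseteq> M" for N M
    using that
  proof (induction N arbitrary: M)
    case 0
    then have "M \<in> maya0_above 0" by (simp add: maya0_above_def maya0_def)
    then show ?case using maya_of_Nil is_partition_Nil unfolding maya0_above_0 by blast
  next
    case (Suc N)
    show ?case
    proof (cases "M \<inter> {0..} = {}")
      case True
      then have "int (card ({..<0} - M)) = 0" using Suc.prems by (simp add: charge_def en_def)
      then have "{..<0} - M = {}" using Suc.prems(1) by (simp add: maya_def)
      then have "M \<in> maya0_above 0" using Suc.prems by (auto simp: maya0_above_def maya0_def)
      then show ?thesis using maya_of_Nil is_partition_Nil unfolding maya0_above_0 by blast
    next
      case False
      define x where "x = Max (M \<inter> {0..})"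
      have fin: "finite (M \<inter> {0..})" using Suc.prems(1) by (simp add: maya_def)
      have x: "x \<in> M" "0 \<le> x" using Max_in[OF fin False] by (auto simp: x_def)
      have max: "s \<le> x" if "s \<in> M" for s
      proof (cases "0 \<le> s")
        case True
        then show ?thesis using that fin by (auto simp: x_def)
      qed (use x in simp)
      let ?M = "shift 1 (M - {x})"
      have "charge ?M = 0" using Suc.prems x by (simp add: charge_shift) (simp add: charge_def en_remove)
      moreover have "{..<- int N} \<subseteq> ?M"
      proof
        fix s assume "s \<in> {..<- int N}"
        then have "s - 1 \<in> M" "s - 1 \<noteq> x" using subsetD[OF Suc.prems(3), of "s - 1"] x by auto
        then show "s \<in> ?M" by simp
      qed
      ultimately obtain l where l: "is_partition l" "maya_of l = ?M"
        using Suc.IH[of ?M] Suc.prems(1) by auto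
      have "y \<le> nat (x + 1)" if "y \<in> set l" for y
      proof -
        obtain i where "i < length l" "l ! i = y" using \<open>y \<in> set l\<close> by (auto simp: in_set_conv_nth)
        then have "y = part l (Suc i)" by (simp add: part_def)
        also have "\<dots> \<le> part l 1" by (rule part_antimono[OF l(1)]) auto
        finally have "y \<le> part l 1" .
        moreover have "int (part l 1) - 1 \<in> ?M" using maya_ofI[of 1 l] l(2) by simp
        then have "int (part l 1) - 2 \<le> x" using max by auto
        moreover have "int (part l 1) - 2 \<noteq> x" using \<open>int (part l 1) - 1 \<in> ?M\<close> by auto
        ultimately show ?thesis by linarith
      qed
      then have "is_partition (nat (x + 1) # l)" using l(1) x(2) by (auto simp: is_partition_Cons)
      moreover have "maya_of (nat (x + 1) # l) = M"
        unfolding maya_of_Cons l(2) using x by auto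
      ultimately show ?thesis by blast
    qed
  qed
  moreover obtain N where "0 \<le> N" "{..<-N} \<subseteq> M" "M \<subseteq> {..<N}" using maya_bounds[OF assms(1)] .
  then have "{..<- int (nat N)} \<subseteq> M" by simp
  ultimately show thesis using assms that by blast
qed

section \<open>Diagrams exchanged with their complement by the reflection\<close>

definition sym_maya :: "int set set" where
  "sym_maya = {M. maya M \<and> (\<forall>s. s \<in> M \<longleftrightarrow> - 1 - s \<notin> M)}"

lemma inj_on_reflect: "inj_on (\<lambda>s :: int. - 1 - s) A"
  by (simp add: inj_on_def)

lemma sym_maya_missing:
  assumes "M \<in> sym_maya" shows "{..<0} - M = (\<lambda>s. - 1 - s) ` (M \<inter> {0..})"
proof -
  have iff: "s \<in> M \<longleftrightarrow> - 1 - s \<notin> M" for s using assms unfolding sym_maya_def by blast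
  have R: "s \<in> (\<lambda>s. - 1 - s) ` (M \<inter> {0..}) \<longleftrightarrow> - 1 - s \<in> M \<and> 0 \<le> - 1 - s" for s
    by (auto simp: image_iff intro!: bexI[of _ "- 1 - s"])
  have L: "s \<in> {..<0} - M \<longleftrightarrow> - 1 - s \<in> M \<and> 0 \<le> - 1 - s" for s
    using iff[of s] by auto
  show ?thesis by (rule set_eqI) (simp only: L R)
qed

text \<open>The negative gaps are the mirror images of the nonnegative beads, so the two sums of
  \<open>en\<close> combine. A constant F gives 0: symmetric diagrams have charge 0.\<close>

lemma en_sym_maya:
  assumes "M \<in> sym_maya" shows "en F M = (\<Sum>s\<in>M \<inter> {0..}. F s - F (- 1 - s))"
  unfolding en_def sym_maya_missing[OF assms]
  by (subst sum.reindex[OF inj_on_reflect]) (simp add: sum_subtractf)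

theorem bij_self_conjugate: "bij_betw maya_of self_conjugate_partitions sym_maya"
  unfolding bij_betw_def
proof
  show "inj_on maya_of self_conjugate_partitions"
    by (rule inj_onI) (auto simp: self_conjugate_partitions_def intro: maya_of_inj)
  show "maya_of ` self_conjugate_partitions = sym_maya"
  proof
    show "maya_of ` self_conjugate_partitions \<subseteq> sym_maya"
    proof (rule image_subsetI)
      fix l assume "l \<in> self_conjugate_partitions"
      then have "is_partition l" "conjugate l = l" by (auto simp: self_conjugate_partitions_def)
      then have "s \<in> maya_of l \<longleftrightarrow> - 1 - s \<notin> maya_of l" for s
        using maya_of_conjugate[of l s] by simp
      then show "maya_of l \<in> sym_maya" unfolding sym_maya_def using maya_maya_of by blast
    qed
    show "sym_maya \<subseteq> maya_of ` self_conjugate_partitions"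
    proof
      fix M assume M: "M \<in> sym_maya"
      then have "charge M = 0" by (simp add: charge_def en_sym_maya)
      then obtain l where l: "is_partition l" "maya_of l = M"
        using maya_of_surj[of M] M unfolding sym_maya_def by blast
      have "maya_of (conjugate l) = maya_of l"
      proof (rule set_eqI)
        fix s
        have "s \<in> M \<longleftrightarrow> - 1 - s \<notin> M" using M unfolding sym_maya_def by blast
        then show "s \<in> maya_of (conjugate l) \<longleftrightarrow> s \<in> maya_of l"
          unfolding maya_of_conjugate[OF l(1)] l(2) by (rule sym)
      qed
      then have "conjugate l = l" by (rule maya_of_inj[OF is_partition_conjugate[OF l(1)] l(1)])
      then show "M \<in> maya_of ` self_conjugate_partitions"
        using l by (auto simp: self_conjugate_partitions_def)
    qed
  qed
qed

section \<open>Runners of a symmetric Maya diagram\<close>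

definition runner :: "nat \<Rightarrow> nat \<Rightarrow> int set \<Rightarrow> int set" where
  "runner t k S = {m. int k + int t * m \<in> S}"

definition runners :: "nat \<Rightarrow> int set \<Rightarrow> nat \<Rightarrow> int set" where
  "runners t S = (\<lambda>k\<in>{..<t div 2}. runner t k S)"

text \<open>Residues below t / 2 carry the given diagrams; residue t - 1 - k is forced to be the
  reflected complement of runner k. For even t the result is symmetric whatever f is.\<close>

definition merge :: "nat \<Rightarrow> (nat \<Rightarrow> int set) \<Rightarrow> int set" where
  "merge t f = {s. if s mod int t < int (t div 2) then s div int t \<in> f (nat (s mod int t))
    else - 1 - s div int t \<notin> f (nat (int t - 1 - s mod int t))}"

lemma reflect_div_mod:
  fixes s :: int assumes "0 < t"
  shows "(- 1 - s) mod t = t - 1 - s mod t" "(- 1 - s) div t = - 1 - s div t"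
proof -
  have eq: "- 1 - s = (t - 1 - s mod t) + t * (- 1 - s div t)"
    using mult_div_mod_eq[of t s] by (simp add: algebra_simps)
  have r: "0 \<le> t - 1 - s mod t" "t - 1 - s mod t < t"
    using assms pos_mod_bound[OF assms, of s] pos_mod_sign[OF assms, of s] by auto
  show "(- 1 - s) mod t = t - 1 - s mod t" unfolding eq using r by simp
  show "(- 1 - s) div t = - 1 - s div t" unfolding eq using r by simp
qed

lemma add_mult_div_mod:
  assumes "k < t"
  shows "(int k + int t * m) mod int t = int k" "(int k + int t * m) div int t = m"
  using assms by simp_all

context
  fixes t u :: nat
  assumes t: "t = 2 * u" "0 < u"
begin

lemma runner_merge:
  assumes "k < u" shows "runner t k (merge t f) = f k"
  using assms t add_mult_div_mod[of k t] by (auto simp: runner_def merge_def)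

lemma runners_apply: "k < u \<Longrightarrow> runners t S k = runner t k S"
  using t(1) by (simp add: runners_def)

lemma merge_reflect: "s \<in> merge t f \<longleftrightarrow> - 1 - s \<notin> merge t f"
proof -
  have t0: "0 < int t" using t by simp
  have mem: "s \<in> merge t f \<longleftrightarrow> (if s mod int t < int u then s div int t \<in> f (nat (s mod int t))
      else - 1 - s div int t \<notin> f (nat (int t - 1 - s mod int t)))" for s
    unfolding merge_def using t(1) by simp
  have "int t - 1 - s mod int t < int u \<longleftrightarrow> \<not> s mod int t < int u" using t(1) by linarith
  then show ?thesis
    unfolding mem[of s] mem[of "- 1 - s"] reflect_div_mod[OF t0]
    by (cases "s mod int t < int u") (simp_all only: if_True if_False not_not simp_thms, simp_all)
qed

lemma merge_runners:
  assumes "S \<in> sym_maya" shows "merge t (runners t S) = S"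
proof (rule set_eqI)
  fix s
  have t0: "0 < int t" using t by simp
  have iff: "s \<in> S \<longleftrightarrow> - 1 - s \<notin> S" using assms unfolding sym_maya_def by blast
  have b: "0 \<le> s mod int t" "s mod int t < int t" using t0 by simp_all
  have s: "s = s mod int t + int t * (s div int t)" by simp
  have s': "- 1 - s = (int t - 1 - s mod int t) + int t * (- 1 - s div int t)"
    using s by (simp add: algebra_simps)
  show "s \<in> merge t (runners t S) \<longleftrightarrow> s \<in> S"
  proof (cases "s mod int t < int u")
    case True
    then have "nat (s mod int t) < u" using b by simp
    then have "s \<in> merge t (runners t S) \<longleftrightarrow> s mod int t + int t * (s div int t) \<in> S"
      using True b t by (simp add: merge_def runners_def runner_def)
    then show ?thesis by simp
  next
    case False
    then have "nat (int t - 1 - s mod int t) < u" "0 \<le> int t - 1 - s mod int t" using b t by auto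
    then have "s \<in> merge t (runners t S) \<longleftrightarrow> (int t - 1 - s mod int t) + int t * (- 1 - s div int t) \<notin> S"
      using False t unfolding merge_def runners_def runner_def by (simp del: of_nat_mult)
    then show ?thesis unfolding s'[symmetric] iff .
  qed
qed

lemma maya_runner:
  assumes "maya S" "k < u" shows "maya (runner t k S)"
  unfolding maya_def
proof
  have inj: "inj (\<lambda>m. int k + int t * m)" using t by (simp add: inj_on_def)
  have "(\<lambda>m. int k + int t * m) ` (runner t k S \<inter> {0..}) \<subseteq> S \<inter> {0..}"
    by (auto simp: runner_def)
  then show "finite (runner t k S \<inter> {0..})"
    using assms(1) inj by (meson finite_imageD finite_subset inj_on_subset maya_def top_greatest)
  have "int k + int t * m < 0" if "m < 0" for m
  proof -
    have "int t * (m + 1) \<le> 0" using that by (simp add: mult_nonneg_nonpos)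
    then show ?thesis using assms(2) t by (simp add: algebra_simps)
  qed
  then have "(\<lambda>m. int k + int t * m) ` ({..<0} - runner t k S) \<subseteq> {..<0} - S"
    by (auto simp: runner_def)
  then show "finite ({..<0} - runner t k S)"
    using assms(1) inj by (meson finite_imageD finite_subset inj_on_subset maya_def top_greatest)
qed

text \<open>The mirror residue of k has a bead at -1 - k - t m exactly when m is a gap of
  \<open>f k\<close>, and that position is nonnegative exactly when m < 0. So the nonnegative beads
  of the merged diagram correspond to the beads and gaps that \<open>en\<close> counts on the
  runners.\<close>

lemma merge_nonneg:
  "merge t f \<inter> {0..} = (\<Union>k<u. (\<lambda>m. int k + int t * m) ` (f k \<inter> {0..}) \<union> (\<lambda>m. - 1 - int k - int t * m) ` ({..<0} - f k))"
  (is "?L = ?R")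
proof
  show "?L \<subseteq> ?R"
  proof
    fix s assume s: "s \<in> ?L"
    have t0: "0 < int t" using t by simp
    define r m where "r = s mod int t" and "m = s div int t"
    have b: "0 \<le> r" "r < int t" using t0 by (simp_all add: r_def)
    have m: "0 \<le> m" using s t0 by (simp add: m_def pos_imp_zdiv_nonneg_iff)
    have srm: "s = r + int t * m" by (simp add: r_def m_def)
    show "s \<in> ?R"
    proof (cases "r < int u")
      case True
      then have "m \<in> f (nat r)" using s t by (simp add: merge_def r_def m_def)
      then have "s \<in> (\<lambda>m. int (nat r) + int t * m) ` (f (nat r) \<inter> {0..})"
        using m b srm by (intro image_eqI[of _ _ m]) auto
      then show ?thesis using True b by (intro UN_I[of "nat r"]) auto
    next
      case False
      define k where "k = nat (int t - 1 - r)"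
      have k: "k < u" "int k = int t - 1 - r" using False b t by (auto simp: k_def)
      have "- 1 - m \<notin> f k" using s t False by (simp add: merge_def r_def m_def k_def)
      then have "s \<in> (\<lambda>m. - 1 - int k - int t * m) ` ({..<0} - f k)"
        using m by (intro image_eqI[of _ _ "- 1 - m"]) (auto simp: srm k(2) algebra_simps)
      then show ?thesis using k by (intro UN_I[of k]) auto
    qed
  qed
  show "?R \<subseteq> ?L"
  proof
    fix s assume "s \<in> ?R"
    then obtain k where k: "k < u" and
      "s \<in> (\<lambda>m. int k + int t * m) ` (f k \<inter> {0..}) \<or> s \<in> (\<lambda>m. - 1 - int k - int t * m) ` ({..<0} - f k)"
      by blast
    then consider (1) m where "m \<in> f k" "0 \<le> m" "s = int k + int t * m"
      | (2) m where "m \<notin> f k" "m < 0" "- 1 - s = int k + int t * m" by force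
    then show "s \<in> ?L"
    proof cases
      case 1
      have "m \<in> runner t k (merge t f)" using 1 runner_merge[OF k] by simp
      then show ?thesis using 1 by (simp add: runner_def)
    next
      case 2
      have "m \<notin> runner t k (merge t f)" using 2 runner_merge[OF k] by simp
      then have "- 1 - s \<notin> merge t f" using 2(3) by (simp add: runner_def)
      then have "s \<in> merge t f" using merge_reflect[of s] by blast
      moreover have "int t * (m + 1) \<le> 0" using 2(2) by (simp add: mult_nonneg_nonpos)
      then have "0 \<le> s" using 2(3) k t by (simp add: algebra_simps)
      ultimately show ?thesis by simp
    qed
  qed
qed

lemma merge_sym_maya:
  assumes "\<And>k. k < u \<Longrightarrow> maya (f k)" shows "merge t f \<in> sym_maya"
proof -
  have "finite (merge t f \<inter> {0..})"
    unfolding merge_nonneg using assms by (auto simp: maya_def)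
  moreover have "{..<0} - merge t f \<subseteq> (\<lambda>s. - 1 - s) ` (merge t f \<inter> {0..})"
  proof
    fix s assume s: "s \<in> {..<0} - merge t f"
    then have "- 1 - s \<in> merge t f" using merge_reflect[of s] by blast
    then show "s \<in> (\<lambda>s. - 1 - s) ` (merge t f \<inter> {0..})"
      using s by (intro image_eqI[of _ _ "- 1 - s"]) auto
  qed
  ultimately have "maya (merge t f)" unfolding maya_def by (meson finite_imageI finite_subset)
  then show ?thesis unfolding sym_maya_def using merge_reflect by blast
qed

lemma bij_runners: "bij_betw (runners t) sym_maya (PiE {..<u} (\<lambda>_. Collect maya))"
proof (rule bij_betw_byWitness[of _ "merge t"])
  show "\<forall>S\<in>sym_maya. merge t (runners t S) = S" using merge_runners by blast
  show "\<forall>f\<in>PiE {..<u} (\<lambda>_. Collect maya). runners t (merge t f) = f"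
  proof
    fix f :: "nat \<Rightarrow> int set" assume f: "f \<in> PiE {..<u} (\<lambda>_. Collect maya)"
    show "runners t (merge t f) = f"
    proof
      fix k show "runners t (merge t f) k = f k"
      proof (cases "k < u")
        case True
        then show ?thesis using runner_merge[OF True] by (simp add: runners_apply)
      next
        case False
        then show ?thesis using PiE_arb[OF f, of k] t(1) by (simp add: runners_def)
      qed
    qed
  qed
  show "runners t ` sym_maya \<subseteq> PiE {..<u} (\<lambda>_. Collect maya)"
  proof (rule image_subsetI)
    fix S assume "S \<in> sym_maya"
    then have "maya S" by (simp add: sym_maya_def)
    show "runners t S \<in> PiE {..<u} (\<lambda>_. Collect maya)"
    proof (rule PiE_I)
      fix k assume "k \<in> {..<u}"
      then show "runners t S k \<in> Collect maya" using maya_runner[OF \<open>maya S\<close>] by (simp add: runners_apply)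
    next
      fix k assume "k \<notin> {..<u}"
      then show "runners t S k = undefined" using t(1) by (simp add: runners_def)
    qed
  qed
  show "merge t ` PiE {..<u} (\<lambda>_. Collect maya) \<subseteq> sym_maya"
    using merge_sym_maya by (auto simp: PiE_def Pi_def)
qed

text \<open>By \<open>en_sym_maya\<close> the left-hand side sums D(s) = F(s) - F(-1 - s) over the
  nonnegative beads of S. These come from nonnegative beads and negative gaps of the runners; D
  changes sign under the reflection, so the gaps enter negatively, as in \<open>en\<close>.\<close>

lemma en_runners:
  assumes "S \<in> sym_maya"
  shows "en F S = (\<Sum>k<u. en (\<lambda>m. F (int k + int t * m) - F (- 1 - int k - int t * m)) (runner t k S))"
proof -
  define D where "D s = F s - F (- 1 - s)" for s
  define R where "R k = runner t k S" for k
  let ?A = "\<lambda>k. (\<lambda>m. int k + int t * m) ` (R k \<inter> {0..})"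
  let ?B = "\<lambda>k. (\<lambda>m. - 1 - int k - int t * m) ` ({..<0} - R k)"
  have mayaR: "maya (R k)" if "k < u" for k
    using maya_runner[OF _ that, of S] assms by (simp add: R_def sym_maya_def)
  have S: "S \<inter> {0..} = (\<Union>k<u. ?A k \<union> ?B k)"
  proof -
    have "S = merge t (runners t S)" using merge_runners[OF assms] by simp
    then have "S \<inter> {0..} = merge t (runners t S) \<inter> {0..}" by simp
    then show ?thesis unfolding merge_nonneg using t by (simp add: runners_def R_def)
  qed
  have t0: "0 < int t" using t by simp
  have modA: "s mod int t = int k" if "s \<in> ?A k" "k < u" for s k
    using that t by (auto simp: add_mult_div_mod)
  have modB: "s mod int t = int t - 1 - int k" if "s \<in> ?B k" "k < u" for s k
  proof -
    from that obtain m where "s = - 1 - int k - int t * m" by blast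
    then have "s = - 1 - (int k + int t * m)" by simp
    moreover have "(int k + int t * m) mod int t = int k" using that t by (simp add: add_mult_div_mod)
    ultimately show ?thesis using reflect_div_mod(1)[OF t0, of "int k + int t * m"] by metis
  qed
  have fin: "finite (?A k)" "finite (?B k)" if "k < u" for k
    using mayaR[OF that] by (auto simp: maya_def)
  have dis: "?A k \<inter> ?B k = {}" if "k < u" for k
  proof -
    have False if "s \<in> ?A k" "s \<in> ?B k" for s
    proof -
      have "int k = int t - 1 - int k" using modA[OF that(1) \<open>k < u\<close>] modB[OF that(2) \<open>k < u\<close>] by (rule subst)
      then show False using t(1) by presburger
    qed
    then show ?thesis by blast
  qed
  have "en F S = sum D (S \<inter> {0..})" unfolding D_def by (rule en_sym_maya[OF assms])
  also have "\<dots> = (\<Sum>k<u. sum D (?A k \<union> ?B k))"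
    unfolding S
  proof (rule sum.UNION_disjoint)
    show "\<forall>i\<in>{..<u}. \<forall>j\<in>{..<u}. i \<noteq> j \<longrightarrow> (?A i \<union> ?B i) \<inter> (?A j \<union> ?B j) = {}"
    proof (intro ballI impI)
      fix i j assume ij: "i \<in> {..<u}" "j \<in> {..<u}" "i \<noteq> j"
      have "False" if "s \<in> ?A i \<union> ?B i" "s \<in> ?A j \<union> ?B j" for s
      proof -
        have "s mod int t = int i \<or> s mod int t = int t - 1 - int i" using that(1) modA modB ij by blast
        moreover have "s mod int t = int j \<or> s mod int t = int t - 1 - int j" using that(2) modA modB ij by blast
        ultimately show False using ij t by auto
      qed
      then show "(?A i \<union> ?B i) \<inter> (?A j \<union> ?B j) = {}" by blast
    qed
  qed (use fin in auto)
  also have "\<dots> = (\<Sum>k<u. en (\<lambda>m. F (int k + int t * m) - F (- 1 - int k - int t * m)) (R k))"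
  proof (rule sum.cong[OF refl])
    fix k assume "k \<in> {..<u}"
    then have k: "k < u" by simp
    have "sum D (?A k \<union> ?B k) = sum D (?A k) + sum D (?B k)"
      by (rule sum.union_disjoint[OF fin[OF k] dis[OF k]])
    also have "sum D (?A k) = (\<Sum>m\<in>R k \<inter> {0..}. F (int k + int t * m) - F (- 1 - int k - int t * m))"
      using t by (subst sum.reindex) (auto simp: inj_on_def D_def algebra_simps)
    also have "sum D (?B k) = (\<Sum>m\<in>{..<0} - R k. - (F (int k + int t * m) - F (- 1 - int k - int t * m)))"
      using t by (subst sum.reindex) (auto simp: inj_on_def D_def algebra_simps)
    finally show "sum D (?A k \<union> ?B k) = en (\<lambda>m. F (int k + int t * m) - F (- 1 - int k - int t * m)) (R k)"
      unfolding en_def sum_negf by simp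
  qed
  finally show ?thesis by (simp add: R_def)
qed

text \<open>A hook divisible by t joins a bead and a gap of the same residue. For a residue k < u it
  is t times a hook of runner k; otherwise the reflection, which exchanges beads with gaps and
  reverses the order, leads back to this case. The flag \<beta> tells the two copies apart.\<close>

lemma bij_hooks:
  assumes "S \<in> sym_maya"
  shows "bij_betw (\<lambda>(k, (a, b), \<beta>). if \<beta> then (- 1 - int k - int t * b, - 1 - int k - int t * a)
      else (int k + int t * a, int k + int t * b))
    (SIGMA k:{..<u}. invs (runner t k S) \<times> (UNIV :: bool set))
    {(a, b). (a, b) \<in> invs S \<and> t dvd nat (a - b)}" (is "bij_betw ?h ?X ?P")
proof (rule bij_betw_byWitness[of _ "\<lambda>(a, b). if a mod int t < int u
    then (nat (a mod int t), (a div int t, b div int t), False)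
    else (nat ((- 1 - b) mod int t), ((- 1 - b) div int t, (- 1 - a) div int t), True)"])
  let ?g = "\<lambda>(a, b). if a mod int t < int u
    then (nat (a mod int t), (a div int t, b div int t), False)
    else (nat ((- 1 - b) mod int t), ((- 1 - b) div int t, (- 1 - a) div int t), True)"
  have t0: "0 < int t" using t by simp
  have iff: "s \<in> S \<longleftrightarrow> - 1 - s \<notin> S" for s using assms unfolding sym_maya_def by blast
  have P: "(a, b) \<in> ?P \<longleftrightarrow> a \<in> S \<and> b \<notin> S \<and> b < a \<and> a mod int t = b mod int t" for a b
  proof -
    have "t dvd nat (a - b) \<longleftrightarrow> int t dvd a - b" if "b < a"
      using that by (metis diff_gt_0_iff_gt int_dvd_int_iff less_imp_le nat_0_le)
    then show ?thesis by (auto simp: invs_def mod_eq_dvd_iff)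
  qed
  have mod: "(int k + int t * m) mod int t = int k" "(int k + int t * m) div int t = m"
    "(- 1 - int k - int t * m) mod int t = int t - 1 - int k" if "k < u" for k m
  proof -
    show 1: "(int k + int t * m) mod int t = int k" "(int k + int t * m) div int t = m"
      using that t add_mult_div_mod[of k t m] by simp_all
    have "- 1 - int k - int t * m = - 1 - (int k + int t * m)" by simp
    then show "(- 1 - int k - int t * m) mod int t = int t - 1 - int k"
      using reflect_div_mod(1)[OF t0, of "int k + int t * m"] 1 by metis
  qed
  show "\<forall>x\<in>?X. ?g (?h x) = x"
  proof
    fix x assume "x \<in> ?X"
    then obtain k a b \<beta> where x: "x = (k, (a, b), \<beta>)" "k < u" by auto
    have "- 1 - (- 1 - int k - int t * m) = int k + int t * m" for m by simp
    then show "?g (?h x) = x" using x mod[OF x(2)] t by (cases \<beta>) (simp_all del: diff_diff_eq)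
  qed
  show "\<forall>p\<in>?P. ?h (?g p) = p"
  proof
    fix p assume p: "p \<in> ?P"
    obtain a b where ab: "p = (a, b)" by (cases p)
    have m: "a mod int t = b mod int t" using p P ab by blast
    have "0 \<le> a mod int t" "0 \<le> (- 1 - b) mod int t" using t0 by simp_all
    moreover have "(- 1 - a) mod int t = (- 1 - b) mod int t" using m reflect_div_mod(1)[OF t0] by simp
    moreover have "int t * (s div int t) = s - s mod int t" for s by (simp add: minus_mod_eq_mult_div)
    ultimately show "?h (?g p) = p" using m by (simp add: ab)
  qed
  show "?h ` ?X \<subseteq> ?P"
  proof (rule image_subsetI)
    fix x assume "x \<in> ?X"
    then obtain k a b \<beta> where x: "x = (k, (a, b), \<beta>)" "k < u" "(a, b) \<in> invs (runner t k S)" by auto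
    then have ab: "int k + int t * a \<in> S" "int k + int t * b \<notin> S" "b < a" by (auto simp: invs_def runner_def)
    then have "int t * b < int t * a" using t by simp
    moreover have "- 1 - int k - int t * b \<in> S" "- 1 - int k - int t * a \<notin> S"
      using ab iff[of "int k + int t * b"] iff[of "int k + int t * a"] by (simp_all add: algebra_simps)
    ultimately show "?h x \<in> ?P"
      unfolding x using ab mod[OF x(2)] P by (cases \<beta>) (simp_all only: case_prod_conv if_True if_False, simp_all)
  qed
  show "?g ` ?P \<subseteq> ?X"
  proof (rule image_subsetI)
    fix p assume p: "p \<in> ?P"
    obtain a b where ab: "p = (a, b)" by (cases p)
    have P': "a \<in> S" "b \<notin> S" "b < a" "a mod int t = b mod int t" using p P ab by blast+
    have lt: "y div int t < x div int t" if "y < x" "x mod int t = y mod int t" for x y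
      using that by (metis mult_div_mod_eq add_less_cancel_right mult_less_cancel_left_pos t0)
    have "0 \<le> a mod int t" using t0 by simp
    show "?g p \<in> ?X"
    proof (cases "a mod int t < int u")
      case True
      have "(a div int t, b div int t) \<in> invs (runner t (nat (a mod int t)) S)"
        using P' lt[OF P'(3,4)] \<open>0 \<le> a mod int t\<close> by (simp add: invs_def runner_def) (metis add.commute mult_div_mod_eq)
      then show ?thesis using True \<open>0 \<le> a mod int t\<close> ab by auto
    next
      case False
      have m: "(- 1 - b) mod int t = (- 1 - a) mod int t" "0 \<le> (- 1 - b) mod int t"
        unfolding reflect_div_mod(1)[OF t0] P'(4) using pos_mod_bound[OF t0, of b] by simp_all
      have mu: "(- 1 - b) mod int t < int u"
        unfolding reflect_div_mod(1)[OF t0] using False P'(4) t(1) by linarith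
      have "- 1 - b \<in> S" "- 1 - a \<notin> S" "- 1 - a < - 1 - b" using P' iff[of a] iff[of b] by auto
      then have "((- 1 - b) div int t, (- 1 - a) div int t) \<in> invs (runner t (nat ((- 1 - b) mod int t)) S)"
        using m(2) lt[of "- 1 - a" "- 1 - b"] m(1) mult_div_mod_eq[of "int t" "- 1 - a"] mult_div_mod_eq[of "int t" "- 1 - b"]
        by (simp add: invs_def runner_def add.commute)
      then show ?thesis using False m(2) mu ab by auto
    qed
  qed
qed

end

section \<open>The generating function of self-conjugate partitions\<close>

definition charge_sign :: "nat \<Rightarrow> int" where
  "charge_sign k = (if even k then 1 else - 1)"

text \<open>The size carried by runner k when its beads are \<open>{..<c}\<close>: the sum of 2 k +
  1 + 2 t m over these m, relative to the vacuum.\<close>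

definition charge_deg :: "nat \<Rightarrow> nat \<Rightarrow> int \<Rightarrow> nat" where
  "charge_deg t k c = nat ((2 * int k + 1) * c + int t * (c * (c - 1)))"

definition theta :: "nat \<Rightarrow> nat \<Rightarrow> qseries" where
  "theta t k = gf UNIV (charge_deg t k) (\<lambda>c. Poly_Mapping.single (charge_sign k * c) 1)"

text \<open>For c \<ge> 1 the linear term is at least c. For c < 0 it is negative, but t \<ge> 2 k +
  2 lets the quadratic term outweigh it. The bound keeps \<open>nat\<close> from truncating and
  makes the fibres over the charges finite.\<close>

lemma charge_deg:
  assumes "2 * k + 1 < t"
  shows "int (charge_deg t k c) = (2 * int k + 1) * c + int t * (c * (c - 1))"
    and "\<bar>c\<bar> \<le> int (charge_deg t k c)"
proof -
  have "\<bar>c\<bar> \<le> (2 * int k + 1) * c + int t * (c * (c - 1))"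
  proof (cases "1 \<le> c")
    case True
    have "0 \<le> int t * (c * (c - 1))" using True by simp
    moreover have "(2 * int k + 1) * c = 2 * int k * c + c" "0 \<le> 2 * int k * c" using True by (simp_all add: distrib_right)
    ultimately show ?thesis using True by linarith
  next
    case False
    have "(2 * int k + 2) * (- c) \<le> int t * (- c)" using assms False by (intro mult_right_mono) auto
    moreover have "int t * (- c) * 1 \<le> int t * (- c) * (1 - c)" using False by (intro mult_left_mono) (auto simp: mult_nonneg_nonpos)
    moreover have "(2 * int k + 2) * (- c) = - ((2 * int k + 1) * c) - c"
      "int t * (- c) * (1 - c) = int t * (c * (c - 1))" by (simp_all add: algebra_simps)
    ultimately show ?thesis using False by linarith
  qed
  then show "int (charge_deg t k c) = (2 * int k + 1) * c + int t * (c * (c - 1))"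
    "\<bar>c\<bar> \<le> int (charge_deg t k c)" unfolding charge_deg_def by linarith+
qed

lemma finite_fibres_charge_deg:
  assumes "2 * k + 1 < t" shows "finite_fibres (charge_deg t k) UNIV"
  unfolding finite_fibres_def
proof
  fix n
  have "{c \<in> UNIV. charge_deg t k c = n} \<subseteq> {- int n..int n}"
  proof
    fix c assume "c \<in> {c \<in> UNIV. charge_deg t k c = n}"
    then show "c \<in> {- int n..int n}" using charge_deg(2)[OF assms, of c] by auto
  qed
  then show "finite {c \<in> UNIV. charge_deg t k c = n}" by (rule finite_subset) simp
qed

lemma en_affine: "en (\<lambda>m. a + b * m) M = a * charge M + b * en (\<lambda>m. m) M"
proof -
  have "sum (\<lambda>m. a + b * m) X = a * int (card X) + b * sum (\<lambda>m. m) X" for X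
    by (simp add: sum.distrib sum_distrib_left)
  then show ?thesis by (simp add: en_def charge_def right_diff_distrib)
qed

lemma bij_shift: "bij_betw (\<lambda>(c, M). shift c M) (UNIV \<times> maya0) (Collect maya)"
  by (rule bij_betw_byWitness[of _ "\<lambda>M. (charge M, shift (- charge M) M)"])
    (auto simp: maya0_def charge_shift)

definition runner_deg :: "nat \<Rightarrow> nat \<Rightarrow> int set \<Rightarrow> nat" where
  "runner_deg t k M = charge_deg t k (charge M) + 2 * t * card (invs M)"

lemma int_runner_deg:
  assumes "2 * k + 1 < t" "maya M"
  shows "int (runner_deg t k M) = (2 * int k + 1) * charge M + 2 * int t * en (\<lambda>m. m) M"
proof -
  have "2 * int t * en (\<lambda>m. m) M = int t * (2 * int (card (invs M)) + charge M * (charge M - 1))"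
    using energy[OF assms(2)] by (metis mult.assoc mult.commute)
  then show ?thesis by (simp add: runner_deg_def charge_deg(1)[OF assms(1)] algebra_simps)
qed

lemma runner_deg_shift:
  "p \<in> UNIV \<times> maya0 \<Longrightarrow> runner_deg t k ((\<lambda>(c, M). shift c M) p)
    = (\<lambda>(c, M). charge_deg t k c + 2 * t * card (invs M)) p"
  by (auto simp: runner_deg_def charge_shift maya0_def)

lemma finite_fibres_maya0_deg: "0 < c \<Longrightarrow> finite_fibres (\<lambda>M. c * card (invs M)) maya0"
  by (rule finite_fibres_mult[OF finite_fibres_maya0])

lemma finite_fibres_runner_deg:
  assumes "2 * k + 1 < t" shows "finite_fibres (runner_deg t k) (Collect maya)"
proof -
  have "finite_fibres (\<lambda>(c, M). charge_deg t k c + 2 * t * card (invs M)) (UNIV \<times> maya0)"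
    using assms by (intro finite_fibres_times finite_fibres_charge_deg finite_fibres_maya0_deg) simp_all
  then have "finite_fibres (\<lambda>p. runner_deg t k ((\<lambda>(c, M). shift c M) p)) (UNIV \<times> maya0)"
    unfolding finite_fibres_def using runner_deg_shift by (auto cong: conj_cong)
  then show ?thesis by (simp only: finite_fibres_reindex[OF bij_shift])
qed

lemma gf_maya:
  fixes w :: "int set \<Rightarrow> laurent"
  assumes "2 * k + 1 < t" and inv: "\<And>c M. w (shift c M) = w M"
  shows "gf (Collect maya) (runner_deg t k) (\<lambda>M. Poly_Mapping.single (charge_sign k * charge M) 1 * w M)
      = theta t k * gf maya0 (\<lambda>M. 2 * t * card (invs M)) w"
proof -
  let ?d = "\<lambda>(c, M). charge_deg t k c + 2 * t * card (invs M)"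
  have "gf (Collect maya) (runner_deg t k) (\<lambda>M. Poly_Mapping.single (charge_sign k * charge M) 1 * w M)
      = gf (UNIV \<times> maya0) ?d (\<lambda>(c, M). Poly_Mapping.single (charge_sign k * c) 1 * w M)"
    unfolding gf_reindex[OF bij_shift]
    by (rule gf_cong) (auto simp: inv charge_shift maya0_def runner_deg_def)
  also have "\<dots> = theta t k * gf maya0 (\<lambda>M. 2 * t * card (invs M)) w"
    unfolding theta_def
    using assms(1) by (intro gf_times finite_fibres_charge_deg finite_fibres_maya0_deg) simp_all
  finally show ?thesis .
qed

lemma prod_single:
  "(\<Prod>k\<in>A. Poly_Mapping.single (f k) (1 :: real poly)) = Poly_Mapping.single (sum f A :: int) 1"
  by (induction A rule: infinite_finite_induct) (simp_all add: mult_single)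

context
  fixes t u :: nat
  assumes t: "t = 2 * u" "0 < u"
begin

lemma deg_runners:
  assumes S: "S \<in> sym_maya"
  shows "nat (en (\<lambda>s. s) S) = (\<Sum>k<u. runner_deg t k (runners t S k))"
proof -
  have "en (\<lambda>s. s) S = (\<Sum>k<u. en (\<lambda>m. (2 * int k + 1) + (2 * int t) * m) (runner t k S))"
    unfolding en_runners[OF t S] by (simp add: algebra_simps)
  also have "\<dots> = (\<Sum>k<u. int (runner_deg t k (runners t S k)))"
  proof (rule sum.cong[OF refl])
    fix i assume "i \<in> {..<u}"
    then have i: "i < u" "2 * i + 1 < t" using t by simp_all
    have "maya (runner t i S)" using maya_runner[OF t _ i(1), of S] S by (simp add: sym_maya_def)
    then show "en (\<lambda>m. (2 * int i + 1) + (2 * int t) * m) (runner t i S) = int (runner_deg t i (runners t S i))"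
      unfolding runners_apply[OF t i(1)] en_affine by (simp only: int_runner_deg[OF i(2)])
  qed
  finally show ?thesis by (simp add: of_nat_sum[symmetric] del: of_nat_sum)
qed

text \<open>As t is even, k + t m has the parity of k and its mirror image the opposite one. The
  difference of \<open>even_ind\<close> is a constant sign, so only the charge of each runner
  matters.\<close>

lemma sign_runners:
  assumes S: "S \<in> sym_maya"
  shows "en even_ind S = (\<Sum>k<u. charge_sign k * charge (runner t k S))"
proof -
  have "even_ind (int k + int t * m) - even_ind (- 1 - int k - int t * m) = charge_sign k + 0 * m" for k m
    using t by (auto simp: even_ind_def charge_sign_def)
  then show ?thesis
    unfolding en_runners[OF t S] by (simp only: en_affine) simp
qed

lemma finite_fibres_runners:
  "finite_fibres (\<lambda>f. \<Sum>k<u. runner_deg t k (f k)) (PiE {..<u} (\<lambda>_. Collect maya))"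
  using t by (intro gf_PiE(1) finite_fibres_runner_deg) simp

lemma finite_fibres_sym_maya: "finite_fibres (\<lambda>S. nat (en (\<lambda>s. s) S)) sym_maya"
proof -
  have "finite_fibres (\<lambda>S. \<Sum>k<u. runner_deg t k (runners t S k)) sym_maya"
    by (rule iffD1[OF finite_fibres_reindex[OF bij_runners[OF t]] finite_fibres_runners])
  then show ?thesis unfolding finite_fibres_def using deg_runners by (auto cong: conj_cong)
qed

text \<open>The weight is kept general because two of them are inserted: w = 1 fixes the product of
  the theta series, and \<open>hook_coeff\<close> is the weight of the theorem.\<close>

theorem gf_sym_maya:
  fixes w :: "int set \<Rightarrow> laurent"
  assumes inv: "\<And>c M. w (shift c M) = w M"
  shows "gf sym_maya (\<lambda>S. nat (en (\<lambda>s. s) S))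
        (\<lambda>S. Poly_Mapping.single (en even_ind S) 1 * (\<Prod>k<u. w (runner t k S)))
      = (\<Prod>k<u. theta t k) * gf maya0 (\<lambda>M. 2 * t * card (invs M)) w ^ u"
proof -
  let ?P = "PiE {..<u} (\<lambda>_. Collect maya)"
  let ?w = "\<lambda>k M. Poly_Mapping.single (charge_sign k * charge M) 1 * w M"
  have k: "2 * k + 1 < t" if "k < u" for k using that t by simp
  have w: "Poly_Mapping.single (en even_ind S) 1 * (\<Prod>k<u. w (runner t k S))
      = (\<Prod>k<u. ?w k (runners t S k))" if S: "S \<in> sym_maya" for S
    unfolding sign_runners[OF S] by (simp add: prod.distrib prod_single runners_apply[OF t])
  have "gf sym_maya (\<lambda>S. nat (en (\<lambda>s. s) S))
        (\<lambda>S. Poly_Mapping.single (en even_ind S) 1 * (\<Prod>k<u. w (runner t k S)))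
      = gf ?P (\<lambda>f. \<Sum>k<u. runner_deg t k (f k)) (\<lambda>f. \<Prod>k<u. ?w k (f k))"
    unfolding gf_reindex[OF bij_runners[OF t]] by (rule gf_cong) (simp_all only: deg_runners w)
  also have "\<dots> = (\<Prod>k<u. gf (Collect maya) (runner_deg t k) (?w k))"
    by (rule gf_PiE(2)) (rule finite_fibres_runner_deg[OF k])
  also have "\<dots> = (\<Prod>k<u. theta t k * gf maya0 (\<lambda>M. 2 * t * card (invs M)) w)"
    by (rule prod.cong[OF refl]) (simp add: gf_maya[where w = w, OF k inv])
  finally show ?thesis by (simp add: prod.distrib)
qed

end

section \<open>Symmetric diagrams as finite sets of diagonal hooks\<close>

definition sym_maya_of :: "nat set \<Rightarrow> int set" where
  "sym_maya_of D = {s. if 0 \<le> s then nat s \<in> D else nat (- 1 - s) \<notin> D}"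

lemma sym_maya_of_nonneg: "sym_maya_of D \<inter> {0..} = int ` D"
proof (rule set_eqI)
  fix s show "s \<in> sym_maya_of D \<inter> {0..} \<longleftrightarrow> s \<in> int ` D"
    by (cases s) (auto simp: sym_maya_of_def)
qed

text \<open>A symmetric diagram is determined by its nonnegative beads, which may form any finite
  set: they are the arm lengths a of the diagonal boxes, whose hooks have length 2 a + 1.\<close>

lemma bij_sym_maya_of: "bij_betw sym_maya_of {D. finite D} sym_maya"
proof (rule bij_betw_byWitness[of _ "\<lambda>S. nat ` (S \<inter> {0..})"])
  show "\<forall>D\<in>{D. finite D}. nat ` (sym_maya_of D \<inter> {0..}) = D"
    by (simp add: sym_maya_of_nonneg image_image)
  show "\<forall>S\<in>sym_maya. sym_maya_of (nat ` (S \<inter> {0..})) = S"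
  proof
    fix S assume S: "S \<in> sym_maya"
    have mem: "nat s \<in> nat ` (S \<inter> {0..}) \<longleftrightarrow> s \<in> S" if "0 \<le> s" for s
      using that by (auto simp: image_iff eq_nat_nat_iff intro!: bexI[of _ s])
    show "sym_maya_of (nat ` (S \<inter> {0..})) = S"
    proof (rule set_eqI)
      fix s
      have "s \<in> S \<longleftrightarrow> - 1 - s \<notin> S" using S unfolding sym_maya_def by blast
      then show "s \<in> sym_maya_of (nat ` (S \<inter> {0..})) \<longleftrightarrow> s \<in> S"
        unfolding sym_maya_of_def using mem[of s] mem[of "- 1 - s"] by (cases "0 \<le> s") auto
    qed
  qed
  show "sym_maya_of ` {D. finite D} \<subseteq> sym_maya"
  proof (rule image_subsetI)
    fix D :: "nat set" assume "D \<in> {D. finite D}"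
    then have D: "finite D" by simp
    have iff: "s \<in> sym_maya_of D \<longleftrightarrow> - 1 - s \<notin> sym_maya_of D" for s
      by (auto simp: sym_maya_of_def)
    have "{..<0} - sym_maya_of D \<subseteq> (\<lambda>n. - 1 - int n) ` D"
    proof
      fix s assume "s \<in> {..<0} - sym_maya_of D"
      then have "nat (- 1 - s) \<in> D" "s = - 1 - int (nat (- 1 - s))" by (auto simp: sym_maya_of_def)
      then show "s \<in> (\<lambda>n. - 1 - int n) ` D" by blast
    qed
    then have "maya (sym_maya_of D)"
      unfolding maya_def sym_maya_of_nonneg using D by (meson finite_imageI finite_subset)
    then show "sym_maya_of D \<in> sym_maya" unfolding sym_maya_def using iff by blast
  qed
  show "(\<lambda>S. nat ` (S \<inter> {0..})) ` sym_maya \<subseteq> {D. finite D}"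
  proof (rule image_subsetI)
    fix S assume "S \<in> sym_maya"
    then have "finite (S \<inter> {0..})" unfolding sym_maya_def maya_def by blast
    then show "nat ` (S \<inter> {0..}) \<in> {D. finite D}" by simp
  qed
qed

lemma en_sym_maya_of: "finite D \<Longrightarrow> en F (sym_maya_of D) = (\<Sum>a\<in>D. F (int a) - F (- 1 - int a))"
  using en_sym_maya[of "sym_maya_of D" F] bij_betwE[OF bij_sym_maya_of]
  by (simp add: sym_maya_of_nonneg sum.reindex)

text \<open>Even and odd arms are separated because their diagonal hooks, 4 j + 1 and 4 j + 3, carry
  b and 1 / b.\<close>

lemma bij_even_odd: "bij_betw (\<lambda>(A, B). (\<lambda>j :: nat. 2 * j) ` A \<union> (\<lambda>j. 2 * j + 1) ` B)
  ({D. finite D} \<times> {D. finite D}) {D. finite D}" (is "bij_betw ?g _ _")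
proof (rule bij_betw_byWitness[of _ "\<lambda>D. ({j. 2 * j \<in> D}, {j. 2 * j + 1 \<in> D})"])
  have "2 * j \<noteq> Suc (2 * i)" for i j :: nat by presburger
  then have ev: "2 * j \<in> ?g (A, B) \<longleftrightarrow> j \<in> A" and od: "2 * j + 1 \<in> ?g (A, B) \<longleftrightarrow> j \<in> B" for j A B
    by (auto simp: image_iff dest: sym)
  show "\<forall>p\<in>{D. finite D} \<times> {D. finite D}. ({j. 2 * j \<in> ?g p}, {j. 2 * j + 1 \<in> ?g p}) = p"
  proof
    fix p :: "nat set \<times> nat set"
    obtain A B where "p = (A, B)" by (cases p)
    then show "({j. 2 * j \<in> ?g p}, {j. 2 * j + 1 \<in> ?g p}) = p" by (simp only: ev od Collect_mem_eq)
  qed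
  show "\<forall>D\<in>{D. finite D}. ?g ({j. 2 * j \<in> D}, {j. 2 * j + 1 \<in> D}) = D"
  proof (intro ballI set_eqI)
    fix D :: "nat set" and n :: nat
    let ?D = "?g ({j. 2 * j \<in> D}, {j. 2 * j + 1 \<in> D})"
    show "n \<in> ?D \<longleftrightarrow> n \<in> D"
    proof (cases "even n")
      case True
      then obtain j where "n = 2 * j" by (rule evenE)
      then show ?thesis by (simp only: ev mem_Collect_eq)
    next
      case False
      then obtain j where "n = 2 * j + 1" by (rule oddE)
      then show ?thesis by (simp only: od mem_Collect_eq)
    qed
  qed
  show "?g ` ({D. finite D} \<times> {D. finite D}) \<subseteq> {D. finite D}" by auto
  have "finite {j. 2 * j \<in> D}" "finite {j. 2 * j + 1 \<in> D}" if "finite D" for D :: "nat set"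
    using finite_vimageI[OF that, of "\<lambda>j. 2 * j"] finite_vimageI[OF that, of "\<lambda>j. 2 * j + 1"]
    by (simp_all add: vimage_def inj_on_def)
  then show "(\<lambda>D. ({j. 2 * j \<in> D}, {j. 2 * j + 1 \<in> D})) ` {D :: nat set. finite D} \<subseteq> {D. finite D} \<times> {D. finite D}"
    by blast
qed

lemma qpoch_inf_eq_gf:
  "qpoch_inf (- (b_pow 1 * q_var)) (q_var ^ 4)
    = gf {D. finite D} (sum (\<lambda>j. 4 * j + 1)) (prod (\<lambda>_. Poly_Mapping.single 1 1))"
  "qpoch_inf (- (q_var ^ 3 * b_pow (- 1))) (q_var ^ 4)
    = gf {D. finite D} (sum (\<lambda>j. 4 * j + 3)) (prod (\<lambda>_. Poly_Mapping.single (- 1) 1))"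
proof -
  have 1: "1 - - (b_pow 1 * q_var) * (q_var ^ 4) ^ j = 1 + fps_const (Poly_Mapping.single 1 1) * fps_X ^ (4 * j + 1)" for j
    by (simp add: b_pow_def q_var_def power_mult[symmetric] mult.assoc)
  have 2: "1 - - (q_var ^ 3 * b_pow (- 1)) * (q_var ^ 4) ^ j = 1 + fps_const (Poly_Mapping.single (- 1) 1) * fps_X ^ (4 * j + 3)" for j
    by (simp add: b_pow_def q_var_def power_mult[symmetric] power_add mult_ac)
  show "qpoch_inf (- (b_pow 1 * q_var)) (q_var ^ 4)
    = gf {D. finite D} (sum (\<lambda>j. 4 * j + 1)) (prod (\<lambda>_. Poly_Mapping.single 1 1))"
    unfolding qpoch_inf_def 1 by (rule prodinf_eq_gf) simp
  show "qpoch_inf (- (q_var ^ 3 * b_pow (- 1))) (q_var ^ 4)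
    = gf {D. finite D} (sum (\<lambda>j. 4 * j + 3)) (prod (\<lambda>_. Poly_Mapping.single (- 1) 1))"
    unfolding qpoch_inf_def 2 by (rule prodinf_eq_gf) simp
qed

lemma gf_sym_maya_eq_qpoch:
  "gf sym_maya (\<lambda>S. nat (en (\<lambda>s. s) S)) (\<lambda>S. Poly_Mapping.single (en even_ind S) (1 :: real poly))
    = qpoch_inf (- (b_pow 1 * q_var)) (q_var ^ 4) * qpoch_inf (- (q_var ^ 3 * b_pow (- 1))) (q_var ^ 4)"
proof -
  let ?F = "{D :: nat set. finite D}"
  let ?g = "\<lambda>(A, B). (\<lambda>j :: nat. 2 * j) ` A \<union> (\<lambda>j. 2 * j + 1) ` B"
  let ?d = "\<lambda>(A, B). sum (\<lambda>j. 4 * j + 1) A + sum (\<lambda>j. 4 * j + 3) B"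
  let ?w = "\<lambda>(A, B). prod (\<lambda>_. Poly_Mapping.single 1 1) A * prod (\<lambda>_. Poly_Mapping.single (- 1) 1) B :: laurent"
  have dw: "nat (en (\<lambda>s. s) (sym_maya_of (?g p))) = ?d p"
    "Poly_Mapping.single (en even_ind (sym_maya_of (?g p))) 1 = ?w p" if "p \<in> ?F \<times> ?F" for p
  proof -
    obtain A B where p: "p = (A, B)" "finite A" "finite B" using \<open>p \<in> ?F \<times> ?F\<close> by auto
    let ?A = "(\<lambda>j :: nat. 2 * j) ` A" and ?B = "(\<lambda>j :: nat. 2 * j + 1) ` B"
    have dis: "?A \<inter> ?B = {}" by auto presburger
    have en: "en F (sym_maya_of (?g p)) = (\<Sum>j\<in>A. F (2 * int j) - F (- 1 - 2 * int j))
        + (\<Sum>j\<in>B. F (2 * int j + 1) - F (- 2 - 2 * int j))" for F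
    proof -
      have "en F (sym_maya_of (?g p)) = (\<Sum>a\<in>?A \<union> ?B. F (int a) - F (- 1 - int a))"
        using p by (simp add: en_sym_maya_of)
      also have "\<dots> = (\<Sum>a\<in>?A. F (int a) - F (- 1 - int a)) + (\<Sum>a\<in>?B. F (int a) - F (- 1 - int a))"
        by (rule sum.union_disjoint) (use p dis in auto)
      finally show ?thesis by (simp add: sum.reindex inj_on_def algebra_simps)
    qed
    have "en (\<lambda>s. s) (sym_maya_of (?g p)) = int (?d p)"
      by (subst en) (simp add: p(1) algebra_simps)
    then show "nat (en (\<lambda>s. s) (sym_maya_of (?g p))) = ?d p" by simp
    have "en even_ind (sym_maya_of (?g p)) = (\<Sum>j\<in>A. 1) + (\<Sum>j\<in>B. - 1)"
      unfolding en by (simp add: even_ind_def)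
    then show "Poly_Mapping.single (en even_ind (sym_maya_of (?g p))) 1 = ?w p"
      unfolding p(1) case_prod_conv prod_single mult_single by (simp only: mult_1)
  qed
  have fin: "finite_fibres (sum (\<lambda>j. 4 * j + 1)) ?F" "finite_fibres (sum (\<lambda>j. 4 * j + 3)) ?F"
    by (rule finite_fibres_Fin, simp)+
  have "gf sym_maya (\<lambda>S. nat (en (\<lambda>s. s) S)) (\<lambda>S. Poly_Mapping.single (en even_ind S) (1 :: real poly))
      = gf (?F \<times> ?F) ?d ?w"
    unfolding gf_reindex[OF bij_sym_maya_of] gf_reindex[OF bij_even_odd]
    by (rule gf_cong) (simp_all only: dw)
  also have "\<dots> = qpoch_inf (- (b_pow 1 * q_var)) (q_var ^ 4) * qpoch_inf (- (q_var ^ 3 * b_pow (- 1))) (q_var ^ 4)"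
    unfolding qpoch_inf_eq_gf by (rule gf_times[OF fin])
  finally show ?thesis .
qed

section \<open>Hook weights on the runners and the final identity\<close>

lemma hookw_shift: "hookw (shift c M) = hookw M"
  unfolding hookw_def prod.reindex_bij_betw[OF bij_invs_shift, symmetric]
  by (rule prod.cong) auto

lemma hook_coeff_shift: "hook_coeff t (shift c M) = hook_coeff t M"
  by (simp add: hook_coeff_def hookw_shift)

lemma prod_hook_coeff:
  "finite A \<Longrightarrow> (\<Prod>k\<in>A. hook_coeff t (R k))
    = xpoly (monom (\<Prod>k\<in>A. hookw (R k) / real t ^ card (invs (R k))) (\<Sum>k\<in>A. 2 * card (invs (R k))))"
  by (induction A rule: finite_induct) (simp_all add: hook_coeff_def xpoly_mult mult_monom)

text \<open>\<open>bij_hooks\<close> lists every inversion of a runner twice, with hook length t (a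
  - b) both times. The two square roots multiply to t (a - b), which leaves \<open>hookw\<close> of
  the runner and one factor 1 / t per inversion.\<close>

lemma hooks_dvd_runners:
  assumes t: "t = 2 * u" "0 < u" and l: "l \<in> self_conjugate_partitions"
  defines "S \<equiv> maya_of l"
  shows "size (hooks_dvd t l) = (\<Sum>k<u. 2 * card (invs (runner t k S)))"
    and "(\<Prod>h\<in>#hooks_dvd t l. 1 / sqrt (real h))
      = (\<Prod>k<u. hookw (runner t k S) / real t ^ card (invs (runner t k S)))"
proof -
  have S: "S \<in> sym_maya" using bij_betwE[OF bij_self_conjugate] l by (simp add: S_def)
  have maya: "maya S" using S by (simp add: sym_maya_def)
  let ?R = "\<lambda>k. runner t k S"
  have finR: "finite (invs (?R k))" if "k < u" for k
    using finite_invs[OF maya_runner[OF t maya that]] .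
  let ?h = "\<lambda>(k, (a, b), \<beta>). if \<beta> then (- 1 - int k - int t * b, - 1 - int k - int t * a)
      else (int k + int t * a, int k + int t * b)"
  let ?X = "SIGMA k:{..<u}. invs (?R k) \<times> (UNIV :: bool set)"
  let ?P = "{(a, b). (a, b) \<in> invs S \<and> t dvd nat (a - b)}"
  have bij: "bij_betw ?h ?X ?P" by (rule bij_hooks[OF t S])
  have "is_partition l" using l by (simp add: self_conjugate_partitions_def)
  then have "hooks_dvd t l = image_mset (\<lambda>(a, b). nat (a - b)) (filter_mset (\<lambda>p. t dvd (case p of (a, b) \<Rightarrow> nat (a - b))) (mset_set (invs S)))"
    by (simp add: hooks_dvd_eq filter_mset_image_mset S_def)
  also have "filter_mset (\<lambda>p. t dvd (case p of (a, b) \<Rightarrow> nat (a - b))) (mset_set (invs S)) = mset_set ?P"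
    by (subst filter_mset_mset_set) (auto simp: finite_invs[OF maya] intro!: arg_cong[of _ _ mset_set])
  finally have H: "hooks_dvd t l = image_mset (\<lambda>(a, b). nat (a - b)) (mset_set ?P)" .
  have "size (hooks_dvd t l) = card ?P" by (simp add: H)
  also have "\<dots> = card ?X" using bij_betw_same_card[OF bij] by simp
  also have "\<dots> = (\<Sum>k<u. card (invs (?R k) \<times> (UNIV :: bool set)))"
    by (rule card_SigmaI) (use finR in auto)
  finally show "size (hooks_dvd t l) = (\<Sum>k<u. 2 * card (invs (?R k)))"
    by (simp add: card_cartesian_product mult.commute)
  have "(\<Prod>h\<in>#hooks_dvd t l. 1 / sqrt (real h)) = (\<Prod>p\<in>?P. 1 / sqrt (real (case p of (a, b) \<Rightarrow> nat (a - b))))"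
    by (simp add: H prod_unfold_prod_mset multiset.map_comp o_def)
  also have "\<dots> = (\<Prod>x\<in>?X. 1 / sqrt (real (case ?h x of (a, b) \<Rightarrow> nat (a - b))))"
    by (rule prod.reindex_bij_betw[OF bij, symmetric])
  also have "\<dots> = (\<Prod>(k, y)\<in>?X. case y of ((a, b), \<beta>) \<Rightarrow> 1 / sqrt (real t * real_of_int (a - b)))"
  proof (rule prod.cong[OF refl])
    fix x assume "x \<in> ?X"
    then obtain k a b \<beta> where x: "x = (k, (a, b), \<beta>)" "(a, b) \<in> invs (?R k)" by auto
    then have "b < a" by (auto simp: invs_def)
    then have nn: "0 \<le> int t * (a - b)" by simp
    have eq: "(case ?h x of (a, b) \<Rightarrow> nat (a - b)) = nat (int t * (a - b))"
      by (cases \<beta>) (simp_all add: x algebra_simps)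
    have "real (case ?h x of (a, b) \<Rightarrow> nat (a - b)) = real t * real_of_int (a - b)"
      unfolding eq of_nat_nat[OF nn] by simp
    then show "1 / sqrt (real (case ?h x of (a, b) \<Rightarrow> nat (a - b)))
        = (case x of (k, y) \<Rightarrow> case y of ((a, b), \<beta>) \<Rightarrow> 1 / sqrt (real t * real_of_int (a - b)))"
      by (simp add: x)
  qed
  also have "\<dots> = (\<Prod>k<u. \<Prod>y\<in>invs (?R k) \<times> (UNIV :: bool set). case y of ((a, b), \<beta>) \<Rightarrow> 1 / sqrt (real t * real_of_int (a - b)))"
    by (rule prod.Sigma[symmetric]) (use finR in auto)
  also have "\<dots> = (\<Prod>k<u. hookw (?R k) / real t ^ card (invs (?R k)))"
  proof (rule prod.cong[OF refl])
    fix k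
    have "(\<Prod>y\<in>invs (?R k) \<times> (UNIV :: bool set). case y of ((a, b), \<beta>) \<Rightarrow> 1 / sqrt (real t * real_of_int (a - b)))
        = (\<Prod>p\<in>invs (?R k). \<Prod>\<beta>\<in>(UNIV :: bool set). case p of (a, b) \<Rightarrow> 1 / sqrt (real t * real_of_int (a - b)))"
      by (subst prod.cartesian_product) (auto intro!: prod.cong)
    also have "\<dots> = (\<Prod>p\<in>invs (?R k). (case p of (a, b) \<Rightarrow> 1 / real_of_int (a - b)) / real t)"
    proof (rule prod.cong[OF refl])
      fix p assume "p \<in> invs (?R k)"
      then obtain a b where p: "p = (a, b)" "b < a" by (auto simp: invs_def)
      then have "0 \<le> real t * real_of_int (a - b)" by simp
      then have "sqrt (real t * real_of_int (a - b)) * sqrt (real t * real_of_int (a - b)) = real t * real_of_int (a - b)"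
        by (rule real_sqrt_mult_self[THEN trans, OF abs_of_nonneg])
      then show "(\<Prod>\<beta>\<in>(UNIV :: bool set). case p of (a, b) \<Rightarrow> 1 / sqrt (real t * real_of_int (a - b)))
          = (case p of (a, b) \<Rightarrow> 1 / real_of_int (a - b)) / real t"
        by (simp add: p(1) UNIV_bool mult.commute)
    qed
    finally show "(\<Prod>y\<in>invs (?R k) \<times> (UNIV :: bool set). case y of ((a, b), \<beta>) \<Rightarrow> 1 / sqrt (real t * real_of_int (a - b)))
        = hookw (?R k) / real t ^ card (invs (?R k))"
      by (simp add: hookw_def prod_dividef)
  qed
  finally show "(\<Prod>h\<in>#hooks_dvd t l. 1 / sqrt (real h))
      = (\<Prod>k<u. hookw (?R k) / real t ^ card (invs (?R k)))" .
qed

theorem corollary4p2: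
  fixes t :: nat
  assumes "even t" and "0 < t"
  shows "((\<lambda>l. q_var ^ sum_list l * x_var ^ size (hooks_dvd t l) * b_pow (BG_rank l)
               * scalar (\<Prod>h \<in># hooks_dvd t l. 1 / sqrt (real h)))
          has_sum
          (qpoch_inf (q_var ^ (2 * t)) (q_var ^ (2 * t)) ^ (t div 2)
           * qpoch_inf (- (b_pow 1 * q_var)) (q_var ^ 4)
           * qpoch_inf (- (q_var ^ 3 * b_pow (- 1))) (q_var ^ 4)
           * exp_qseries (scalar (1 / 2) * x_var ^ 2 * q_var ^ (2 * t)
                          + scalar (1 / (4 * real t)) * x_var ^ 4 * q_var ^ (4 * t))))
         self_conjugate_partitions"
proof -
  obtain u where t: "t = 2 * u" "0 < u" using assms by (auto elim: evenE)
  define deg where "deg = (\<lambda>S. nat (en (\<lambda>s. s) S))"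
  define W where "W = (\<lambda>S. Poly_Mapping.single (en even_ind S) 1 * (\<Prod>k<u. hook_coeff t (runner t k S)))"
  define \<Theta> where "\<Theta> = (\<Prod>k<u. theta t k)"
  define E where "E = gf maya0 (\<lambda>M. 2 * t * card (invs M)) (hook_coeff t)"
  define P where "P = gf maya0 (\<lambda>M. 2 * t * card (invs M)) (\<lambda>_. 1 :: laurent)"
  define \<phi> where "\<phi> = qpoch_inf (q_var ^ (2 * t)) (q_var ^ (2 * t))"
  define B where "B = qpoch_inf (- (b_pow 1 * q_var)) (q_var ^ 4) * qpoch_inf (- (q_var ^ 3 * b_pow (- 1))) (q_var ^ 4)"
  \<comment> \<open>With weight 1 the sum is also known as the product over diagonal hooks.\<close>
  have \<Theta>P: "\<Theta> * P ^ u = B"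
    using gf_sym_maya[OF t, where w = "\<lambda>_. 1"] gf_sym_maya_eq_qpoch by (simp add: \<Theta>_def P_def B_def)
  have P\<phi>: "P * \<phi> = 1"
    unfolding P_def \<phi>_def qpoch_inf_def q_var_def by (rule partition_gf) (use assms in simp)
  \<comment> \<open>Multiplying by \<phi>^u, the inverse of P^u, takes the place of a
    division.\<close>
  have "\<Theta> = \<Theta> * (P * \<phi>) ^ u" by (simp add: P\<phi>)
  also have "\<dots> = \<phi> ^ u * (\<Theta> * P ^ u)" by (simp only: power_mult_distrib ac_simps)
  finally have \<Theta>: "\<Theta> = \<phi> ^ u * B" by (simp only: \<Theta>P)
  have "gf self_conjugate_partitions (\<lambda>l. deg (maya_of l)) (\<lambda>l. W (maya_of l)) = gf sym_maya deg W"
    by (rule gf_reindex[OF bij_self_conjugate, symmetric])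
  also have "\<dots> = \<Theta> * E ^ u"
    unfolding deg_def W_def \<Theta>_def E_def by (rule gf_sym_maya[OF t hook_coeff_shift])
  finally have G: "gf self_conjugate_partitions (\<lambda>l. deg (maya_of l)) (\<lambda>l. W (maya_of l)) = \<phi> ^ u * B * E ^ u"
    by (simp only: \<Theta>)
  have "finite_fibres (\<lambda>l. deg (maya_of l)) self_conjugate_partitions"
    using finite_fibres_sym_maya[OF t] unfolding deg_def finite_fibres_reindex[OF bij_self_conjugate] .
  from gf_has_sum[OF this, of "\<lambda>l. W (maya_of l)"]
  have sum: "((\<lambda>l. fps_const (W (maya_of l)) * fps_X ^ deg (maya_of l)) has_sum \<phi> ^ u * B * E ^ u)
      self_conjugate_partitions"
    unfolding G .
  have summand: "q_var ^ sum_list l * x_var ^ size (hooks_dvd t l) * b_pow (BG_rank l)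
      * scalar (\<Prod>h \<in># hooks_dvd t l. 1 / sqrt (real h))
    = fps_const (W (maya_of l)) * fps_X ^ deg (maya_of l)" if l: "l \<in> self_conjugate_partitions" for l
  proof -
    have part: "is_partition l" using l by (simp add: self_conjugate_partitions_def)
    have deg: "deg (maya_of l) = sum_list l"
      using sum_list_eq_en[OF part] by (simp add: deg_def)
    have "(\<Prod>k<u. hook_coeff t (runner t k (maya_of l)))
        = xpoly (monom (\<Prod>h \<in># hooks_dvd t l. 1 / sqrt (real h)) (size (hooks_dvd t l)))"
      by (simp only: prod_hook_coeff finite_lessThan hooks_dvd_runners[OF t l])
    then have "fps_const (W (maya_of l))
        = b_pow (BG_rank l) * (scalar (\<Prod>h \<in># hooks_dvd t l. 1 / sqrt (real h)) * x_var ^ size (hooks_dvd t l))"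
      by (simp only: W_def scalar_x_var b_pow_def BG_rank_eq_en[OF part] fps_const_mult)
    then show ?thesis by (simp only: deg q_var_def ac_simps)
  qed
  have tu: "t div 2 = u" using t(1) by simp
  have Eu: "exp_qseries (scalar (1 / 2) * x_var ^ 2 * q_var ^ (2 * t)
      + scalar (1 / (4 * real t)) * x_var ^ 4 * q_var ^ (4 * t)) = E ^ u"
    using hook_gf_power[OF assms] unfolding tu E_def by (rule sym)
  have rhs: "qpoch_inf (q_var ^ (2 * t)) (q_var ^ (2 * t)) ^ (t div 2)
           * qpoch_inf (- (b_pow 1 * q_var)) (q_var ^ 4)
           * qpoch_inf (- (q_var ^ 3 * b_pow (- 1))) (q_var ^ 4)
           * exp_qseries (scalar (1 / 2) * x_var ^ 2 * q_var ^ (2 * t)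
                          + scalar (1 / (4 * real t)) * x_var ^ 4 * q_var ^ (4 * t))
      = \<phi> ^ u * B * E ^ u"
    unfolding Eu tu \<phi>_def B_def by (simp only: mult.assoc)
  show ?thesis
    unfolding rhs by (rule iffD2[OF has_sum_cong[OF summand] sum])
qed

end
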